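(* Let $G$ be a finite group and let $R(G)$ be the set of isomorphism classes of irreducible complex representations of $G$. Fix partition-valued functions $\underline{\lambda},\underline{\mu},\underline{\nu}$ on $R(G)$. Then the multiplicity of $V(\underline{\nu}[n])$ in $V(\underline{\lambda}[n])\otimes V(\underline{\mu}[n])$, as representations of $S_n\ltimes G^n$, is independent of $n$ for $n\gg0$.
   Context: All representations are over $\mathbf{C}$. For a partition $\lambda$ of $n$, $\mathbf{M}_\lambda$ is the Specht module, the irreducible representation of $S_n$ indexed by $\lambda$. For a partition-valued function $\underline{\lambda}$ on $R(G)$ put $|\underline{\lambda}|=\sum_{x\in R(G)}|\underline{\lambda}(x)|$. The irreducible representations $V(\underline{\lambda})$ of the wreath product $S_n\ltimes G^n$ are indexed by the partition-valued functions $\underline{\lambda}$ on $R(G)$ with $|\underline{\lambda}|=n$, and are constructed as follows. For a representation $V$ of $G$ and a representation $W$ of $S_m$, let $V\wr W$ be $V^{\otimes m}\otimes W$ with $S_m\ltimes G^m$ acting by $(g_1,\dots,g_m)\cdot(v_1\otimes\cdots\otimes v_m\otimes w)=g_1v_1\otimes\cdots\otimes g_mv_m\otimes w$ and $\sigma\cdot(v_1\otimes\cdots\otimes v_m\otimes w)=v_{\sigma^{-1}(1)}\otimes\cdots\otimes v_{\sigma^{-1}(m)}\otimes\sigma w$. With $n_V=|\underline{\lambda}(V)|$, $V(\underline{\lambda})$ is the induction to $S_n\ltimes G^n$ of the representation $\bigotimes_{V\in R(G)}V\wr\mathbf{M}_{\underline{\lambda}(V)}$ of the subgroup $\prod_{V}(S_{n_V}\ltimes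 G^{n_V})$. For a partition-valued function $\underline{\lambda}$ of any size and $n$ sufficiently large, $\underline{\lambda}[n]$ denotes the partition-valued function on $R(G)$ of total size $n$ which agrees with $\underline{\lambda}$ on all non-trivial irreducible representations and whose value at the trivial representation $1_G$ is the partition $(n-|\underline{\lambda}|,\ \underline{\lambda}(1_G)_1,\ \underline{\lambda}(1_G)_2,\dots)$. *)

theory Defs
  imports "HOL-Algebra.Sym_Groups" "HOL-Algebra.Product_Groups" "HOL-Library.Function_Algebras"
    Complex_Main
begin

section \<open>Complex representations on spaces of functions\<close>

definition cscale :: "complex \<Rightarrow> ('x \<Rightarrow> complex) \<Rightarrow> 'x \<Rightarrow> complex" where
  "cscale c f = (\<lambda>x. c * f x)"

interpretation fun_space: vector_space cscale
  by unfold_locales (simp_all add: cscale_def fun_eq_iff algebra_simps)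

definition linear_on :: "('x \<Rightarrow> complex) set \<Rightarrow> (('x \<Rightarrow> complex) \<Rightarrow> ('y \<Rightarrow> complex)) \<Rightarrow> bool" where
  "linear_on U f \<longleftrightarrow>
     (\<forall>u\<in>U. \<forall>v\<in>U. f (u + v) = f u + f v) \<and> (\<forall>c. \<forall>u\<in>U. f (cscale c u) = cscale c (f u))"

text \<open>The underlying vector space of a representation is a subspace of \<open>'x \<Rightarrow> complex\<close>;
  the values of the action outside that subspace (and outside the carrier of the group) are
  irrelevant.\<close>

record ('g, 'x) rep =
  rep_space :: "('x \<Rightarrow> complex) set"
  rep_act :: "'g \<Rightarrow> ('x \<Rightarrow> complex) \<Rightarrow> ('x \<Rightarrow> complex)"

definition representation :: "('g, 'b) monoid_scheme \<Rightarrow> ('g, 'x) rep \<Rightarrow> bool" where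
  "representation K V \<longleftrightarrow>
     fun_space.subspace (rep_space V) \<and>
     (\<forall>g\<in>carrier K. rep_act V g ` rep_space V \<subseteq> rep_space V \<and>
        linear_on (rep_space V) (rep_act V g)) \<and>
     (\<forall>v\<in>rep_space V. rep_act V \<one>\<^bsub>K\<^esub> v = v) \<and>
     (\<forall>g\<in>carrier K. \<forall>h\<in>carrier K. \<forall>v\<in>rep_space V.
        rep_act V (g \<otimes>\<^bsub>K\<^esub> h) v = rep_act V g (rep_act V h v))"

definition rep_iso ::
  "('g, 'b) monoid_scheme \<Rightarrow> ('g, 'x) rep \<Rightarrow> ('g, 'y) rep \<Rightarrow> bool" where
  "rep_iso K V W \<longleftrightarrow>
     (\<exists>f. linear_on (rep_space V) f \<and> bij_betw f (rep_space V) (rep_space W) \<and>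
        (\<forall>g\<in>carrier K. \<forall>v\<in>rep_space V. f (rep_act V g v) = rep_act W g (f v)))"

definition irreducible_rep :: "('g, 'b) monoid_scheme \<Rightarrow> ('g, 'x) rep \<Rightarrow> bool" where
  "irreducible_rep K V \<longleftrightarrow>
     representation K V \<and> rep_space V \<noteq> {0} \<and>
     (\<forall>U. fun_space.subspace U \<and> U \<subseteq> rep_space V \<and> (\<forall>g\<in>carrier K. rep_act V g ` U \<subseteq> U)
        \<longrightarrow> U = {0} \<or> U = rep_space V)"

definition irreducible_decomposition ::
  "('g, 'b) monoid_scheme \<Rightarrow> ('g, 'x) rep \<Rightarrow> nat \<Rightarrow> (nat \<Rightarrow> ('x \<Rightarrow> complex) set) \<Rightarrow> bool" where
  "irreducible_decomposition K W k D \<longleftrightarrow>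
     (\<forall>i<k. D i \<subseteq> rep_space W \<and> irreducible_rep K (W\<lparr>rep_space := D i\<rparr>)) \<and>
     (\<forall>w\<in>rep_space W. \<exists>!d. d \<in> (\<Pi>\<^sub>E i\<in>{..<k}. D i) \<and> w = (\<Sum>i<k. d i))"

text \<open>The multiplicity is kept as a relation, so that asserting its value includes the existence
  of a decomposition and the independence of the count from the decomposition.\<close>

definition has_multiplicity ::
  "('g, 'b) monoid_scheme \<Rightarrow> ('g, 'x) rep \<Rightarrow> ('g, 'y) rep \<Rightarrow> nat \<Rightarrow> bool" where
  "has_multiplicity K V W m \<longleftrightarrow>
     representation K W \<and>
     (\<exists>k D. irreducible_decomposition K W k D) \<and>
     (\<forall>k D. irreducible_decomposition K W k D \<longrightarrow>
        card {i. i < k \<and> rep_iso K V (W\<lparr>rep_space := D i\<rparr>)} = m)"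

text \<open>Isomorphism classes of irreducible representations. An irreducible representation of a
  finite group is finite-dimensional, hence isomorphic to one on a subspace of
  \<open>nat \<Rightarrow> complex\<close>.\<close>

definition iso_class :: "('g, 'b) monoid_scheme \<Rightarrow> ('g, nat) rep \<Rightarrow> ('g, nat) rep set" where
  "iso_class G V = {W. irreducible_rep G W \<and> rep_iso G V W}"

definition irreps :: "('g, 'b) monoid_scheme \<Rightarrow> ('g, nat) rep set set" where
  "irreps G = iso_class G ` {V. irreducible_rep G V}"

definition trivial_rep :: "('g, nat) rep" where
  "trivial_rep = \<lparr>rep_space = {f. \<forall>i. i \<noteq> 0 \<longrightarrow> f i = 0}, rep_act = (\<lambda>g f. f)\<rparr>"

definition trivial_class :: "('g, 'b) monoid_scheme \<Rightarrow> ('g, nat) rep set" where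
  "trivial_class G = iso_class G trivial_rep"


section \<open>Tensor products and induction\<close>

text \<open>The tensor product of \<open>U \<subseteq> ('x \<Rightarrow> complex)\<close> and \<open>W \<subseteq> ('y \<Rightarrow> complex)\<close> is realised as the span
  of the functions \<open>(x, y) \<mapsto> u x * w y\<close>, and similarly for a family indexed by a finite set. An
  action prescribed on pure tensors is extended linearly; the extension is unique on the span.\<close>

definition pure_tensor :: "('x \<Rightarrow> complex) \<Rightarrow> ('y \<Rightarrow> complex) \<Rightarrow> 'x \<times> 'y \<Rightarrow> complex" where
  "pure_tensor u w = (\<lambda>(x, y). u x * w y)"

definition pure_tensor_family ::
  "'i set \<Rightarrow> ('i \<Rightarrow> 'x \<Rightarrow> complex) \<Rightarrow> ('i \<Rightarrow> 'x) \<Rightarrow> complex" where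
  "pure_tensor_family I v = (\<lambda>x. \<Prod>i\<in>I. v i (x i))"

definition tensor_rep :: "('g, 'x) rep \<Rightarrow> ('g, 'y) rep \<Rightarrow> ('g, 'x \<times> 'y) rep" where
  "tensor_rep V W =
     (let S = fun_space.span {pure_tensor v w | v w. v \<in> rep_space V \<and> w \<in> rep_space W}
      in \<lparr>rep_space = S,
          rep_act = (\<lambda>g. SOME T. linear_on S T \<and>
            (\<forall>v\<in>rep_space V. \<forall>w\<in>rep_space W.
               T (pure_tensor v w) = pure_tensor (rep_act V g v) (rep_act W g w)))\<rparr>)"

text \<open>The external tensor product, a representation of \<open>product_group I H\<close> when each \<open>V i\<close> is a
  representation of \<open>H i\<close>.\<close>

definition ext_tensor_rep ::
  "'i set \<Rightarrow> ('i \<Rightarrow> ('g, 'x) rep) \<Rightarrow> ('i \<Rightarrow> 'g, 'i \<Rightarrow> 'x) rep" where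
  "ext_tensor_rep I V =
     (let S = fun_space.span {pure_tensor_family I v | v. \<forall>i\<in>I. v i \<in> rep_space (V i)}
      in \<lparr>rep_space = S,
          rep_act = (\<lambda>h. SOME T. linear_on S T \<and>
            (\<forall>v. (\<forall>i\<in>I. v i \<in> rep_space (V i)) \<longrightarrow>
               T (pure_tensor_family I v) = pure_tensor_family I (\<lambda>i. rep_act (V i) (h i) (v i))))\<rparr>)"

text \<open>Induction of a representation \<open>V\<close> of \<open>H\<close> along an injective homomorphism \<open>\<phi>\<close> from \<open>H\<close> to a
  finite group \<open>K\<close>: the functions \<open>F\<close> from \<open>K\<close> to \<open>V\<close> with \<open>F (\<phi> h k) = h (F k)\<close>, on which
  \<open>K\<close> acts by right translation. Here \<open>F k\<close> is the curried function \<open>\<lambda>x. F (k, x)\<close>.\<close>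

definition induced_rep ::
  "('h, 'b) monoid_scheme \<Rightarrow> ('g, 'c) monoid_scheme \<Rightarrow> ('h \<Rightarrow> 'g) \<Rightarrow> ('h, 'x) rep
     \<Rightarrow> ('g, 'g \<times> 'x) rep" where
  "induced_rep H K \<phi> V =
     \<lparr>rep_space = {F.
        (\<forall>k\<in>carrier K. (\<lambda>x. F (k, x)) \<in> rep_space V) \<and>
        (\<forall>k. k \<notin> carrier K \<longrightarrow> (\<forall>x. F (k, x) = 0)) \<and>
        (\<forall>h\<in>carrier H. \<forall>k\<in>carrier K.
           (\<lambda>x. F (\<phi> h \<otimes>\<^bsub>K\<^esub> k, x)) = rep_act V h (\<lambda>x. F (k, x)))},
      rep_act = (\<lambda>g F (k, x). if k \<in> carrier K then F (k \<otimes>\<^bsub>K\<^esub> g, x) else 0)\<rparr>"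


section \<open>Partitions and Specht modules\<close>

definition is_partition :: "nat list \<Rightarrow> bool" where
  "is_partition xs \<longleftrightarrow> sorted_wrt (\<ge>) xs \<and> 0 \<notin> set xs"

definition cells :: "nat list \<Rightarrow> (nat \<times> nat) set" where
  "cells xs = {(i, j). i < length xs \<and> j < xs ! i}"

definition tableaux :: "nat list \<Rightarrow> (nat \<times> nat \<Rightarrow> nat) set" where
  "tableaux xs = {t. bij_betw t (cells xs) {1..sum_list xs}}"

text \<open>A tabloid is the sequence of the row sets of a tableau.\<close>

definition tabloid :: "nat list \<Rightarrow> (nat \<times> nat \<Rightarrow> nat) \<Rightarrow> nat \<Rightarrow> nat set" where
  "tabloid xs t = (\<lambda>i. {t (i, j) | j. (i, j) \<in> cells xs})"

definition column_stabilizer :: "nat list \<Rightarrow> (nat \<times> nat \<Rightarrow> nat) \<Rightarrow> (nat \<Rightarrow> nat) set" where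
  "column_stabilizer xs t =
     {p. p permutes {1..sum_list xs} \<and>
         (\<forall>(i, j)\<in>cells xs. \<exists>i'. (i', j) \<in> cells xs \<and> p (t (i, j)) = t (i', j))}"

definition polytabloid ::
  "nat list \<Rightarrow> (nat \<times> nat \<Rightarrow> nat) \<Rightarrow> (nat \<Rightarrow> nat set) \<Rightarrow> complex" where
  "polytabloid xs t =
     (\<lambda>T. \<Sum>p\<in>column_stabilizer xs t. if T = tabloid xs (p \<circ> t) then of_int (sign p) else 0)"

text \<open>The action is the linear extension of the action on tabloids, \<open>p \<cdot> T = (\<lambda>i. p ` T i)\<close>.\<close>

definition specht :: "nat list \<Rightarrow> (nat \<Rightarrow> nat, nat \<Rightarrow> nat set) rep" where
  "specht xs =
     \<lparr>rep_space = fun_space.span (polytabloid xs ` tableaux xs),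
      rep_act = (\<lambda>p f T. f (\<lambda>i. inv' p ` T i))\<rparr>"


section \<open>Wreath products and their irreducible representations\<close>

text \<open>The pair \<open>(\<sigma>, g)\<close> stands for the product \<open>g \<sigma>\<close> of \<open>g \<in> G\<^sup>n\<close> and \<open>\<sigma> \<in> S\<^sub>n\<close>, where
  \<open>\<sigma> g \<sigma>\<inverse> = (\<lambda>k. g (\<sigma>\<inverse> k))\<close>.\<close>

definition wreath_group ::
  "nat \<Rightarrow> ('g, 'b) monoid_scheme \<Rightarrow> ((nat \<Rightarrow> nat) \<times> (nat \<Rightarrow> 'g)) monoid" where
  "wreath_group n G =
     \<lparr>carrier = carrier (sym_group n) \<times> carrier (product_group {1..n} (\<lambda>_. G)),
      mult = (\<lambda>(\<sigma>, g) (\<tau>, h).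
        (\<sigma> \<otimes>\<^bsub>sym_group n\<^esub> \<tau>, g \<otimes>\<^bsub>product_group {1..n} (\<lambda>_. G)\<^esub> (\<lambda>k\<in>{1..n}. h (inv' \<sigma> k)))),
      one = (\<one>\<^bsub>sym_group n\<^esub>, \<one>\<^bsub>product_group {1..n} (\<lambda>_. G)\<^esub>)\<rparr>"

definition wreath_rep ::
  "nat \<Rightarrow> ('g, 'x) rep \<Rightarrow> (nat \<Rightarrow> nat, 'y) rep
     \<Rightarrow> ((nat \<Rightarrow> nat) \<times> (nat \<Rightarrow> 'g), (nat \<Rightarrow> 'x) \<times> 'y) rep" where
  "wreath_rep m V W =
     (let S = fun_space.span {pure_tensor (pure_tensor_family {1..m} v) w | v w.
                (\<forall>k\<in>{1..m}. v k \<in> rep_space V) \<and> w \<in> rep_space W}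
      in \<lparr>rep_space = S,
          rep_act = (\<lambda>(\<sigma>, g). SOME T. linear_on S T \<and>
            (\<forall>v w. (\<forall>k\<in>{1..m}. v k \<in> rep_space V) \<and> w \<in> rep_space W \<longrightarrow>
               T (pure_tensor (pure_tensor_family {1..m} v) w) =
               pure_tensor (pure_tensor_family {1..m} (\<lambda>k. rep_act V (g k) (v (inv' \<sigma> k))))
                 (rep_act W \<sigma> w)))\<rparr>)"

text \<open>The embedding of \<open>\<Prod>x\<in>R. (S\<^bsub>m x\<^esub> \<ltimes> G\<^bsup>m x\<^esup>)\<close> into \<open>S\<^sub>n \<ltimes> G\<^sup>n\<close>, \<open>n = (\<Sum>x\<in>R. m x)\<close>, obtained from
  an identification \<open>e\<close> of the disjoint union of the sets \<open>{1..m x}\<close> with \<open>{1..n}\<close>.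
  Different choices of \<open>e\<close> give conjugate embeddings, hence isomorphic induced representations.\<close>

definition block_bij :: "'r set \<Rightarrow> ('r \<Rightarrow> nat) \<Rightarrow> 'r \<times> nat \<Rightarrow> nat" where
  "block_bij R m = (SOME e. bij_betw e (SIGMA x:R. {1..m x}) {1..\<Sum>x\<in>R. m x})"

definition block_embedding ::
  "'r set \<Rightarrow> ('r \<Rightarrow> nat) \<Rightarrow> ('r \<Rightarrow> (nat \<Rightarrow> nat) \<times> (nat \<Rightarrow> 'g)) \<Rightarrow> (nat \<Rightarrow> nat) \<times> (nat \<Rightarrow> 'g)" where
  "block_embedding R m h =
     (let e = block_bij R m;
          n = \<Sum>x\<in>R. m x;
          pos = inv_into (SIGMA x:R. {1..m x}) e
      in ((\<lambda>j. if j \<in> {1..n} then case pos j of (x, k) \<Rightarrow> e (x, fst (h x) k) else j),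
          (\<lambda>j\<in>{1..n}. case pos j of (x, k) \<Rightarrow> snd (h x) k)))"

definition partition_valued ::
  "('g, 'b) monoid_scheme \<Rightarrow> (('g, nat) rep set \<Rightarrow> nat list) \<Rightarrow> bool" where
  "partition_valued G lam \<longleftrightarrow> (\<forall>x\<in>irreps G. is_partition (lam x))"

definition total_size ::
  "('g, 'b) monoid_scheme \<Rightarrow> (('g, nat) rep set \<Rightarrow> nat list) \<Rightarrow> nat" where
  "total_size G lam = (\<Sum>x\<in>irreps G. sum_list (lam x))"

definition wreath_irrep ::
  "('g, 'b) monoid_scheme \<Rightarrow> (('g, nat) rep set \<Rightarrow> nat list)
    \<Rightarrow> ((nat \<Rightarrow> nat) \<times> (nat \<Rightarrow> 'g),
        ((nat \<Rightarrow> nat) \<times> (nat \<Rightarrow> 'g)) \<times>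
        (('g, nat) rep set \<Rightarrow> (nat \<Rightarrow> nat) \<times> (nat \<Rightarrow> nat set))) rep" where
  "wreath_irrep G lam =
     (let m = (\<lambda>x. sum_list (lam x))
      in induced_rep
           (product_group (irreps G) (\<lambda>x. wreath_group (m x) G))
           (wreath_group (total_size G lam) G)
           (block_embedding (irreps G) m)
           (ext_tensor_rep (irreps G) (\<lambda>x. wreath_rep (m x) (SOME V. V \<in> x) (specht (lam x)))))"

text \<open>\<open>lam[n]\<close>, a partition-valued function of total size \<open>n\<close> once \<open>n\<close> is at least
  \<open>total_size G lam\<close> plus the first part of \<open>lam (trivial_class G)\<close>. (The case of the empty
  function and \<open>n = 0\<close>, which gives the list \<open>[0]\<close>, is excluded for large \<open>n\<close>.)\<close>

definition pad ::
  "('g, 'b) monoid_scheme \<Rightarrow> (('g, nat) rep set \<Rightarrow> nat list) \<Rightarrow> nat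
     \<Rightarrow> ('g, nat) rep set \<Rightarrow> nat list" where
  "pad G lam n =
     lam(trivial_class G := (n - total_size G lam) # lam (trivial_class G))"

end

theory Submission
  imports Defs "HOL-Computational_Algebra.Fundamental_Theorem_Algebra"
begin

text \<open>Write \<open>K\<^sub>n\<close> for \<open>S\<^sub>n \<ltimes> G\<^sup>n\<close> and \<open>U\<^sub>n\<close>, \<open>V\<^sub>n\<close>, \<open>W\<^sub>n\<close> for the representations attached to \<open>lam[n]\<close>,
  \<open>mu[n]\<close>, \<open>nu[n]\<close>. The proof turns the multiplicity into dimensions of spaces of invariant forms, and
  shows that these dimensions decrease with \<open>n\<close> from some point on; a decreasing sequence of natural
  numbers is eventually constant.

  For finite-dimensional representations \<open>X\<close>, \<open>Y\<close> of a finite group \<open>K\<close> consider the \<open>K\<close>-invariant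
  forms \<open>X \<times> Y \<rightarrow> \<complex>\<close> that are linear in \<open>X\<close> and conjugate-linear in \<open>Y\<close>. Averaging provides an
  invariant inner product on \<open>Y\<close>, and by the theorem of Riesz every invariant form is an intertwiner
  \<open>X \<rightarrow> Y\<close> followed by that inner product. Hence Schur's lemma shows that the dimension of the space of
  forms is the multiplicity of \<open>Y\<close> in \<open>X\<close> if \<open>Y\<close> is irreducible, and that \<open>Y\<close> is irreducible exactly if
  the forms on \<open>Y \<times> Y\<close> have dimension \<open>1\<close>. So the multiplicity of \<open>W\<^sub>n\<close> in \<open>U\<^sub>n \<otimes> V\<^sub>n\<close> is determined by
  the dimensions of the forms on \<open>(U\<^sub>n \<otimes> V\<^sub>n) \<times> W\<^sub>n\<close> and on \<open>W\<^sub>n \<times> W\<^sub>n\<close> (\<open>has_multiplicity_dim_forms\<close>).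

  These dimensions decrease because the sequences \<open>U\<close>, \<open>V\<close>, \<open>W\<close> grow stably: there is a
  \<open>K\<^sub>n\<close>-equivariant map \<open>\<iota>\<close> from the \<open>n\<close>-th to the next representation, and the latter is spanned by
  vectors \<open>x\<close> that involve a bounded number of the letters \<open>1, \<dots>, n + 1\<close>, in the sense that exchanging
  \<open>n + 1\<close> with a letter not involved in \<open>x\<close> carries \<open>x\<close> into the image of \<open>\<iota>\<close>. Tensor products inherit
  this property. If \<open>n\<close> is large, two such vectors \<open>x\<close>, \<open>y\<close> leave a common letter free; exchanging it
  with \<open>n + 1\<close> moves both into the images of the maps \<open>\<iota>\<close> and does not change the value of an invariant
  form at \<open>(x, y)\<close>. So an invariant form in degree \<open>n + 1\<close> is determined by its restriction to degree
  \<open>n\<close> (\<open>dim_forms_Suc_le\<close>).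

  Stable growth is visible in a model. The representation attached to \<open>lam[n]\<close> is spanned by vectors
  obtained as follows: distribute the letters \<open>1, \<dots>, n\<close> over the cells of all diagrams of \<open>lam[n]\<close>, put
  a vector of the irreducible representation \<open>x\<close> of \<open>G\<close> at each cell of the diagram of \<open>x\<close>, and
  antisymmetrize along the columns. Going from \<open>n\<close> to \<open>n + 1\<close> adds one cell to the first row of the
  diagram of the trivial representation. Once that row is long, the new cell is alone in its column
  and takes no part in the antisymmetrization, and the vector at it is a multiple of a fixed one since
  the trivial representation is a line. So \<open>\<iota>\<close> is the tensor product with a fixed vector at the letter
  \<open>n + 1\<close>, and the letters involved in a spanning vector are those in the remaining cells, whose
  number is bounded independently of \<open>n\<close> (\<open>model_grows_stably\<close>). Frobenius reciprocity identifies the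
  model with the induced representation (\<open>model_iso_Ind\<close>).\<close>

section \<open>Linear algebra on spaces of functions\<close>

interpretation fun_pair: vector_space_pair
  "cscale :: complex \<Rightarrow> ('x \<Rightarrow> complex) \<Rightarrow> 'x \<Rightarrow> complex"
  "cscale :: complex \<Rightarrow> ('y \<Rightarrow> complex) \<Rightarrow> 'y \<Rightarrow> complex"
  by unfold_locales

abbreviation subspace_fun :: "('x \<Rightarrow> complex) set \<Rightarrow> bool" where
  "subspace_fun \<equiv> fun_space.subspace"

(* Rewritten pointwise, a sum of functions becomes an abstraction, to which the linearity of a map
   does not apply any more. *)
lemmas fun_apply = plus_fun_apply zero_fun_apply minus_apply uminus_apply cscale_def
declare plus_fun_apply [simp del] zero_fun_apply [simp del] minus_apply [simp del]
  uminus_apply [simp del]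

lemma sum_fun_apply: "(\<Sum>i\<in>I. f i) x = (\<Sum>i\<in>I. f i x)" for f :: "'i \<Rightarrow> 'x \<Rightarrow> complex"
  by (induction I rule: infinite_finite_induct) (auto simp: fun_apply)

lemma linear_onI:
  assumes "\<And>u v. u \<in> S \<Longrightarrow> v \<in> S \<Longrightarrow> f (u + v) = f u + f v"
    and "\<And>c u. u \<in> S \<Longrightarrow> f (cscale c u) = cscale c (f u)"
  shows "linear_on S f"
  using assms by (simp add: linear_on_def)

lemma linear_on_add: "linear_on S f \<Longrightarrow> u \<in> S \<Longrightarrow> v \<in> S \<Longrightarrow> f (u + v) = f u + f v"
  and linear_on_scale: "linear_on S f \<Longrightarrow> u \<in> S \<Longrightarrow> f (cscale c u) = cscale c (f u)"
  by (simp_all add: linear_on_def)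

lemma linear_on_subset: "linear_on S f \<Longrightarrow> T \<subseteq> S \<Longrightarrow> linear_on T f"
  unfolding linear_on_def by blast

lemma linear_on_compose:
  "linear_on S f \<Longrightarrow> linear_on T g \<Longrightarrow> f ` S \<subseteq> T \<Longrightarrow> linear_on S (g \<circ> f)"
  by (auto simp: linear_on_def image_subset_iff)

lemma linear_on_0: "linear_on S f \<Longrightarrow> subspace_fun S \<Longrightarrow> f 0 = 0"
  using linear_on_scale[of S f 0 0] fun_space.subspace_0[of S] by simp

lemma linear_on_diff:
  "linear_on S f \<Longrightarrow> subspace_fun S \<Longrightarrow> u \<in> S \<Longrightarrow> v \<in> S \<Longrightarrow> f (u - v) = f u - f v"
  using linear_on_add[of S f "u - v" v] fun_space.subspace_diff[of S u v] by simp

lemma linear_on_sum: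
  "linear_on S f \<Longrightarrow> subspace_fun S \<Longrightarrow> (\<And>i. i \<in> I \<Longrightarrow> w i \<in> S) \<Longrightarrow>
    f (\<Sum>i\<in>I. w i) = (\<Sum>i\<in>I. f (w i))"
  by (induction I rule: infinite_finite_induct)
    (auto simp: linear_on_0 linear_on_add fun_space.subspace_sum)

lemma linear_on_image_span:
  assumes "linear_on (fun_space.span X) f" "\<And>x. x \<in> X \<Longrightarrow> f x \<in> T" "subspace_fun T"
    and "u \<in> fun_space.span X"
  shows "f u \<in> T"
proof -
  let ?S = "{u \<in> fun_space.span X. f u \<in> T}"
  have "subspace_fun ?S"
    using linear_on_0[OF assms(1) fun_space.subspace_span] linear_on_add[OF assms(1)]
      linear_on_scale[OF assms(1)] assms(3)
    by (intro fun_space.subspaceI)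
      (auto simp: fun_space.subspace_0 fun_space.span_zero fun_space.span_add fun_space.span_scale
        fun_space.subspace_add fun_space.subspace_scale)
  then have "fun_space.span X \<subseteq> ?S"
    by (intro fun_space.span_minimal) (auto simp: assms(2) fun_space.span_base)
  then show ?thesis using assms(4) by blast
qed

lemma linear_on_eq_on_span:
  assumes "linear_on (fun_space.span X) f" "linear_on (fun_space.span X) g"
    and "\<And>x. x \<in> X \<Longrightarrow> f x = g x" and "u \<in> fun_space.span X"
  shows "f u = g u"
proof -
  have "linear_on (fun_space.span X) (\<lambda>u. f u - g u)"
    by (rule linear_onI)
      (simp_all add: linear_on_add[OF assms(1)] linear_on_add[OF assms(2)] linear_on_scale[OF assms(1)]
        linear_on_scale[OF assms(2)] fun_space.scale_right_diff_distrib)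
  then have "f u - g u \<in> {0}"
    by (rule linear_on_image_span) (use assms(3,4) in auto)
  then show ?thesis by simp
qed

lemma subspace_image_linear_on:
  assumes "linear_on S f" "subspace_fun S"
  shows "subspace_fun (f ` S)"
proof (rule fun_space.subspaceI)
  show "0 \<in> f ` S" using linear_on_0[OF assms] fun_space.subspace_0[OF assms(2)] by force
  show "x + y \<in> f ` S" if "x \<in> f ` S" "y \<in> f ` S" for x y
    using that linear_on_add[OF assms(1)] fun_space.subspace_add[OF assms(2)] by force
  show "cscale c x \<in> f ` S" if "x \<in> f ` S" for c x
    using that by (auto simp: fun_space.subspace_scale[OF assms(2)] simp flip: linear_on_scale[OF assms(1)])
qed

lemma linear_on_inv_into:
  assumes "linear_on S f" "subspace_fun S" "inj_on f S"
  shows "linear_on (f ` S) (inv_into S f)"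
proof (rule linear_onI)
  fix u v assume "u \<in> f ` S" "v \<in> f ` S"
  then obtain a b where "a \<in> S" "b \<in> S" "u = f a" "v = f b" by auto
  then show "inv_into S f (u + v) = inv_into S f u + inv_into S f v"
    using assms by (simp add: fun_space.subspace_add flip: linear_on_add)
next
  fix c u assume "u \<in> f ` S"
  then obtain a where "a \<in> S" "u = f a" by auto
  then show "inv_into S f (cscale c u) = cscale c (inv_into S f u)"
    using assms by (simp add: fun_space.subspace_scale flip: linear_on_scale)
qed

lemma linear_on_inj_iff:
  assumes "linear_on S f" "subspace_fun S"
  shows "inj_on f S \<longleftrightarrow> (\<forall>x\<in>S. f x = 0 \<longrightarrow> x = 0)"
proof
  assume "inj_on f S"
  then show "\<forall>x\<in>S. f x = 0 \<longrightarrow> x = 0"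
    using linear_on_0[OF assms] fun_space.subspace_0[OF assms(2)] by (metis inj_onD)
next
  assume *: "\<forall>x\<in>S. f x = 0 \<longrightarrow> x = 0"
  show "inj_on f S"
  proof (rule inj_onI)
    fix x y assume xy: "x \<in> S" "y \<in> S" "f x = f y"
    then have "f (x - y) = 0" by (simp add: linear_on_diff[OF assms])
    then show "x = y" using * xy fun_space.subspace_diff[OF assms(2)] by (metis eq_iff_diff_eq_0)
  qed
qed

text \<open>Maps that are linear on a subspace only are extended to the whole space, where the theory of
  linear maps applies to them.\<close>

lemma linear_on_extend:
  assumes "linear_on S f" "subspace_fun S"
  obtains g where "Vector_Spaces.linear cscale cscale g" "\<And>x. x \<in> S \<Longrightarrow> g x = f x"
proof -
  obtain B where B: "B \<subseteq> S" "fun_space.independent B" "S \<subseteq> fun_space.span B"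
    using fun_space.maximal_independent_subset by blast
  obtain g where g: "Vector_Spaces.linear cscale cscale g" "\<forall>x\<in>B. g x = f x"
    using fun_pair.linear_independent_extend[OF B(2)] by blast
  have S: "S = fun_space.span B"
    using B fun_space.span_minimal[OF B(1) assms(2)] by auto
  have "g x = f x" if "x \<in> S" for x
  proof (rule linear_on_eq_on_span[of B])
    show "linear_on (fun_space.span B) g"
      using g(1) by (auto simp: Vector_Spaces.linear_iff linear_on_def)
    show "linear_on (fun_space.span B) f" using assms S by simp
  qed (use g that S in auto)
  with g(1) show thesis by (rule that)
qed

definition finite_dim :: "('x \<Rightarrow> complex) set \<Rightarrow> bool" where
  "finite_dim S \<longleftrightarrow> (\<exists>B. finite B \<and> S \<subseteq> fun_space.span B)"

lemma finite_dim_subset: "finite_dim T \<Longrightarrow> S \<subseteq> T \<Longrightarrow> finite_dim S"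
  by (auto simp: finite_dim_def)

lemma finite_dim_span [simp]: "finite_dim (fun_space.span S) \<longleftrightarrow> finite_dim S"
  unfolding finite_dim_def
  by (meson fun_space.span_minimal fun_space.span_superset fun_space.subspace_span subset_trans)

lemma finite_dim_finite: "finite B \<Longrightarrow> finite_dim B"
  unfolding finite_dim_def using fun_space.span_superset by blast

lemma finite_dim_Un:
  assumes "finite_dim S" "finite_dim T"
  shows "finite_dim (S \<union> T)"
proof -
  obtain A B where "finite A" "S \<subseteq> fun_space.span A" "finite B" "T \<subseteq> fun_space.span B"
    using assms by (auto simp: finite_dim_def)
  then show ?thesis unfolding finite_dim_def
    by (intro exI[of _ "A \<union> B"]) (use fun_space.span_mono[of A "A \<union> B"] fun_space.span_mono[of B "A \<union> B"] in auto)
qed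

lemma finite_dim_UN:
  "finite I \<Longrightarrow> (\<And>i. i \<in> I \<Longrightarrow> finite_dim (S i)) \<Longrightarrow> finite_dim (\<Union>i\<in>I. S i)"
  by (induction I rule: finite_induct) (auto intro: finite_dim_Un finite_dim_finite)

lemma finite_dim_basis:
  assumes "finite_dim S" "subspace_fun S"
  obtains B where "finite B" "B \<subseteq> S" "fun_space.independent B" "S = fun_space.span B"
    "card B = fun_space.dim S"
proof -
  obtain B where B: "B \<subseteq> S" "fun_space.independent B" "S \<subseteq> fun_space.span B" "card B = fun_space.dim S"
    using fun_space.basis_exists by blast
  obtain A where A: "finite A" "S \<subseteq> fun_space.span A" using assms by (auto simp: finite_dim_def)
  have "finite B" using fun_space.independent_span_bound[OF A(1) B(2)] A(2) B(1) by blast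
  moreover have "S = fun_space.span B"
    using B fun_space.span_minimal[OF B(1) assms(2)] by auto
  ultimately show thesis using B that by blast
qed

lemma finite_dim_image:
  assumes "finite_dim S" "subspace_fun S" "linear_on S f"
  shows "finite_dim (f ` S)"
proof -
  obtain B where B: "finite B" "S = fun_space.span B"
    using finite_dim_basis[OF assms(1,2)] by metis
  have "f u \<in> fun_space.span (f ` B)" if "u \<in> S" for u
    using linear_on_image_span[of B f "fun_space.span (f ` B)" u] that assms(3) B(2)
    by (simp add: fun_space.span_base)
  with B(1) show ?thesis unfolding finite_dim_def by blast
qed

lemma finite_dim_injective:
  assumes "linear_on S f" "subspace_fun S" "\<And>x. x \<in> S \<Longrightarrow> f x = 0 \<Longrightarrow> x = 0"
    and "f ` S \<subseteq> T" "finite_dim T"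
  shows "finite_dim S"
proof -
  have inj: "inj_on f S" using linear_on_inj_iff[OF assms(1,2)] assms(3) by blast
  have "finite_dim (inv_into S f ` (f ` S))"
    using finite_dim_image[OF finite_dim_subset[OF assms(5,4)] subspace_image_linear_on[OF assms(1,2)]]
      linear_on_inv_into[OF assms(1,2) inj] by blast
  then show ?thesis using inj by simp
qed

lemma dim_injective_le:
  assumes "linear_on S f" "subspace_fun S" "\<And>x. x \<in> S \<Longrightarrow> f x = 0 \<Longrightarrow> x = 0"
    and "f ` S \<subseteq> T" "finite_dim T" "subspace_fun T"
  shows "fun_space.dim S \<le> fun_space.dim T"
proof -
  obtain g where g: "Vector_Spaces.linear cscale cscale g" "\<And>x. x \<in> S \<Longrightarrow> g x = f x"
    using linear_on_extend[OF assms(1,2)] by blast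
  obtain B where B: "finite B" "B \<subseteq> S" "fun_space.independent B" "S = fun_space.span B" "card B = fun_space.dim S"
    using finite_dim_basis[OF finite_dim_injective[OF assms(1-5)] assms(2)] by metis
  obtain C where C: "finite C" "T = fun_space.span C" "card C = fun_space.dim T"
    using finite_dim_basis[OF assms(5,6)] by metis
  have inj: "inj_on g (fun_space.span B)"
    using linear_on_inj_iff[OF assms(1,2)] assms(3) g(2) B(4) by (metis inj_on_cong)
  have "fun_space.independent (g ` B)"
    using fun_pair.linear_independent_injective_image[OF g(1) B(3) inj] .
  moreover have "g ` B \<subseteq> fun_space.span C"
    using assms(4) B(2) C(2) g(2) by force
  ultimately have "card (g ` B) \<le> card C"
    using fun_space.independent_span_bound[OF C(1)] by blast
  moreover have "card (g ` B) = card B"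
    using inj by (intro card_image inj_on_subset[OF inj]) (auto intro: fun_space.span_base)
  ultimately show ?thesis using B(5) C(3) by simp
qed

lemma dim_subspace_less:
  assumes "S \<subseteq> T" "S \<noteq> T" "subspace_fun S" "subspace_fun T" "finite_dim T"
  shows "fun_space.dim S < fun_space.dim T"
proof -
  obtain B where B: "finite B" "B \<subseteq> S" "fun_space.independent B" "S = fun_space.span B" "card B = fun_space.dim S"
    using finite_dim_basis[OF finite_dim_subset[OF assms(5,1)] assms(3)] by metis
  obtain C where C: "finite C" "T = fun_space.span C" "card C = fun_space.dim T"
    using finite_dim_basis[OF assms(5,4)] by metis
  obtain t where t: "t \<in> T" "t \<notin> S" using assms by blast
  have "fun_space.independent (insert t B)"
    using fun_space.independent_insertI[of t B] t B by blast
  then have "card (insert t B) \<le> card C"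
    using fun_space.independent_span_bound[OF C(1), of "insert t B"] t B assms(1) C(2) by blast
  moreover have "t \<notin> B" using t B by auto
  ultimately show ?thesis using B C by simp
qed

lemma finite_dim_finite_support:
  assumes "finite A"
  shows "finite_dim {f :: 'x \<Rightarrow> complex. \<forall>x. x \<notin> A \<longrightarrow> f x = 0}"
proof -
  define d :: "'x \<Rightarrow> 'x \<Rightarrow> complex" where "d a = (\<lambda>x. if x = a then 1 else 0)" for a
  have "f \<in> fun_space.span (d ` A)" if f: "\<forall>x. x \<notin> A \<longrightarrow> f x = 0" for f
  proof -
    have "f = (\<Sum>a\<in>A. cscale (f a) (d a))"
      using f assms by (auto simp: fun_eq_iff sum_fun_apply cscale_def d_def if_distrib sum.delta cong: if_cong)
    also have "\<dots> \<in> fun_space.span (d ` A)"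
      by (intro fun_space.span_sum fun_space.span_scale fun_space.span_base imageI)
    finally show ?thesis .
  qed
  then show ?thesis using assms unfolding finite_dim_def by blast
qed

text \<open>The functions \<open>p\<close> and \<open>q\<close> select the variables of the two factors. Pure tensors of two functions and,
  one factor at a time, of a family of functions are of this form.\<close>

lemma span_product:
  assumes "u \<in> fun_space.span A" "w \<in> fun_space.span B"
  shows "(\<lambda>x. u (p x) * w (q x)) \<in> fun_space.span {\<lambda>x. a (p x) * b (q x) | a b. a \<in> A \<and> b \<in> B}"
    (is "_ \<in> fun_space.span ?P")
proof -
  have 1: "(\<lambda>x. a (p x) * w (q x)) \<in> fun_space.span ?P" if "a \<in> A" for a
  proof -
    have "linear_on (fun_space.span B) (\<lambda>w x. a (p x) * w (q x))"
      by (rule linear_onI) (auto simp: fun_eq_iff fun_apply algebra_simps)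
    then show ?thesis
      by (rule linear_on_image_span) (use that assms in \<open>auto intro!: fun_space.span_base\<close>)
  qed
  have "linear_on (fun_space.span A) (\<lambda>u x. u (p x) * w (q x))"
    by (rule linear_onI) (auto simp: fun_eq_iff fun_apply algebra_simps)
  then show ?thesis
    by (rule linear_on_image_span) (use 1 assms in auto)
qed

lemma finite_dim_product:
  assumes "finite_dim A" "finite_dim B"
  shows "finite_dim {\<lambda>x. a (p x) * b (q x) | a b. a \<in> A \<and> b \<in> B}"
proof -
  obtain A' B' where f: "finite A'" "A \<subseteq> fun_space.span A'" "finite B'" "B \<subseteq> fun_space.span B'"
    using assms by (auto simp: finite_dim_def)
  let ?P = "{\<lambda>x. a (p x) * b (q x) | a b. a \<in> A' \<and> b \<in> B'}"
  have "?P = (\<lambda>(a, b) x. a (p x) * b (q x)) ` (A' \<times> B')" by auto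
  then have "finite ?P" using f by simp
  moreover have "{\<lambda>x. a (p x) * b (q x) | a b. a \<in> A \<and> b \<in> B} \<subseteq> fun_space.span ?P"
    using span_product f by blast
  ultimately show ?thesis unfolding finite_dim_def by blast
qed

lemma span_pure_tensor:
  assumes "u \<in> fun_space.span A" "w \<in> fun_space.span B"
  shows "pure_tensor u w \<in> fun_space.span {pure_tensor a b | a b. a \<in> A \<and> b \<in> B}"
  using span_product[OF assms, of fst snd] by (simp add: pure_tensor_def case_prod_beta')

lemma span_pure_tensor_family:
  assumes "finite I" "\<And>i. i \<in> I \<Longrightarrow> u i \<in> fun_space.span (A i)"
  shows "pure_tensor_family I u \<in> fun_space.span {pure_tensor_family I a | a. \<forall>i\<in>I. a i \<in> A i}"
  using assms
proof (induction I rule: finite_induct)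
  case empty
  then show ?case by (auto intro!: fun_space.span_base simp: pure_tensor_family_def)
next
  case (insert i I)
  let ?P = "{pure_tensor_family I a | a. \<forall>i\<in>I. a i \<in> A i}"
  let ?P' = "{pure_tensor_family (insert i I) a | a. \<forall>i\<in>insert i I. a i \<in> A i}"
  have "pure_tensor_family (insert i I) u = (\<lambda>x. u i (x i) * pure_tensor_family I u (id x))"
    using insert by (simp add: pure_tensor_family_def)
  also have "\<dots> \<in> fun_space.span {\<lambda>x. a (x i) * b (id x) | a b. a \<in> A i \<and> b \<in> ?P}"
    by (rule span_product) (use insert in auto)
  also have "{\<lambda>x. a (x i) * b (id x) | a b. a \<in> A i \<and> b \<in> ?P} \<subseteq> ?P'"
  proof clarsimp
    fix a b assume ab: "a \<in> A i" "\<forall>i\<in>I. b i \<in> A i"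
    have "(\<lambda>x. a (x i) * pure_tensor_family I b x) = pure_tensor_family (insert i I) (b(i := a))"
      using insert(1,2) by (auto simp: pure_tensor_family_def fun_eq_iff intro!: prod.cong)
    then show "\<exists>a'. (\<lambda>x. a (x i) * pure_tensor_family I b x) = pure_tensor_family (insert i I) a' \<and>
        a' i \<in> A i \<and> (\<forall>i\<in>I. a' i \<in> A i)"
      using ab insert(2) by (intro exI[of _ "b(i := a)"]) auto
  qed
  then have "fun_space.span {\<lambda>x. a (x i) * b (id x) | a b. a \<in> A i \<and> b \<in> ?P} \<subseteq> fun_space.span ?P'"
    by (rule fun_space.span_mono)
  finally show ?case .
qed

lemma finite_dim_pure_tensor:
  assumes "finite_dim A" "finite_dim B"
  shows "finite_dim {pure_tensor a b | a b. a \<in> A \<and> b \<in> B}"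
  using finite_dim_product[OF assms, of fst snd] by (simp add: pure_tensor_def case_prod_beta')

lemma finite_dim_pure_tensor_family:
  assumes "finite I" "\<And>i. i \<in> I \<Longrightarrow> finite_dim (A i)"
  shows "finite_dim {pure_tensor_family I a | a. \<forall>i\<in>I. a i \<in> A i}"
  using assms
proof (induction I rule: finite_induct)
  case empty
  have "{pure_tensor_family {} a | a. \<forall>i\<in>{}. a i \<in> A i} = {\<lambda>_. 1}"
    by (auto simp: pure_tensor_family_def)
  then show ?case by (metis finite.emptyI finite.insertI finite_dim_finite)
next
  case (insert i I)
  let ?P = "{pure_tensor_family I a | a. \<forall>i\<in>I. a i \<in> A i}"
  have "finite_dim {\<lambda>x. a (x i) * b (id x) | a b. a \<in> A i \<and> b \<in> ?P}"
    by (rule finite_dim_product) (use insert in auto)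
  then show ?case
  proof (rule finite_dim_subset, clarify)
    fix a assume a: "\<forall>j\<in>insert i I. a j \<in> A j"
    have "pure_tensor_family (insert i I) a = (\<lambda>x. a i (x i) * pure_tensor_family I a (id x))"
      using insert by (simp add: pure_tensor_family_def)
    then show "\<exists>a' b. pure_tensor_family (insert i I) a = (\<lambda>x. a' (x i) * b (id x)) \<and> a' \<in> A i \<and> b \<in> ?P"
      using a by auto
  qed
qed

definition sesquilinear_on ::
  "('x \<Rightarrow> complex) set \<Rightarrow> ('y \<Rightarrow> complex) set \<Rightarrow> (('x \<Rightarrow> complex) \<Rightarrow> ('y \<Rightarrow> complex) \<Rightarrow> complex) \<Rightarrow> bool" where
  "sesquilinear_on W V h \<longleftrightarrow>
     (\<forall>w\<in>W. \<forall>w'\<in>W. \<forall>v\<in>V. h (w + w') v = h w v + h w' v) \<and>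
     (\<forall>c. \<forall>w\<in>W. \<forall>v\<in>V. h (cscale c w) v = c * h w v) \<and>
     (\<forall>w\<in>W. \<forall>v\<in>V. \<forall>v'\<in>V. h w (v + v') = h w v + h w v') \<and>
     (\<forall>c. \<forall>w\<in>W. \<forall>v\<in>V. h w (cscale c v) = cnj c * h w v)"

lemma sesquilinear_onI:
  assumes "\<And>w w' v. w \<in> W \<Longrightarrow> w' \<in> W \<Longrightarrow> v \<in> V \<Longrightarrow> h (w + w') v = h w v + h w' v"
    and "\<And>c w v. w \<in> W \<Longrightarrow> v \<in> V \<Longrightarrow> h (cscale c w) v = c * h w v"
    and "\<And>w v v'. w \<in> W \<Longrightarrow> v \<in> V \<Longrightarrow> v' \<in> V \<Longrightarrow> h w (v + v') = h w v + h w v'"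
    and "\<And>c w v. w \<in> W \<Longrightarrow> v \<in> V \<Longrightarrow> h w (cscale c v) = cnj c * h w v"
  shows "sesquilinear_on W V h"
  using assms unfolding sesquilinear_on_def by blast

lemma sesquilinear_onD:
  assumes "sesquilinear_on W V h"
  shows "w \<in> W \<Longrightarrow> w' \<in> W \<Longrightarrow> v \<in> V \<Longrightarrow> h (w + w') v = h w v + h w' v"
    and "w \<in> W \<Longrightarrow> v \<in> V \<Longrightarrow> h (cscale c w) v = c * h w v"
    and "w \<in> W \<Longrightarrow> v \<in> V \<Longrightarrow> v' \<in> V \<Longrightarrow> h w (v + v') = h w v + h w v'"
    and "w \<in> W \<Longrightarrow> v \<in> V \<Longrightarrow> h w (cscale c v) = cnj c * h w v"
  using assms unfolding sesquilinear_on_def by blast+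

lemma sesquilinear_on_0:
  assumes "sesquilinear_on W V h"
  shows "subspace_fun W \<Longrightarrow> v \<in> V \<Longrightarrow> h 0 v = 0"
    and "subspace_fun V \<Longrightarrow> w \<in> W \<Longrightarrow> h w 0 = 0"
  using sesquilinear_onD(2)[OF assms, of 0 v 0] sesquilinear_onD(4)[OF assms, of w 0 0]
    fun_space.subspace_0[of W] fun_space.subspace_0[of V] by auto

lemma sesquilinear_on_diff:
  assumes "sesquilinear_on W V h"
  shows "subspace_fun W \<Longrightarrow> w \<in> W \<Longrightarrow> w' \<in> W \<Longrightarrow> v \<in> V \<Longrightarrow> h (w - w') v = h w v - h w' v"
    and "subspace_fun V \<Longrightarrow> w \<in> W \<Longrightarrow> v \<in> V \<Longrightarrow> v' \<in> V \<Longrightarrow> h w (v - v') = h w v - h w v'"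
  using sesquilinear_onD(1)[OF assms, of "w - w'" w' v] sesquilinear_onD(3)[OF assms, of w "v - v'" v']
    fun_space.subspace_diff[of W w w'] fun_space.subspace_diff[of V v v'] by (auto simp: algebra_simps)

lemma sesquilinear_on_sum:
  assumes "sesquilinear_on W V h" "subspace_fun W" "v \<in> V" "\<And>i. i \<in> I \<Longrightarrow> f i \<in> W"
  shows "h (\<Sum>i\<in>I. f i) v = (\<Sum>i\<in>I. h (f i) v)"
  using assms(4)
  by (induction I rule: infinite_finite_induct)
    (auto simp: sesquilinear_on_0(1)[OF assms(1-3)] sesquilinear_onD(1)[OF assms(1)] assms(2,3)
      fun_space.subspace_sum)

lemma sesquilinear_on_eq_0:
  assumes h: "sesquilinear_on (fun_space.span A) (fun_space.span B) h"
    and 0: "\<And>a b. a \<in> A \<Longrightarrow> b \<in> B \<Longrightarrow> h a b = 0"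
    and wv: "w \<in> fun_space.span A" "v \<in> fun_space.span B"
  shows "h w v = 0"
proof -
  have 1: "h w b = 0" if b: "b \<in> fun_space.span B" and ab: "\<And>a. a \<in> A \<Longrightarrow> h a b = 0" for b
  proof -
    have "subspace_fun {w \<in> fun_space.span A. h w b = 0}"
      using sesquilinear_onD[OF h] sesquilinear_on_0[OF h] b
      by (intro fun_space.subspaceI)
        (auto simp: fun_space.span_zero fun_space.span_add fun_space.span_scale)
    then have "fun_space.span A \<subseteq> {w \<in> fun_space.span A. h w b = 0}"
      by (intro fun_space.span_minimal) (auto simp: ab fun_space.span_base)
    then show ?thesis using wv by blast
  qed
  have "subspace_fun {v \<in> fun_space.span B. \<forall>a\<in>A. h a v = 0}"
    using sesquilinear_onD[OF h] sesquilinear_on_0[OF h]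
    by (intro fun_space.subspaceI)
      (auto simp: fun_space.span_zero fun_space.span_add fun_space.span_scale fun_space.span_base)
  then have "fun_space.span B \<subseteq> {v \<in> fun_space.span B. \<forall>a\<in>A. h a v = 0}"
    by (intro fun_space.span_minimal) (auto simp: 0 fun_space.span_base)
  then show ?thesis using 1 wv by blast
qed

section \<open>Hermitian inner products\<close>

locale hermitian_space =
  fixes V :: "('x \<Rightarrow> complex) set" and h
  assumes subspace: "subspace_fun V"
    and sesquilinear: "sesquilinear_on V V h"
    and hermitian: "u \<in> V \<Longrightarrow> v \<in> V \<Longrightarrow> h v u = cnj (h u v)"
    and positive: "v \<in> V \<Longrightarrow> v \<noteq> 0 \<Longrightarrow> Re (h v v) > 0"
begin

lemma definite: "v \<in> V \<Longrightarrow> h v v = 0 \<Longrightarrow> v = 0"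
  using positive by fastforce

lemma orthogonal_projection:
  assumes U: "U \<subseteq> V" "subspace_fun U" "finite_dim U" and v: "v \<in> V"
  obtains u where "u \<in> U" "\<And>u'. u' \<in> U \<Longrightarrow> h (v - u) u' = 0"
proof -
  note s = sesquilinear_onD[OF sesquilinear] sesquilinear_on_0[OF sesquilinear, OF subspace]
    sesquilinear_on_diff[OF sesquilinear, OF subspace]
  obtain B where B: "finite B" "U = fun_space.span B" "B \<subseteq> U"
    using finite_dim_basis[OF U(3,2)] by metis
  have "\<forall>v\<in>V. \<exists>u\<in>fun_space.span B. \<forall>u'\<in>fun_space.span B. h (v - u) u' = 0"
    if "finite B" "B \<subseteq> V" for B
    using that
  proof (induction B rule: finite_induct)
    case empty
    then show ?case using s by (auto simp: fun_space.span_empty)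
  next
    case (insert b B)
    have sp: "fun_space.span B \<subseteq> V" "fun_space.span (insert b B) \<subseteq> V"
      using fun_space.span_minimal[OF _ subspace, of B]
        fun_space.span_minimal[OF _ subspace, OF insert.prems] insert.prems by blast+
    have mono: "fun_space.span B \<subseteq> fun_space.span (insert b B)" by (intro fun_space.span_mono) auto
    \<comment> \<open>Gram-Schmidt: \<open>z\<close> is the part of the new vector \<open>b\<close> that is orthogonal to the previous span, and
      \<open>cscale a z\<close> corrects the projection \<open>q\<close> of \<open>v\<close> to that span.\<close>
    obtain p where p: "p \<in> fun_space.span B" "\<forall>u'\<in>fun_space.span B. h (b - p) u' = 0"
      using insert by blast
    define z where "z = b - p"
    have zspan: "z \<in> fun_space.span (insert b B)"
      unfolding z_def
      by (intro fun_space.span_diff fun_space.span_base subsetD[OF mono p(1)]) simp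
    then have zV: "z \<in> V" by (rule subsetD[OF sp(2)])
    have span_eq: "\<exists>c y. y \<in> fun_space.span B \<and> x = cscale c z + y"
      if x: "x \<in> fun_space.span (insert b B)" for x
    proof -
      obtain c where c: "x - cscale c b \<in> fun_space.span B"
        using x[unfolded fun_space.span_breakdown_eq] by blast
      have "x = cscale c z + ((x - cscale c b) + cscale c p)"
        unfolding z_def by (simp add: fun_space.scale_right_diff_distrib)
      moreover have "(x - cscale c b) + cscale c p \<in> fun_space.span B"
        by (intro fun_space.span_add fun_space.span_scale c p(1))
      ultimately show ?thesis by blast
    qed
    show ?case
    proof
      fix v assume v: "v \<in> V"
      obtain q where q: "q \<in> fun_space.span B" "\<forall>u'\<in>fun_space.span B. h (v - q) u' = 0"
        using insert v by blast
      define a where "a = h (v - q) z / h z z"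
      have mem: "v - q \<in> V" "cscale a z \<in> V" "q \<in> V" "p \<in> V" "v - q - cscale a z \<in> V"
        using v sp(1)[THEN subsetD, OF q(1)] sp(1)[THEN subsetD, OF p(1)] zV
        by (simp_all add: fun_space.subspace_diff[OF subspace] fun_space.subspace_scale[OF subspace])
      have "h (v - q - cscale a z) u' = 0" if "u' \<in> fun_space.span (insert b B)" for u'
      proof -
        obtain c y where y: "y \<in> fun_space.span B" "u' = cscale c z + y" using span_eq \<open>u' \<in> _\<close> by blast
        then have yV: "y \<in> V" "cscale c z \<in> V"
          using subsetD[OF sp(1)] zV by (simp_all add: fun_space.subspace_scale[OF subspace])
        have "h (v - q - cscale a z) y = 0"
          using y p q mem yV zV unfolding z_def[symmetric] by (simp add: s)
        moreover have "h (v - q - cscale a z) z = 0"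
          using mem zV definite[OF zV] by (cases "z = 0") (auto simp: s a_def)
        ultimately show ?thesis using y yV mem zV by (simp add: s)
      qed
      moreover have "q + cscale a z \<in> fun_space.span (insert b B)"
        by (intro fun_space.span_add fun_space.span_scale zspan subsetD[OF mono q(1)])
      ultimately show "\<exists>u\<in>fun_space.span (insert b B). \<forall>u'\<in>fun_space.span (insert b B). h (v - u) u' = 0"
        by (intro bexI[of _ "q + cscale a z"] ballI) (simp_all add: diff_diff_eq)
    qed
  qed
  from this[of B] B U(1) v show thesis using that by blast
qed

text \<open>Up to a factor, the functional is the inner product with a vector that is orthogonal to its kernel.\<close>

lemma riesz:
  assumes fd: "finite_dim V"
    and add: "\<And>u v. u \<in> V \<Longrightarrow> v \<in> V \<Longrightarrow> f (u + v) = f u + f v"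
    and scale: "\<And>c v. v \<in> V \<Longrightarrow> f (cscale c v) = cnj c * f v"
  obtains u where "u \<in> V" "\<And>v. v \<in> V \<Longrightarrow> h u v = f v"
proof -
  note s = sesquilinear_onD[OF sesquilinear] sesquilinear_on_0[OF sesquilinear, OF subspace]
    sesquilinear_on_diff[OF sesquilinear, OF subspace]
  note sub = fun_space.subspace_diff[OF subspace] fun_space.subspace_scale[OF subspace]
    fun_space.subspace_0[OF subspace] fun_space.subspace_add[OF subspace]
  have f0: "f 0 = 0" using scale[of 0 0] sub by simp
  have diff: "f (u - v) = f u - f v" if "u \<in> V" "v \<in> V" for u v
    using add[of "u - v" v] that sub by simp
  define N where "N = {v \<in> V. f v = 0}"
  have N: "subspace_fun N" "N \<subseteq> V"
    unfolding N_def by (auto intro!: fun_space.subspaceI simp: f0 add scale sub)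
  show thesis
  proof (cases "\<forall>v\<in>V. f v = 0")
    case True
    then show thesis using that[of 0] s sub by auto
  next
    case False
    then obtain v0 where v0: "v0 \<in> V" "f v0 \<noteq> 0" by blast
    obtain p where p: "p \<in> N" "\<And>u'. u' \<in> N \<Longrightarrow> h (v0 - p) u' = 0"
      using orthogonal_projection[OF N(2,1) finite_dim_subset[OF fd N(2)] v0(1)] by blast
    define z where "z = v0 - p"
    have pV: "p \<in> V" "f p = 0" using p N_def by auto
    have z: "z \<in> V" "f z \<noteq> 0" "z \<noteq> 0" using v0 pV sub diff f0 unfolding z_def by auto
    have hz: "h z z \<noteq> 0" using z definite by blast
    show thesis
    proof (rule that[of "cscale (f z / h z z) z"])
      show "cscale (f z / h z z) z \<in> V" using z sub by simp
    next
      fix v assume v: "v \<in> V"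
      define a where "a = cnj (f v / f z)"
      have "v - cscale a z \<in> N" unfolding N_def using v z by (auto simp: sub diff scale a_def)
      then have "h z (v - cscale a z) = 0" using p by (simp add: z_def)
      then have "h z v = cnj a * h z z" using v z sub by (simp add: s)
      then show "h (cscale (f z / h z z) z) v = f v" using v z hz by (simp add: s a_def)
    qed
  qed
qed

end

text \<open>Declare a basis to be orthonormal.\<close>

lemma exists_hermitian_space:
  assumes "finite_dim V" "subspace_fun V"
  obtains h where "hermitian_space V h"
proof -
  obtain B where B: "finite B" "B \<subseteq> V" "fun_space.independent B" "V = fun_space.span B"
    using finite_dim_basis[OF assms] by metis
  define r where "r = fun_space.representation B"
  have r: "r (u + v) = (\<lambda>b. r u b + r v b)" "r (cscale c u) = (\<lambda>b. c * r u b)" if "u \<in> V" "v \<in> V" for u v c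
    using that B unfolding r_def by (auto simp: fun_space.representation_add fun_space.representation_scale)
  have nz: "\<exists>b\<in>B. r v b \<noteq> 0" if "v \<in> V" "v \<noteq> 0" for v
  proof (rule ccontr)
    assume "\<not> ?thesis"
    moreover have "(\<Sum>b\<in>B. cscale (r v b) b) = v"
      unfolding r_def using B that by (intro fun_space.sum_representation_eq) auto
    ultimately show False using that by simp
  qed
  define h where "h u v = (\<Sum>b\<in>B. r u b * cnj (r v b))" for u v
  have "hermitian_space V h"
  proof
    show "subspace_fun V" by fact
    show "sesquilinear_on V V h"
      by (rule sesquilinear_onI)
        (auto simp: h_def r sum_distrib_left algebra_simps sum.distrib)
    show "h v u = cnj (h u v)" for u v by (simp add: h_def mult.commute)
    show "Re (h v v) > 0" if v: "v \<in> V" "v \<noteq> 0" for v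
    proof -
      have "Re (h v v) = (\<Sum>b\<in>B. (cmod (r v b))\<^sup>2)"
        by (simp add: h_def complex_norm_square[symmetric])
      also obtain b where "b \<in> B" "r v b \<noteq> 0" using nz[OF v] by blast
      then have "(\<Sum>b\<in>B. (cmod (r v b))\<^sup>2) > 0"
        using B(1) by (intro sum_pos2[of B b]) auto
      finally show ?thesis .
    qed
  qed
  then show thesis by (rule that)
qed

section \<open>Representations of a finite group\<close>

lemma representationD:
  assumes "representation K V"
  shows "subspace_fun (rep_space V)"
    and "g \<in> carrier K \<Longrightarrow> v \<in> rep_space V \<Longrightarrow> rep_act V g v \<in> rep_space V"
    and "g \<in> carrier K \<Longrightarrow> linear_on (rep_space V) (rep_act V g)"
    and "v \<in> rep_space V \<Longrightarrow> rep_act V \<one>\<^bsub>K\<^esub> v = v"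
    and "g \<in> carrier K \<Longrightarrow> g' \<in> carrier K \<Longrightarrow> v \<in> rep_space V \<Longrightarrow>
      rep_act V (g \<otimes>\<^bsub>K\<^esub> g') v = rep_act V g (rep_act V g' v)"
  using assms unfolding representation_def by auto

lemma representation_inv:
  assumes "group K" "representation K V" "g \<in> carrier K" "v \<in> rep_space V"
  shows "rep_act V g (rep_act V (inv\<^bsub>K\<^esub> g) v) = v" "rep_act V (inv\<^bsub>K\<^esub> g) (rep_act V g v) = v"
  using assms representationD(4,5)[OF assms(2)]
  by (simp_all add: group.inv_closed group.r_inv group.l_inv flip: representationD(5)[OF assms(2)])

definition invariant_subspace ::
  "('g, 'b) monoid_scheme \<Rightarrow> ('g, 'x) rep \<Rightarrow> ('x \<Rightarrow> complex) set \<Rightarrow> bool" where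
  "invariant_subspace K V U \<longleftrightarrow>
     subspace_fun U \<and> U \<subseteq> rep_space V \<and> (\<forall>g\<in>carrier K. rep_act V g ` U \<subseteq> U)"

lemma irreducible_rep_iff:
  "irreducible_rep K V \<longleftrightarrow> representation K V \<and> rep_space V \<noteq> {0} \<and>
     (\<forall>U. invariant_subspace K V U \<longrightarrow> U = {0} \<or> U = rep_space V)"
  unfolding irreducible_rep_def invariant_subspace_def by blast

lemma representation_restrict:
  assumes "representation K V" "invariant_subspace K V U"
  shows "representation K (V\<lparr>rep_space := U\<rparr>)"
  using assms unfolding representation_def invariant_subspace_def
  by (auto intro: linear_on_subset)

definition invariant_form ::
  "('g, 'b) monoid_scheme \<Rightarrow> ('g, 'x) rep \<Rightarrow> ('g, 'y) rep
     \<Rightarrow> (('x \<Rightarrow> complex) \<Rightarrow> ('y \<Rightarrow> complex) \<Rightarrow> complex) \<Rightarrow> bool" where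
  "invariant_form K W V h \<longleftrightarrow>
     sesquilinear_on (rep_space W) (rep_space V) h \<and>
     (\<forall>g\<in>carrier K. \<forall>w\<in>rep_space W. \<forall>v\<in>rep_space V. h (rep_act W g w) (rep_act V g v) = h w v)"

text \<open>Average an inner product over the group.\<close>

lemma exists_invariant_inner_product:
  assumes K: "group K" "finite (carrier K)"
    and V: "representation K V" "finite_dim (rep_space V)"
  obtains h where "hermitian_space (rep_space V) h" "invariant_form K V V h"
proof -
  note D = representationD[OF V(1)]
  obtain h0 where h0: "hermitian_space (rep_space V) h0"
    using exists_hermitian_space[OF V(2) D(1)] by blast
  interpret h0: hermitian_space "rep_space V" h0 by fact
  note s = sesquilinear_onD[OF h0.sesquilinear]
  define h where "h u v = (\<Sum>g\<in>carrier K. h0 (rep_act V g u) (rep_act V g v))" for u v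
  have h0g: "sesquilinear_on (rep_space V) (rep_space V) (\<lambda>u v. h0 (rep_act V g u) (rep_act V g v))"
    if g: "g \<in> carrier K" for g
    by (rule sesquilinear_onI)
      (simp_all add: linear_on_add[OF D(3)[OF g]] linear_on_scale[OF D(3)[OF g]] s D(2)[OF g])
  have ses: "sesquilinear_on (rep_space V) (rep_space V) h"
    unfolding h_def sum_distrib_left sum.distrib[symmetric]
  proof (rule sesquilinear_onI, goal_cases)
    case (1 u u' v)
    show ?case unfolding sum.distrib[symmetric]
      by (intro sum.cong refl sesquilinear_onD(1)[OF h0g] 1)
  next
    case (2 c u v)
    show ?case unfolding sum_distrib_left
      by (intro sum.cong refl sesquilinear_onD(2)[OF h0g] 2)
  next
    case (3 u v v')
    show ?case unfolding sum.distrib[symmetric]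
      by (intro sum.cong refl sesquilinear_onD(3)[OF h0g] 3)
  next
    case (4 c u v)
    show ?case unfolding sum_distrib_left
      by (intro sum.cong refl sesquilinear_onD(4)[OF h0g] 4)
  qed
  have "hermitian_space (rep_space V) h"
  proof
    show "h v u = cnj (h u v)" if "u \<in> rep_space V" "v \<in> rep_space V" for u v
      unfolding h_def cnj_sum using D(2) that by (intro sum.cong refl h0.hermitian) auto
    show "Re (h v v) > 0" if v: "v \<in> rep_space V" "v \<noteq> 0" for v
      unfolding h_def Re_sum
    proof (rule sum_pos)
      show "carrier K \<noteq> {}" using K(1) group.is_monoid monoid.one_closed by blast
      fix g assume g: "g \<in> carrier K"
      then have "rep_act V g v \<noteq> 0"
        using representation_inv(2)[OF K(1) V(1) g v(1)] v(2)
          linear_on_0[OF D(3) D(1)] group.inv_closed[OF K(1)] by metis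
      then show "0 < Re (h0 (rep_act V g v) (rep_act V g v))" using g v D(2) h0.positive by blast
    qed fact
  qed (use D ses in auto)
  moreover have "invariant_form K V V h"
    unfolding invariant_form_def
  proof (intro conjI ballI ses)
    fix g u v assume g: "g \<in> carrier K" and uv: "u \<in> rep_space V" "v \<in> rep_space V"
    have "bij_betw (\<lambda>x. x \<otimes>\<^bsub>K\<^esub> g) (carrier K) (carrier K)"
      using g K(1) group.inj_on_multc group.surj_const_mult[OF K(1)]
      by (intro bij_betwI[where g = "\<lambda>x. x \<otimes>\<^bsub>K\<^esub> inv\<^bsub>K\<^esub> g"])
        (auto simp: group.is_monoid monoid.m_closed group.inv_closed monoid.m_assoc group.r_inv group.l_inv)
    from sum.reindex_bij_betw[OF this, of "\<lambda>x. h0 (rep_act V x u) (rep_act V x v)"]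
    show "h (rep_act V g u) (rep_act V g v) = h u v"
      unfolding h_def using g uv D(5) by simp
  qed
  ultimately show thesis by (rule that)
qed

text \<open>Maschke's theorem: the orthogonal complement for an invariant inner product is invariant.\<close>

lemma maschke:
  assumes K: "group K" "finite (carrier K)"
    and V: "representation K V" "finite_dim (rep_space V)"
    and U: "invariant_subspace K V U"
  obtains U' where "invariant_subspace K V U'" "U \<inter> U' = {0}"
    "\<And>v. v \<in> rep_space V \<Longrightarrow> \<exists>u\<in>U. \<exists>u'\<in>U'. v = u + u'"
proof -
  note D = representationD[OF V(1)]
  obtain h where h: "hermitian_space (rep_space V) h" "invariant_form K V V h"
    using exists_invariant_inner_product[OF assms(1-4)] by blast
  interpret h: hermitian_space "rep_space V" h by fact
  note s = sesquilinear_onD[OF h.sesquilinear] sesquilinear_on_0[OF h.sesquilinear, OF D(1)]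
  have inv: "h (rep_act V g u) (rep_act V g v) = h u v"
    if "g \<in> carrier K" "u \<in> rep_space V" "v \<in> rep_space V" for g u v
    using h(2) that unfolding invariant_form_def by blast
  have U': "subspace_fun U" "U \<subseteq> rep_space V" "\<And>g u. g \<in> carrier K \<Longrightarrow> u \<in> U \<Longrightarrow> rep_act V g u \<in> U"
    using U unfolding invariant_subspace_def by auto
  define C where "C = {v \<in> rep_space V. \<forall>u\<in>U. h v u = 0}"
  show thesis
  proof (rule that)
    show "invariant_subspace K V C"
      unfolding invariant_subspace_def
    proof (intro conjI ballI)
      show "subspace_fun C"
        unfolding C_def using U'(2)
        by (intro fun_space.subspaceI)
          (auto simp: s subset_iff fun_space.subspace_0[OF D(1)] fun_space.subspace_add[OF D(1)]
            fun_space.subspace_scale[OF D(1)])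
      show "C \<subseteq> rep_space V" by (auto simp: C_def)
      fix g assume g: "g \<in> carrier K"
      show "rep_act V g ` C \<subseteq> C"
      proof clarify
        fix v assume v: "v \<in> C"
        then have "h (rep_act V g v) u = 0" if "u \<in> U" for u
          using inv[of g v "rep_act V (inv\<^bsub>K\<^esub> g) u"] representation_inv[OF K(1) V(1) g, of u] that g U'
            D(2) group.inv_closed[OF K(1) g] unfolding C_def by (simp add: subset_iff)
        then show "rep_act V g v \<in> C" using v g D(2) by (auto simp: C_def)
      qed
    qed
    show "U \<inter> C = {0}"
      using h.definite U' fun_space.subspace_0[OF U'(1)] s unfolding C_def by auto
    fix v assume v: "v \<in> rep_space V"
    obtain u where u: "u \<in> U" "\<And>u'. u' \<in> U \<Longrightarrow> h (v - u) u' = 0"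
      using h.orthogonal_projection[OF U'(2,1) finite_dim_subset[OF V(2) U'(2)] v] by blast
    have "v - u \<in> C" unfolding C_def using u v U' fun_space.subspace_diff[OF D(1)] by auto
    then show "\<exists>u\<in>U. \<exists>u'\<in>C. v = u + u'" using u by (intro bexI[of _ u] bexI[of _ "v - u"]) auto
  qed
qed

section \<open>Decompositions and Schur's lemma\<close>

text \<open>A non-zero invariant subspace of least dimension is irreducible. It is split off by Maschke's theorem,
  and its complement has smaller dimension.\<close>

lemma exists_irreducible_decomposition:
  assumes K: "group K" "finite (carrier K)"
    and W: "representation K W" "finite_dim (rep_space W)"
  shows "\<exists>k D. irreducible_decomposition K W k D"
  using W
proof (induction "fun_space.dim (rep_space W)" arbitrary: W rule: less_induct)
  case less
  note sub = representationD(1)[OF less.prems(1)]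
  show ?case
  proof (cases "rep_space W = {0}")
    case True
    then have "irreducible_decomposition K W 0 (\<lambda>_. {})"
      by (auto simp: irreducible_decomposition_def)
    then show ?thesis by blast
  next
    case False
    then have ne: "invariant_subspace K W (rep_space W) \<and> rep_space W \<noteq> {0}"
      using sub representationD(2)[OF less.prems(1)] by (auto simp: invariant_subspace_def)
    obtain U where U: "invariant_subspace K W U" "U \<noteq> {0}"
      and minimal: "\<And>U'. invariant_subspace K W U' \<Longrightarrow> U' \<noteq> {0} \<Longrightarrow> fun_space.dim U \<le> fun_space.dim U'"
      using ex_has_least_nat[of "\<lambda>U. invariant_subspace K W U \<and> U \<noteq> {0}" "rep_space W" "fun_space.dim"] ne
      by blast
    have Us: "subspace_fun U" "U \<subseteq> rep_space W" using U by (auto simp: invariant_subspace_def)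
    have irr: "irreducible_rep K (W\<lparr>rep_space := U\<rparr>)"
      unfolding irreducible_rep_iff
    proof (intro conjI allI impI)
      show "representation K (W\<lparr>rep_space := U\<rparr>)" by (rule representation_restrict) fact+
      show "rep_space (W\<lparr>rep_space := U\<rparr>) \<noteq> {0}" using U by simp
      fix U1 assume "invariant_subspace K (W\<lparr>rep_space := U\<rparr>) U1"
      then have U1: "subspace_fun U1" "U1 \<subseteq> U" "invariant_subspace K W U1"
        using Us by (auto simp: invariant_subspace_def)
      show "U1 = {0} \<or> U1 = rep_space (W\<lparr>rep_space := U\<rparr>)"
        using minimal[OF U1(3)] dim_subspace_less[OF U1(2) _ U1(1) Us(1)]
          finite_dim_subset[OF less.prems(2) Us(2)] by fastforce
    qed
    obtain C where C: "invariant_subspace K W C" "U \<inter> C = {0}"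
      and sum: "\<And>v. v \<in> rep_space W \<Longrightarrow> \<exists>u\<in>U. \<exists>u'\<in>C. v = u + u'"
      using maschke[OF K less.prems U(1)] by blast
    have Cs: "subspace_fun C" "C \<subseteq> rep_space W" using C by (auto simp: invariant_subspace_def)
    have "C \<noteq> rep_space W" using C(2) U(2) Us fun_space.subspace_0[OF Us(1)] by blast
    then have "fun_space.dim C < fun_space.dim (rep_space W)"
      using dim_subspace_less[OF Cs(2) _ Cs(1) sub less.prems(2)] by blast
    then obtain k D where D: "irreducible_decomposition K (W\<lparr>rep_space := C\<rparr>) k D"
      using less.hyps[of "W\<lparr>rep_space := C\<rparr>"] representation_restrict[OF less.prems(1) C(1)]
        finite_dim_subset[OF less.prems(2) Cs(2)] by auto
    have DC: "\<And>i. i < k \<Longrightarrow> D i \<subseteq> C" "\<And>i. i < k \<Longrightarrow> irreducible_rep K (W\<lparr>rep_space := D i\<rparr>)"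
      and Dex: "\<And>w. w \<in> C \<Longrightarrow> \<exists>!d. d \<in> (\<Pi>\<^sub>E i\<in>{..<k}. D i) \<and> w = (\<Sum>i<k. d i)"
      using D unfolding irreducible_decomposition_def by auto
    let ?D = "D(k := U)"
    have "irreducible_decomposition K W (Suc k) ?D"
      unfolding irreducible_decomposition_def
    proof (intro conjI allI impI ballI)
      fix i assume "i < Suc k"
      then show "?D i \<subseteq> rep_space W" "irreducible_rep K (W\<lparr>rep_space := ?D i\<rparr>)"
        using DC Cs Us irr by (auto simp: less_Suc_eq)
    next
      fix w assume "w \<in> rep_space W"
      then obtain u c where uc: "u \<in> U" "c \<in> C" "w = u + c" using sum by blast
      obtain d where d: "d \<in> (\<Pi>\<^sub>E i\<in>{..<k}. D i)" "c = (\<Sum>i<k. d i)"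
        and d_unique: "\<And>e. e \<in> (\<Pi>\<^sub>E i\<in>{..<k}. D i) \<Longrightarrow> c = (\<Sum>i<k. e i) \<Longrightarrow> e = d"
        using Dex[OF uc(2)] by blast
      show "\<exists>!d. d \<in> (\<Pi>\<^sub>E i\<in>{..<Suc k}. ?D i) \<and> w = (\<Sum>i<Suc k. d i)"
      proof (rule ex1I[of _ "d(k := u)"])
        show "d(k := u) \<in> (\<Pi>\<^sub>E i\<in>{..<Suc k}. ?D i) \<and> w = (\<Sum>i<Suc k. (d(k := u)) i)"
          using d uc by (auto simp: PiE_iff less_Suc_eq extensional_def add.commute)
        fix e assume e: "e \<in> (\<Pi>\<^sub>E i\<in>{..<Suc k}. ?D i) \<and> w = (\<Sum>i<Suc k. e i)"
        then have mem: "e i \<in> ?D i" if "i < Suc k" for i using that by (auto simp: PiE_iff)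
        have ek: "e k \<in> U" "\<And>i. i < k \<Longrightarrow> e i \<in> D i"
          using mem[of k] by simp (use mem in \<open>metis fun_upd_other less_SucI less_irrefl\<close>)
        have s: "(\<Sum>i<k. e i) \<in> C" using ek DC Cs by (intro fun_space.subspace_sum) auto
        have "u - e k = (\<Sum>i<k. e i) - c" using e uc by (simp add: algebra_simps)
        then have "u - e k \<in> U \<inter> C"
          using fun_space.subspace_diff[OF Us(1) uc(1) ek(1)] fun_space.subspace_diff[OF Cs(1) s uc(2)]
          by simp
        then have eq: "e k = u" "(\<Sum>i<k. e i) = c" using C(2) \<open>u - e k = _\<close> by auto
        have "restrict e {..<k} = d"
          by (rule d_unique) (use ek eq in auto)
        then show "e = d(k := u)"
          using e eq by (auto simp: fun_eq_iff PiE_iff extensional_def less_Suc_eq split: if_splits)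
      qed
    qed
    then show ?thesis by blast
  qed
qed

definition intertwiner ::
  "('g, 'b) monoid_scheme \<Rightarrow> ('g, 'x) rep \<Rightarrow> ('g, 'y) rep \<Rightarrow> (('x \<Rightarrow> complex) \<Rightarrow> 'y \<Rightarrow> complex) \<Rightarrow> bool" where
  "intertwiner K V W T \<longleftrightarrow> linear_on (rep_space V) T \<and> T ` rep_space V \<subseteq> rep_space W \<and>
     (\<forall>g\<in>carrier K. \<forall>v\<in>rep_space V. T (rep_act V g v) = rep_act W g (T v))"

lemma intertwinerD:
  assumes "intertwiner K V W T"
  shows "linear_on (rep_space V) T"
    and "v \<in> rep_space V \<Longrightarrow> T v \<in> rep_space W"
    and "g \<in> carrier K \<Longrightarrow> v \<in> rep_space V \<Longrightarrow> T (rep_act V g v) = rep_act W g (T v)"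
  using assms unfolding intertwiner_def by auto

lemma rep_iso_iff:
  "rep_iso K V W \<longleftrightarrow> (\<exists>T. intertwiner K V W T \<and> bij_betw T (rep_space V) (rep_space W))"
  unfolding rep_iso_def intertwiner_def by (auto simp: bij_betw_def)

lemma intertwiner_inverse:
  assumes "intertwiner K V W T" "bij_betw T (rep_space V) (rep_space W)" "representation K V"
  shows "intertwiner K W V (inv_into (rep_space V) T)"
    and "bij_betw (inv_into (rep_space V) T) (rep_space W) (rep_space V)"
proof -
  note T = intertwinerD[OF assms(1)] and V = representationD[OF assms(3)]
  have inj: "inj_on T (rep_space V)" "rep_space W = T ` rep_space V"
    using assms(2) by (auto simp: bij_betw_def)
  show "bij_betw (inv_into (rep_space V) T) (rep_space W) (rep_space V)"
    by (rule bij_betw_inv_into) fact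
  show "intertwiner K W V (inv_into (rep_space V) T)"
    unfolding intertwiner_def inj(2)
    using linear_on_inv_into[OF T(1) V(1) inj(1)] inj(1) V(2)
    by (auto simp flip: T(3))
qed

lemma intertwiner_compose:
  assumes "intertwiner K U V S" "intertwiner K V W T"
  shows "intertwiner K U W (T \<circ> S)"
  using intertwinerD[OF assms(1)] intertwinerD[OF assms(2)] unfolding intertwiner_def
  by (auto intro: linear_on_compose)

lemma rep_iso_sym: "representation K V \<Longrightarrow> rep_iso K V W \<Longrightarrow> rep_iso K W V"
  unfolding rep_iso_iff using intertwiner_inverse by blast

lemma rep_iso_trans: "rep_iso K U V \<Longrightarrow> rep_iso K V W \<Longrightarrow> rep_iso K U W"
  unfolding rep_iso_iff using intertwiner_compose bij_betw_trans by blast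

lemma rep_iso_refl: "rep_iso K V V"
  unfolding rep_iso_def by (intro exI[of _ id]) (auto simp: linear_on_def bij_betw_def)

lemma kernel_invariant:
  assumes "representation K V" "representation K W" "intertwiner K V W T"
  shows "invariant_subspace K V {v \<in> rep_space V. T v = 0}"
proof -
  note V = representationD[OF assms(1)] and W = representationD[OF assms(2)] and T = intertwinerD[OF assms(3)]
  show ?thesis
    unfolding invariant_subspace_def
    using linear_on_0[OF T(1) V(1)] linear_on_0[OF W(3) W(1)] V(2) T(3)
    by (auto intro!: fun_space.subspaceI simp: linear_on_add[OF T(1)] linear_on_scale[OF T(1)]
        fun_space.subspace_0[OF V(1)] fun_space.subspace_add[OF V(1)] fun_space.subspace_scale[OF V(1)])
qed

lemma image_invariant:
  assumes "representation K V" "intertwiner K V W T"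
  shows "invariant_subspace K W (T ` rep_space V)"
proof -
  note V = representationD[OF assms(1)] and T = intertwinerD[OF assms(2)]
  show ?thesis
    unfolding invariant_subspace_def
    using subspace_image_linear_on[OF T(1) V(1)] T(2) V(2) by (auto simp flip: T(3))
qed

text \<open>The kernel and the image of an intertwiner are invariant.\<close>

lemma schur_bijective:
  assumes "irreducible_rep K V" "irreducible_rep K W" "intertwiner K V W T"
    and "v \<in> rep_space V" "T v \<noteq> 0"
  shows "bij_betw T (rep_space V) (rep_space W)"
proof -
  have V: "representation K V" "representation K W"
    and irr: "\<And>U. invariant_subspace K V U \<Longrightarrow> U = {0} \<or> U = rep_space V"
      "\<And>U. invariant_subspace K W U \<Longrightarrow> U = {0} \<or> U = rep_space W"
    using assms(1,2) unfolding irreducible_rep_iff by auto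
  have "{v \<in> rep_space V. T v = 0} = {0}"
    using irr(1)[OF kernel_invariant[OF V assms(3)]] assms(4,5) by blast
  then have "inj_on T (rep_space V)"
    using linear_on_inj_iff[OF intertwinerD(1)[OF assms(3)] representationD(1)[OF V(1)]] by blast
  moreover have "T ` rep_space V = rep_space W"
    using irr(2)[OF image_invariant[OF V(1) assms(3)]] assms(4,5) by blast
  ultimately show ?thesis by (simp add: bij_betw_def)
qed

text \<open>The vector \<open>p(T) v\<close>, by Horner's rule.\<close>

definition poly_at :: "(('x \<Rightarrow> complex) \<Rightarrow> 'x \<Rightarrow> complex) \<Rightarrow> ('x \<Rightarrow> complex) \<Rightarrow> complex poly \<Rightarrow> 'x \<Rightarrow> complex" where
  "poly_at T v p = fold_coeffs (\<lambda>a u. cscale a v + T u) p 0"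

lemma poly_at_simps:
  assumes "Vector_Spaces.linear cscale cscale T"
  shows "poly_at T v 0 = 0"
    and "poly_at T v (pCons a p) = cscale a v + T (poly_at T v p)"
    and "poly_at T v (p + q) = poly_at T v p + poly_at T v q"
    and "poly_at T v (smult c p) = cscale c (poly_at T v p)"
proof -
  have T: "T (u + w) = T u + T w" "T (cscale c u) = cscale c (T u)" "T 0 = 0" for u w c
    using assms fun_pair.linear_0[OF assms] by (auto simp: Vector_Spaces.linear_iff)
  show 0: "poly_at T v 0 = 0" by (simp add: poly_at_def)
  show pCons: "poly_at T v (pCons a p) = cscale a v + T (poly_at T v p)" for a p
    by (cases "p = 0 \<and> a = 0") (auto simp: poly_at_def T)
  show "poly_at T v (p + q) = poly_at T v p + poly_at T v q"
    by (induction p q rule: poly_induct2)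
      (simp_all add: 0 pCons T fun_space.scale_left_distrib algebra_simps)
  show "poly_at T v (smult c p) = cscale c (poly_at T v p)"
    by (induction p) (simp_all add: 0 pCons T fun_space.scale_right_distrib)
qed

lemma poly_at_monom:
  assumes "Vector_Spaces.linear cscale cscale T"
  shows "poly_at T v (monom c i) = cscale c ((T ^^ i) v)"
proof -
  have T: "T (cscale c u) = cscale c (T u)" "T 0 = 0" for u c
    using assms fun_pair.linear_0[OF assms] by (auto simp: Vector_Spaces.linear_iff)
  show ?thesis
    by (induction i) (simp_all add: monom_0 monom_Suc poly_at_simps[OF assms] T)
qed

lemma poly_at_sum:
  assumes "Vector_Spaces.linear cscale cscale T"
  shows "poly_at T v (\<Sum>i\<in>I. f i) = (\<Sum>i\<in>I. poly_at T v (f i))"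
  by (induction I rule: infinite_finite_induct) (simp_all add: poly_at_simps[OF assms])

lemma poly_at_closed:
  assumes "subspace_fun V" "T ` V \<subseteq> V" "v \<in> V" "Vector_Spaces.linear cscale cscale T"
  shows "poly_at T v p \<in> V"
  using assms(1-3)
  by (induction p)
    (auto simp: poly_at_simps[OF assms(4)] fun_space.subspace_0 fun_space.subspace_add fun_space.subspace_scale)

text \<open>Let \<open>p(x) = (x - z) q(x)\<close>. Either \<open>q(T) v = 0\<close> and \<open>q\<close> has smaller degree, or \<open>q(T) v\<close> is an eigenvector
  with eigenvalue \<open>z\<close>.\<close>

lemma eigenvector_of_annihilator:
  assumes T: "Vector_Spaces.linear cscale cscale T" and V: "subspace_fun V" "T ` V \<subseteq> V" "v \<in> V" "v \<noteq> 0"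
    and p: "p \<noteq> 0" "poly_at T v p = 0"
  shows "\<exists>c u. u \<in> V \<and> u \<noteq> 0 \<and> T u = cscale c u"
  using p
proof (induction "degree p" arbitrary: p rule: less_induct)
  case less
  show ?case
  proof (cases "degree p = 0")
    case True
    then obtain c where "p = [:c:]" by (auto elim: degree_eq_zeroE)
    then show ?thesis
      using less.prems V fun_pair.linear_0[OF T] by (auto simp: poly_at_simps[OF T])
  next
    case False
    then obtain z where "poly p z = 0"
      using fundamental_theorem_of_algebra[of p] by (auto simp: constant_degree)
    then obtain q where q: "p = [:- z, 1:] * q" by (metis dvdE poly_eq_0_iff_dvd)
    then have q0: "q \<noteq> 0" using less.prems by auto
    then have "degree p = degree [:- z, 1:] + degree q" unfolding q by (intro degree_mult_eq) auto
    then have deg: "degree q < degree p" by simp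
    let ?u = "poly_at T v q"
    have "p = pCons 0 q + smult (- z) q" unfolding q by simp
    then have "poly_at T v p = cscale 0 v + T ?u + cscale (- z) ?u"
      by (simp only: poly_at_simps[OF T])
    then have "poly_at T v p = T ?u - cscale z ?u" by simp
    then show ?thesis
      using less.hyps[OF deg q0] less.prems poly_at_closed[OF V(1-3) T, of q] by auto
  qed
qed

text \<open>Among the vectors \<open>T\<^sup>i v\<close> with \<open>i \<le> dim V\<close> two coincide, or there is a linear relation.\<close>

lemma exists_annihilator:
  assumes T: "Vector_Spaces.linear cscale cscale T"
    and V: "subspace_fun V" "T ` V \<subseteq> V" "v \<in> V" "finite_dim V"
  shows "\<exists>p. p \<noteq> 0 \<and> poly_at T v p = 0"
proof -
  obtain B where B: "finite B" "V = fun_space.span B" using finite_dim_basis[OF V(4,1)] by metis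
  let ?f = "\<lambda>i. (T ^^ i) v"
  have inV: "?f i \<in> V" for i by (induction i) (use V in auto)
  show ?thesis
  proof (cases "inj_on ?f {..card B}")
    case False
    then obtain i j where ij: "i < j" "?f i = ?f j"
      unfolding inj_on_def by (metis linorder_neqE_nat)
    have "coeff (monom 1 j + monom (-1) i :: complex poly) j \<noteq> 0" using ij by simp
    then have "monom 1 j + monom (-1) i \<noteq> (0 :: complex poly)" by (metis coeff_0)
    moreover have "poly_at T v (monom 1 j + monom (-1) i) = 0"
      using ij by (simp add: poly_at_simps[OF T] poly_at_monom[OF T])
    ultimately show ?thesis by blast
  next
    case True
    have "\<not> fun_space.independent (?f ` {..card B})"
    proof
      assume "fun_space.independent (?f ` {..card B})"
      then have "card (?f ` {..card B}) \<le> card B"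
        using fun_space.independent_span_bound[OF B(1)] inV B(2) by blast
      then show False using card_image[OF True] by simp
    qed
    then obtain u where u: "\<exists>w\<in>?f ` {..card B}. u w \<noteq> 0" "(\<Sum>w\<in>?f ` {..card B}. cscale (u w) w) = 0"
      using fun_space.dependent_finite[of "?f ` {..card B}"] by auto
    define p where "p = (\<Sum>i\<in>{..card B}. monom (u (?f i)) i)"
    obtain j where j: "j \<le> card B" "u (?f j) \<noteq> 0" using u by auto
    have "coeff p j = u (?f j)" using j by (simp add: p_def coeff_sum)
    then have "p \<noteq> 0" using j by auto
    moreover have "poly_at T v p = 0"
      using u(2) unfolding p_def by (simp add: poly_at_sum[OF T] poly_at_monom[OF T] sum.reindex[OF True])
    ultimately show ?thesis by blast
  qed
qed

text \<open>The eigenspace of an eigenvalue is invariant and not zero, hence everything.\<close>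

lemma schur_scalar:
  assumes V: "irreducible_rep K V" "finite_dim (rep_space V)" and T: "intertwiner K V V T"
  obtains c where "\<And>v. v \<in> rep_space V \<Longrightarrow> T v = cscale c v"
proof -
  have rep: "representation K V" and ne: "rep_space V \<noteq> {0}"
    and irr: "\<And>U. invariant_subspace K V U \<Longrightarrow> U = {0} \<or> U = rep_space V"
    using V(1) unfolding irreducible_rep_iff by auto
  note D = representationD[OF rep] and T' = intertwinerD[OF T]
  obtain g where g: "Vector_Spaces.linear cscale cscale g" "\<And>x. x \<in> rep_space V \<Longrightarrow> g x = T x"
    using linear_on_extend[OF T'(1) D(1)] by blast
  obtain v where v: "v \<in> rep_space V" "v \<noteq> 0" using ne fun_space.subspace_0[OF D(1)] by blast
  have gV: "g ` rep_space V \<subseteq> rep_space V" using g(2) T'(2) by auto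
  obtain c u where u: "u \<in> rep_space V" "u \<noteq> 0" "T u = cscale c u"
    using exists_annihilator[OF g(1) D(1) gV v(1) V(2)] eigenvector_of_annihilator[OF g(1) D(1) gV v] g(2)
    by metis
  let ?S = "\<lambda>v. T v - cscale c v"
  have "intertwiner K V V ?S"
    unfolding intertwiner_def
    using T'(2,3) D(2)
    by (auto intro!: linear_onI simp: linear_on_add[OF T'(1)] linear_on_scale[OF T'(1)]
        linear_on_diff[OF D(3) D(1)] linear_on_scale[OF D(3)] fun_space.subspace_diff[OF D(1)]
        fun_space.subspace_scale[OF D(1)] fun_space.scale_right_distrib fun_space.scale_right_diff_distrib
        fun_space.scale_left_commute)
  from irr[OF kernel_invariant[OF rep rep this]] u have "\<And>v. v \<in> rep_space V \<Longrightarrow> ?S v = 0" by auto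
  then have "\<And>v. v \<in> rep_space V \<Longrightarrow> T v = cscale c v" by simp
  then show thesis by (rule that)
qed

text \<open>By the uniqueness of the components of a vector, each component is a linear and equivariant function
  of the vector.\<close>

lemma decomposition_projections:
  assumes W: "representation K W" and dec: "irreducible_decomposition K W k D"
  obtains \<pi> where "\<And>i. i < k \<Longrightarrow> intertwiner K W (W\<lparr>rep_space := D i\<rparr>) (\<pi> i)"
    and "\<And>w. w \<in> rep_space W \<Longrightarrow> w = (\<Sum>i<k. \<pi> i w)"
    and "\<And>i j w. i < k \<Longrightarrow> j < k \<Longrightarrow> w \<in> D j \<Longrightarrow> \<pi> i w = (if i = j then w else 0)"
proof -
  note DW = representationD[OF W]
  have D: "\<And>i. i < k \<Longrightarrow> D i \<subseteq> rep_space W" "\<And>i. i < k \<Longrightarrow> representation K (W\<lparr>rep_space := D i\<rparr>)"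
    and ex: "\<And>w. w \<in> rep_space W \<Longrightarrow> \<exists>!d. d \<in> (\<Pi>\<^sub>E i\<in>{..<k}. D i) \<and> w = (\<Sum>i<k. d i)"
    using dec unfolding irreducible_decomposition_def irreducible_rep_iff by auto
  have Ds: "subspace_fun (D i)" "\<And>g v. g \<in> carrier K \<Longrightarrow> v \<in> D i \<Longrightarrow> rep_act W g v \<in> D i" if "i < k" for i
    using representationD(1,2)[OF D(2)[OF that]] by auto
  define p where "p w = (THE d. d \<in> (\<Pi>\<^sub>E i\<in>{..<k}. D i) \<and> w = (\<Sum>i<k. d i))" for w
  have p: "p w \<in> (\<Pi>\<^sub>E i\<in>{..<k}. D i)" "w = (\<Sum>i<k. p w i)" if "w \<in> rep_space W" for w
    using theI'[OF ex[OF that]] unfolding p_def by auto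
  have pI: "p w i = d i" if "w \<in> rep_space W" "\<And>i. i < k \<Longrightarrow> d i \<in> D i" "w = (\<Sum>i<k. d i)" "i < k" for w d i
  proof -
    have "p w = restrict d {..<k}"
      unfolding p_def using that by (intro the1_equality[OF ex[OF that(1)]]) auto
    then show ?thesis using that by simp
  qed
  have pD: "p w i \<in> D i" if "w \<in> rep_space W" "i < k" for w i using p(1)[OF that(1)] that by auto
  show thesis
  proof (rule that)
    show "w = (\<Sum>i<k. p w i)" if "w \<in> rep_space W" for w by (rule p) fact
    show "p w i = (if i = j then w else 0)" if "i < k" "j < k" "w \<in> D j" for i j w
    proof -
      have "(\<Sum>i<k. if i = j then w else 0) = w" using that by (simp add: sum.delta)
      then show ?thesis using that D(1) fun_space.subspace_0[OF Ds(1)]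
        by (intro pI[where d = "\<lambda>i. if i = j then w else 0"]) auto
    qed
    show "intertwiner K W (W\<lparr>rep_space := D i\<rparr>) (\<lambda>w. p w i)" if i: "i < k" for i
      unfolding intertwiner_def
    proof (intro conjI ballI linear_onI)
      fix u v assume uv: "u \<in> rep_space W" "v \<in> rep_space W"
      show "p (u + v) i = p u i + p v i"
        by (rule pI[where d = "\<lambda>i. p u i + p v i"])
          (use uv i p(2) pD fun_space.subspace_add[OF Ds(1)] fun_space.subspace_add[OF DW(1)]
            in \<open>auto simp: sum.distrib\<close>)
    next
      fix c u assume u: "u \<in> rep_space W"
      show "p (cscale c u) i = cscale c (p u i)"
        by (rule pI[where d = "\<lambda>i. cscale c (p u i)"])
          (use u i p(2) pD fun_space.subspace_scale[OF Ds(1)] fun_space.subspace_scale[OF DW(1)]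
            in \<open>auto simp flip: fun_space.scale_sum_right\<close>)
    next
      fix g u assume gu: "g \<in> carrier K" "u \<in> rep_space W"
      have "rep_act W g u = (\<Sum>i<k. rep_act W g (p u i))"
        using p(2)[OF gu(2)] linear_on_sum[OF DW(3)[OF gu(1)] DW(1), of "{..<k}" "p u"] pD[OF gu(2)] D(1)
        by (metis lessThan_iff subsetD)
      then have "p (rep_act W g u) i = rep_act W g (p u i)"
        by (intro pI[where d = "\<lambda>i. rep_act W g (p u i)"]) (use gu i pD Ds in \<open>simp_all add: DW(2) flip: \<open>rep_act W g u = _\<close>\<close>)
      then show "p (rep_act W g u) i = rep_act (W\<lparr>rep_space := D i\<rparr>) g (p u i)" by simp
    qed (use pD i in auto)
  qed
qed

section \<open>Multiplicities as dimensions of spaces of invariant forms\<close>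

text \<open>The second argument is conjugate-linear so that forms on \<open>W \<times> V\<close> correspond to intertwiners from \<open>W\<close> to
  \<open>V\<close> itself rather than to its dual. The value \<open>0\<close> outside \<open>W \<times> V\<close> makes the forms a space of functions,
  whose dimension is available.\<close>

definition forms ::
  "('g, 'b) monoid_scheme \<Rightarrow> ('g, 'x) rep \<Rightarrow> ('g, 'y) rep
     \<Rightarrow> (('x \<Rightarrow> complex) \<times> ('y \<Rightarrow> complex) \<Rightarrow> complex) set" where
  "forms K W V = {B. invariant_form K W V (\<lambda>w v. B (w, v)) \<and>
     (\<forall>w v. w \<notin> rep_space W \<or> v \<notin> rep_space V \<longrightarrow> B (w, v) = 0)}"

definition form_of ::
  "('g, 'x) rep \<Rightarrow> ('g, 'y) rep \<Rightarrow> (('x \<Rightarrow> complex) \<Rightarrow> ('y \<Rightarrow> complex) \<Rightarrow> complex)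
     \<Rightarrow> ('x \<Rightarrow> complex) \<times> ('y \<Rightarrow> complex) \<Rightarrow> complex" where
  "form_of W V h = (\<lambda>(w, v). if w \<in> rep_space W \<and> v \<in> rep_space V then h w v else 0)"

lemma form_of_in_forms:
  assumes "representation K W" "representation K V" "invariant_form K W V h"
  shows "form_of W V h \<in> forms K W V"
proof -
  note s = sesquilinear_onD[of "rep_space W" "rep_space V" h]
  have "sesquilinear_on (rep_space W) (rep_space V) h"
    and inv: "\<And>g w v. g \<in> carrier K \<Longrightarrow> w \<in> rep_space W \<Longrightarrow> v \<in> rep_space V \<Longrightarrow>
      h (rep_act W g w) (rep_act V g v) = h w v"
    using assms(3) by (auto simp: invariant_form_def)
  then show ?thesis
    unfolding forms_def invariant_form_def form_of_def
    using representationD(1,2)[OF assms(1)] representationD(1,2)[OF assms(2)]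
    by (auto intro!: sesquilinear_onI simp: s fun_space.subspace_add fun_space.subspace_scale)
qed

lemma subspace_forms: "subspace_fun (forms K W V)"
  by (rule fun_space.subspaceI)
    (auto simp: forms_def invariant_form_def sesquilinear_on_def fun_apply algebra_simps)

lemma formsD:
  assumes "B \<in> forms K W V"
  shows "sesquilinear_on (rep_space W) (rep_space V) (\<lambda>w v. B (w, v))"
    and "g \<in> carrier K \<Longrightarrow> w \<in> rep_space W \<Longrightarrow> v \<in> rep_space V \<Longrightarrow>
      B (rep_act W g w, rep_act V g v) = B (w, v)"
    and "w \<notin> rep_space W \<or> v \<notin> rep_space V \<Longrightarrow> B (w, v) = 0"
  using assms unfolding forms_def invariant_form_def by auto

lemma finite_dim_forms:
  assumes "representation K W" "finite_dim (rep_space W)" "representation K V" "finite_dim (rep_space V)"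
  shows "finite_dim (forms K W V)"
proof -
  obtain A where A: "finite A" "rep_space W = fun_space.span A"
    using finite_dim_basis[OF assms(2) representationD(1)[OF assms(1)]] by metis
  obtain C where C: "finite C" "rep_space V = fun_space.span C"
    using finite_dim_basis[OF assms(4) representationD(1)[OF assms(3)]] by metis
  let ?r = "\<lambda>B p. if p \<in> A \<times> C then B p else (0 :: complex)"
  show ?thesis
  proof (rule finite_dim_injective)
    show "linear_on (forms K W V) ?r"
      by (rule linear_onI) (auto simp: fun_eq_iff fun_apply)
    show "?r ` forms K W V \<subseteq> {f. \<forall>x. x \<notin> A \<times> C \<longrightarrow> f x = 0}" by auto
    show "finite_dim {f :: _ \<Rightarrow> complex. \<forall>x. x \<notin> A \<times> C \<longrightarrow> f x = 0}"
      using A C by (intro finite_dim_finite_support) auto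
    fix B assume B: "B \<in> forms K W V" "?r B = 0"
    have "B (a, c) = 0" if "a \<in> A" "c \<in> C" for a c
      using fun_cong[OF B(2), of "(a, c)"] that by (simp add: fun_apply)
    then have "B (w, v) = 0" for w v
      using sesquilinear_on_eq_0[OF formsD(1)[OF B(1), unfolded A(2) C(2)], of w v] formsD(3)[OF B(1), of w v]
        A C by auto
    then show "B = 0" by (auto simp: fun_eq_iff fun_apply)
  qed (rule subspace_forms)
qed

text \<open>By Riesz, \<open>B (w, _)\<close> is the inner product with a vector \<open>T w\<close>, and the uniqueness of this vector makes \<open>T\<close>
  an intertwiner.\<close>

lemma form_intertwiner:
  assumes W: "representation K W" and V: "group K" "representation K V" "finite_dim (rep_space V)"
    and h: "hermitian_space (rep_space V) h" "invariant_form K V V h"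
    and B: "B \<in> forms K W V"
  obtains T where "intertwiner K W V T"
    and "\<And>w v. w \<in> rep_space W \<Longrightarrow> v \<in> rep_space V \<Longrightarrow> B (w, v) = h (T w) v"
proof -
  interpret h: hermitian_space "rep_space V" h by fact
  note DV = representationD[OF V(2)] and DW = representationD[OF W]
  note s = sesquilinear_onD[OF h.sesquilinear] and sB = sesquilinear_onD[OF formsD(1)[OF B]]
  have ex: "\<exists>u\<in>rep_space V. \<forall>v\<in>rep_space V. h u v = B (w, v)" if "w \<in> rep_space W" for w
    using h.riesz[of "\<lambda>v. B (w, v)"] V(3) sB that by metis
  define T where "T w = (SOME u. u \<in> rep_space V \<and> (\<forall>v\<in>rep_space V. h u v = B (w, v)))" for w
  have T: "T w \<in> rep_space V" "\<And>v. v \<in> rep_space V \<Longrightarrow> h (T w) v = B (w, v)" if "w \<in> rep_space W" for w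
    using someI_ex[of "\<lambda>u. u \<in> rep_space V \<and> (\<forall>v\<in>rep_space V. h u v = B (w, v))"] ex[OF that]
    unfolding T_def by blast+
  have eqI: "u = u'" if "u \<in> rep_space V" "u' \<in> rep_space V" "\<And>v. v \<in> rep_space V \<Longrightarrow> h u v = h u' v" for u u'
    using h.definite[of "u - u'"] sesquilinear_on_diff(1)[OF h.sesquilinear DV(1) that(1,2), of "u - u'"] that
      fun_space.subspace_diff[OF DV(1) that(1,2)] by simp
  have hinv: "h (rep_act V g u) (rep_act V g v) = h u v"
    if "g \<in> carrier K" "u \<in> rep_space V" "v \<in> rep_space V" for g u v
    using h(2) that unfolding invariant_form_def by blast
  have "intertwiner K W V T"
    unfolding intertwiner_def
  proof (intro conjI ballI linear_onI)
    fix u v assume uv: "u \<in> rep_space W" "v \<in> rep_space W"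
    show "T (u + v) = T u + T v"
      by (rule eqI) (use uv in \<open>auto simp: T s sB fun_space.subspace_add[OF DW(1)] fun_space.subspace_add[OF DV(1)]\<close>)
  next
    fix c u assume u: "u \<in> rep_space W"
    show "T (cscale c u) = cscale c (T u)"
      by (rule eqI) (use u in \<open>auto simp: T s sB fun_space.subspace_scale[OF DW(1)] fun_space.subspace_scale[OF DV(1)]\<close>)
  next
    fix g w assume g: "g \<in> carrier K" and w: "w \<in> rep_space W"
    show "T (rep_act W g w) = rep_act V g (T w)"
    proof (rule eqI)
      fix v assume v: "v \<in> rep_space V"
      let ?v = "rep_act V (inv\<^bsub>K\<^esub> g) v"
      have v': "?v \<in> rep_space V" "rep_act V g ?v = v"
        using v g DV(2) representation_inv[OF V(1,2)] group.inv_closed[OF V(1)] by auto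
      have "h (T (rep_act W g w)) v = B (w, ?v)"
        using T(2)[OF DW(2)[OF g w] v] formsD(2)[OF B g w v'(1)] v' by simp
      also have "\<dots> = h (rep_act V g (T w)) v"
        using T[OF w] v' hinv[OF g T(1)[OF w] v'(1)] by simp
      finally show "h (T (rep_act W g w)) v = h (rep_act V g (T w)) v" .
    qed (use g w T DV(2) DW(2) in auto)
  qed (use T in auto)
  then show thesis by (rule that) (simp add: T)
qed

lemma form_of_intertwiner:
  assumes "representation K W" "representation K V" "hermitian_space (rep_space V) h" "invariant_form K V V h"
    "intertwiner K W V T"
  shows "invariant_form K W V (\<lambda>w v. h (T w) v)"
proof -
  interpret h: hermitian_space "rep_space V" h by fact
  note s = sesquilinear_onD[OF h.sesquilinear]
  show ?thesis
    using assms(4) intertwinerD[OF assms(5)] unfolding invariant_form_def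
    by (auto intro!: sesquilinear_onI simp: s linear_on_add[OF intertwinerD(1)[OF assms(5)]]
        linear_on_scale[OF intertwinerD(1)[OF assms(5)]])
qed

text \<open>For every component isomorphic to \<open>V\<close> let \<open>t i\<close> be an isomorphism onto \<open>V\<close>, and let \<open>\<pi> i\<close> be the projection
  to the component. The forms \<open>\<beta> i\<close> that take \<open>(w, v)\<close> to \<open>h (t i (\<pi> i w)) v\<close> are a basis of the space of
  invariant forms. They are independent since \<open>\<beta> j\<close> vanishes on the \<open>i\<close>-th component if \<open>i \<noteq> j\<close>. They
  span since, by Schur's lemma, the intertwiner that belongs to a form is a multiple of \<open>t i\<close> on the
  components isomorphic to \<open>V\<close> and zero on the others.\<close>

theorem card_isomorphic_components:
  assumes K: "group K" "finite (carrier K)" and W: "representation K W"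
    and V: "irreducible_rep K V" "finite_dim (rep_space V)"
    and dec: "irreducible_decomposition K W k D"
  shows "card {i. i < k \<and> rep_iso K V (W\<lparr>rep_space := D i\<rparr>)} = fun_space.dim (forms K W V)"
proof -
  let ?I = "{i. i < k \<and> rep_iso K V (W\<lparr>rep_space := D i\<rparr>)}"
  have rV: "representation K V" "rep_space V \<noteq> {0}" using V(1) by (simp_all add: irreducible_rep_iff)
  have irrD: "irreducible_rep K (W\<lparr>rep_space := D i\<rparr>)" "D i \<subseteq> rep_space W" if "i < k" for i
    using dec that unfolding irreducible_decomposition_def by simp_all
  note DV = representationD[OF rV(1)] and DW = representationD[OF W]
  obtain h where h: "hermitian_space (rep_space V) h" "invariant_form K V V h"
    using exists_invariant_inner_product[OF K rV(1) V(2)] by blast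
  interpret h: hermitian_space "rep_space V" h by fact
  note s = sesquilinear_onD[OF h.sesquilinear] and s0 = sesquilinear_on_0[OF h.sesquilinear DV(1)]
  obtain \<pi> where \<pi>: "\<And>i. i < k \<Longrightarrow> intertwiner K W (W\<lparr>rep_space := D i\<rparr>) (\<pi> i)"
    and \<pi>_sum: "\<And>w. w \<in> rep_space W \<Longrightarrow> w = (\<Sum>i<k. \<pi> i w)"
    and \<pi>_D: "\<And>i j w. i < k \<Longrightarrow> j < k \<Longrightarrow> w \<in> D j \<Longrightarrow> \<pi> i w = (if i = j then w else 0)"
    using decomposition_projections[OF W dec] by blast
  define f where "f i = (SOME f. intertwiner K V (W\<lparr>rep_space := D i\<rparr>) f \<and> bij_betw f (rep_space V) (D i))" for i
  have f: "intertwiner K V (W\<lparr>rep_space := D i\<rparr>) (f i)" "bij_betw (f i) (rep_space V) (D i)" if "i \<in> ?I" for i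
  proof -
    have "\<exists>f. intertwiner K V (W\<lparr>rep_space := D i\<rparr>) f \<and> bij_betw f (rep_space V) (D i)"
      using that by (simp add: rep_iso_iff)
    from someI_ex[OF this] show "intertwiner K V (W\<lparr>rep_space := D i\<rparr>) (f i)" "bij_betw (f i) (rep_space V) (D i)"
      unfolding f_def by blast+
  qed
  define t where "t i = inv_into (rep_space V) (f i)" for i
  have t: "intertwiner K (W\<lparr>rep_space := D i\<rparr>) V (t i)" "bij_betw (t i) (D i) (rep_space V)" if "i \<in> ?I" for i
    using intertwiner_inverse[OF f(1)[OF that] _ rV(1)] f(2)[OF that] unfolding t_def by simp_all
  have tf: "t i (f i v) = v" if "i \<in> ?I" "v \<in> rep_space V" for i v
    unfolding t_def using bij_betw_inv_into_left[OF f(2)[OF that(1)] that(2)] .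
  have ft: "f i (t i w) = w" if "i \<in> ?I" "w \<in> D i" for i w
    unfolding t_def using bij_betw_inv_into_right[OF f(2)[OF that(1)] that(2)] .
  define \<beta> where "\<beta> i = form_of W V (\<lambda>w v. h (t i (\<pi> i w)) v)" for i
  have \<beta>_forms: "\<beta> i \<in> forms K W V" if i: "i \<in> ?I" for i
  proof -
    have "intertwiner K W V (t i \<circ> \<pi> i)"
      by (rule intertwiner_compose[OF \<pi> t(1)[OF i]]) (use i in simp)
    from form_of_in_forms[OF W rV(1) form_of_intertwiner[OF W rV(1) h this]]
    show ?thesis unfolding \<beta>_def comp_def .
  qed
  obtain v0 where v0: "v0 \<in> rep_space V" "v0 \<noteq> 0" using rV(2) fun_space.subspace_0[OF DV(1)] by blast
  have fD: "f i v0 \<in> D i" "f i v0 \<in> rep_space W" if "i \<in> ?I" for i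
  proof -
    show "f i v0 \<in> D i" using bij_betwE[OF f(2)[OF that]] v0(1) by blast
    then show "f i v0 \<in> rep_space W" using irrD(2)[of i] that by blast
  qed
  have repD: "representation K (W\<lparr>rep_space := D i\<rparr>)" if "i < k" for i
    using irrD(1)[OF that] by (simp add: irreducible_rep_iff)
  have t0: "t i 0 = 0" if "i \<in> ?I" for i
    using linear_on_0[OF intertwinerD(1)[OF t(1)[OF that]] representationD(1)[OF repD[of i]]] that by simp
  have \<beta>_val: "\<beta> j (f i v0, v0) = (if i = j then h v0 v0 else 0)" if "i \<in> ?I" "j \<in> ?I" for i j
  proof -
    have "\<beta> j (f i v0, v0) = h (t j (\<pi> j (f i v0))) v0"
      using fD(2)[OF that(1)] v0(1) by (simp add: \<beta>_def form_of_def)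
    also have "\<pi> j (f i v0) = (if j = i then f i v0 else 0)"
      using that fD(1)[OF that(1)] by (intro \<pi>_D) auto
    also have "h (t j \<dots>) v0 = (if i = j then h v0 v0 else 0)"
      using tf[OF that(1) v0(1)] t0[OF that(2)] s0(1)[OF v0(1)] by (cases "i = j") simp_all
    finally show ?thesis .
  qed
  have hv0: "h v0 v0 \<noteq> 0" using v0 h.definite by blast
  have inj: "inj_on \<beta> ?I"
  proof (rule inj_onI)
    fix i j assume ij: "i \<in> ?I" "j \<in> ?I" "\<beta> i = \<beta> j"
    show "i = j" using \<beta>_val[OF ij(1,1)] \<beta>_val[OF ij(1,2)] ij(3) hv0 by (simp split: if_splits)
  qed
  have fin: "finite ?I" by simp
  have indep: "fun_space.independent (\<beta> ` ?I)"
  proof (rule fun_space.independent_if_scalars_zero)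
    fix c b assume c: "(\<Sum>x\<in>\<beta> ` ?I. cscale (c x) x) = 0" and b: "b \<in> \<beta> ` ?I"
    then obtain i where i: "i \<in> ?I" "b = \<beta> i" by blast
    have "0 = (\<Sum>j\<in>?I. cscale (c (\<beta> j)) (\<beta> j)) (f i v0, v0)"
      using c by (simp add: sum.reindex[OF inj] fun_apply)
    also have "\<dots> = (\<Sum>j\<in>?I. if i = j then c (\<beta> j) * h v0 v0 else 0)"
      unfolding sum_fun_apply by (intro sum.cong refl) (use i(1) \<beta>_val in \<open>auto simp: fun_apply\<close>)
    also have "\<dots> = c b * h v0 v0" using i fin by (simp add: sum.delta)
    finally show "c b = 0" using hv0 by simp
  qed (use fin in simp)
  have spans: "B \<in> fun_space.span (\<beta> ` ?I)" if B: "B \<in> forms K W V" for B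
  proof -
    obtain T where T: "intertwiner K W V T"
      and BT: "\<And>w v. w \<in> rep_space W \<Longrightarrow> v \<in> rep_space V \<Longrightarrow> B (w, v) = h (T w) v"
      using form_intertwiner[OF W K(1) rV(1) V(2) h B] by blast
    have TD: "intertwiner K (W\<lparr>rep_space := D i\<rparr>) V T" if "i < k" for i
      using linear_on_subset[OF intertwinerD(1)[OF T] irrD(2)[OF that]] subsetD[OF irrD(2)[OF that]]
        intertwinerD(2,3)[OF T] unfolding intertwiner_def by (simp add: image_subset_iff)
    have "\<exists>c. \<forall>w\<in>D i. T w = cscale c (t i w)" if i: "i \<in> ?I" for i
    proof -
      have "intertwiner K V V (T \<circ> f i)" by (rule intertwiner_compose[OF f(1)[OF i] TD]) (use i in simp)
      then obtain c where c: "\<And>v. v \<in> rep_space V \<Longrightarrow> (T \<circ> f i) v = cscale c v"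
        using schur_scalar[OF V] by blast
      have "T w = cscale c (t i w)" if "w \<in> D i" for w
        using c[of "t i w"] ft[OF i that] bij_betwE[OF t(2)[OF i]] that by simp
      then show ?thesis by blast
    qed
    then have "\<exists>c. \<forall>i\<in>?I. \<forall>w\<in>D i. T w = cscale (c i) (t i w)" by (intro bchoice) blast
    then obtain c where c: "\<And>i w. i \<in> ?I \<Longrightarrow> w \<in> D i \<Longrightarrow> T w = cscale (c i) (t i w)" by blast
    have zero: "T w = 0" if "i < k" "i \<notin> ?I" "w \<in> D i" for i w
    proof (rule ccontr)
      assume "T w \<noteq> 0"
      then have "rep_iso K (W\<lparr>rep_space := D i\<rparr>) V"
        unfolding rep_iso_iff
        using schur_bijective[OF irrD(1)[OF that(1)] V(1) TD[OF that(1)]] that(3) TD[OF that(1)] by auto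
      then have "rep_iso K V (W\<lparr>rep_space := D i\<rparr>)"
        by (rule rep_iso_sym[OF repD[OF that(1)]])
      then show False using that by simp
    qed
    have \<pi>D: "\<pi> i w \<in> D i" "\<pi> i w \<in> rep_space W" if "i < k" "w \<in> rep_space W" for i w
      using intertwinerD(2)[OF \<pi>[OF that(1)] that(2)] subsetD[OF irrD(2)[OF that(1)]] by simp_all
    have "B = (\<Sum>i\<in>?I. cscale (c i) (\<beta> i))"
    proof (rule ext, clarify)
      fix w v
      show "B (w, v) = (\<Sum>i\<in>?I. cscale (c i) (\<beta> i)) (w, v)"
      proof (cases "w \<in> rep_space W \<and> v \<in> rep_space V")
        case True
        have TV: "T (\<pi> i w) \<in> rep_space V" if "i < k" for i using \<pi>D that True intertwinerD(2)[OF T] by blast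
        have "T w = (\<Sum>i<k. T (\<pi> i w))"
          using \<pi>_sum[of w] True linear_on_sum[OF intertwinerD(1)[OF T] DW(1), of "{..<k}" "\<lambda>i. \<pi> i w"] \<pi>D
          by (metis lessThan_iff)
        then have "B (w, v) = (\<Sum>i<k. h (T (\<pi> i w)) v)"
          using BT True sesquilinear_on_sum[OF h.sesquilinear DV(1), of v "{..<k}"] TV by simp
        also have "\<dots> = (\<Sum>i\<in>?I. h (T (\<pi> i w)) v)"
          proof (rule sum.mono_neutral_right)
          show "\<forall>i\<in>{..<k} - ?I. h (T (\<pi> i w)) v = 0"
          proof
            fix i assume i: "i \<in> {..<k} - ?I"
            then have "T (\<pi> i w) = 0" using zero[of i "\<pi> i w"] \<pi>D(1)[of i w] True by blast
            then show "h (T (\<pi> i w)) v = 0" using s0(1) True by simp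
          qed
        qed auto
        also have "\<dots> = (\<Sum>i\<in>?I. c i * \<beta> i (w, v))"
        proof (intro sum.cong refl)
          fix i assume i: "i \<in> ?I"
          then have "t i (\<pi> i w) \<in> rep_space V" using bij_betwE[OF t(2)[OF i]] \<pi>D True by blast
          then show "h (T (\<pi> i w)) v = c i * \<beta> i (w, v)"
            using c[OF i] \<pi>D i True by (simp add: \<beta>_def form_of_def s)
        qed
        finally show ?thesis by (simp add: sum_fun_apply fun_apply)
      next
        case False
        then show ?thesis using formsD(3)[OF B] by (auto simp: sum_fun_apply fun_apply \<beta>_def form_of_def)
      qed
    qed
    also have "\<dots> \<in> fun_space.span (\<beta> ` ?I)"
      by (intro fun_space.span_sum fun_space.span_scale fun_space.span_base imageI)
    finally show ?thesis .
  qed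
  have "card (\<beta> ` ?I) = fun_space.dim (forms K W V)"
    by (rule fun_space.basis_card_eq_dim[OF _ _ indep]) (use \<beta>_forms spans in auto)
  then show ?thesis using card_image[OF inj] by simp
qed

text \<open>If \<open>U\<close> is a proper non-zero invariant subspace and \<open>p\<close> is the projection to \<open>U\<close> along an invariant
  complement, then \<open>(w, v) \<mapsto> h (p w) v\<close> is an invariant form that is not a multiple of \<open>h\<close>.\<close>

lemma irreducible_iff_dim_forms:
  assumes K: "group K" "finite (carrier K)" and V: "representation K V" "finite_dim (rep_space V)"
  shows "irreducible_rep K V \<longleftrightarrow> fun_space.dim (forms K V V) = 1"
proof
  assume irr: "irreducible_rep K V"
  have "irreducible_decomposition K V 1 (\<lambda>_. rep_space V)"
    unfolding irreducible_decomposition_def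
  proof (intro conjI ballI allI impI)
    fix w assume w: "w \<in> rep_space V"
    show "\<exists>!d. d \<in> {..<1::nat} \<rightarrow>\<^sub>E rep_space V \<and> w = (\<Sum>i<1. d i)"
      by (rule ex1I[of _ "\<lambda>i\<in>{..<1::nat}. w"]) (use w in \<open>auto simp: fun_eq_iff PiE_iff extensional_def\<close>)
  qed (use irr in auto)
  from card_isomorphic_components[OF K V(1) irr V(2) this]
  have "card {i. i < (1::nat) \<and> rep_iso K V V} = fun_space.dim (forms K V V)" by simp
  moreover have "{i. i < (1::nat) \<and> rep_iso K V V} = {0}" using rep_iso_refl by auto
  ultimately show "fun_space.dim (forms K V V) = 1" by simp
next
  assume dim: "fun_space.dim (forms K V V) = 1"
  note DV = representationD[OF V(1)]
  obtain B0 where B0: "card B0 = 1" "forms K V V = fun_space.span B0"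
    using finite_dim_basis[OF finite_dim_forms[OF V V] subspace_forms] dim by metis
  then obtain b0 where b0: "forms K V V = fun_space.span {b0}" by (auto simp: card_1_singleton_iff)
  obtain h where h: "hermitian_space (rep_space V) h" "invariant_form K V V h"
    using exists_invariant_inner_product[OF K V] by blast
  interpret h: hermitian_space "rep_space V" h by fact
  note s0 = sesquilinear_on_0[OF h.sesquilinear DV(1)]
  have mem: "\<exists>c. form_of V V h' = cscale c b0" if "invariant_form K V V h'" for h'
    using form_of_in_forms[OF V(1) V(1) that] unfolding b0 fun_space.span_singleton by auto
  obtain c0 where c0: "form_of V V h = cscale c0 b0" using mem[OF h(2)] by blast
  show "irreducible_rep K V"
    unfolding irreducible_rep_iff
  proof (intro conjI allI impI V(1))
    show "rep_space V \<noteq> {0}"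
    proof
      assume "rep_space V = {0}"
      have "B = 0" if B: "B \<in> forms K V V" for B
      proof (rule ext, clarify)
        fix u v show "B (u, v) = 0 (u, v)"
          using formsD(3)[OF B, of u v] sesquilinear_on_0(1)[OF formsD(1)[OF B] DV(1), of v] \<open>rep_space V = {0}\<close>
          by (cases "u = 0 \<and> v = 0") (auto simp: fun_apply)
      qed
      then have "forms K V V \<subseteq> fun_space.span {}" by auto
      from fun_space.dim_le_card[OF this] show False using dim by simp
    qed
    fix U assume U: "invariant_subspace K V U"
    show "U = {0} \<or> U = rep_space V"
    proof (rule ccontr)
      assume neg: "\<not> ?thesis"
      have Us: "subspace_fun U" "U \<subseteq> rep_space V" using U by (auto simp: invariant_subspace_def)
      obtain C where C: "invariant_subspace K V C" "U \<inter> C = {0}"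
        and UC: "\<And>v. v \<in> rep_space V \<Longrightarrow> \<exists>u\<in>U. \<exists>u'\<in>C. v = u + u'"
        using maschke[OF K V U] by blast
      have Cs: "subspace_fun C" "C \<subseteq> rep_space V" using C by (auto simp: invariant_subspace_def)
      obtain u where u: "u \<in> U" "u \<noteq> 0" using neg fun_space.subspace_0[OF Us(1)] by blast
      obtain v where v: "v \<in> rep_space V" "v \<notin> U" using neg Us by blast
      obtain x where x: "x \<in> C" "x \<noteq> 0" using UC[OF v(1)] v(2) by force
      have inv: "g \<in> carrier K \<Longrightarrow> y \<in> U \<Longrightarrow> rep_act V g y \<in> U" "g \<in> carrier K \<Longrightarrow> y \<in> C \<Longrightarrow> rep_act V g y \<in> C" for g y
        using U C(1) unfolding invariant_subspace_def by blast+
      define p where "p v = (THE y. y \<in> U \<and> v - y \<in> C)" for v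
      have pI: "p v = y" if "y \<in> U" "v - y \<in> C" for v y
        unfolding p_def
      proof (rule the_equality)
        fix z assume z: "z \<in> U \<and> v - z \<in> C"
        have "z - y \<in> U" using z that fun_space.subspace_diff[OF Us(1)] by blast
        moreover have "z - y = (v - y) - (v - z)" by simp
        then have "z - y \<in> C" using z that fun_space.subspace_diff[OF Cs(1)] by metis
        ultimately have "z - y \<in> {0}" using C(2) by blast
        then show "z = y" by simp
      qed (use that in auto)
      have p: "p v \<in> U" "v - p v \<in> C" if v: "v \<in> rep_space V" for v
      proof -
        obtain y y' where "y \<in> U" "y' \<in> C" "v = y + y'" using UC[OF v] by blast
        then show "p v \<in> U" "v - p v \<in> C" using pI[of y v] by auto
      qed
      have "intertwiner K V V p"
        unfolding intertwiner_def
      proof (intro conjI ballI linear_onI)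
        fix a b assume ab: "a \<in> rep_space V" "b \<in> rep_space V"
        have eq: "a + b - (p a + p b) = (a - p a) + (b - p b)" by simp
        show "p (a + b) = p a + p b"
        proof (rule pI)
          show "p a + p b \<in> U" using p ab fun_space.subspace_add[OF Us(1)] by blast
          show "a + b - (p a + p b) \<in> C" unfolding eq using p ab fun_space.subspace_add[OF Cs(1)] by blast
        qed
      next
        fix c a assume a: "a \<in> rep_space V"
        show "p (cscale c a) = cscale c (p a)"
          using p[OF a] fun_space.subspace_scale[OF Cs(1) p(2)[OF a], of c]
          by (intro pI) (simp_all add: fun_space.subspace_scale[OF Us(1)] fun_space.scale_right_diff_distrib)
      next
        fix g a assume g: "g \<in> carrier K" and a: "a \<in> rep_space V"
        have "rep_act V g a - rep_act V g (p a) = rep_act V g (a - p a)"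
          using linear_on_diff[OF DV(3)[OF g] DV(1) a] p[OF a] Us by auto
        then show "p (rep_act V g a) = rep_act V g (p a)"
          using p[OF a] inv g by (intro pI) auto
      qed (use p Us in auto)
      from mem[OF form_of_intertwiner[OF V(1) V(1) h this]]
      obtain c1 where c1: "form_of V V (\<lambda>w. h (p w)) = cscale c1 b0" by blast
      have pu: "p u = u" "p x = 0" using pI[of u u] pI[of 0 x] u x fun_space.subspace_0[OF Us(1)] fun_space.subspace_0[OF Cs(1)] by auto
      have V': "u \<in> rep_space V" "x \<in> rep_space V" using u x Us Cs by auto
      have e: "h w v = c0 * b0 (w, v)" "h (p w) v = c1 * b0 (w, v)" if "w \<in> rep_space V" "v \<in> rep_space V" for w v
        using fun_cong[OF c0, of "(w, v)"] fun_cong[OF c1, of "(w, v)"] that by (auto simp: form_of_def fun_apply)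
      have "h u u \<noteq> 0" "h x x \<noteq> 0" using V' u x h.definite by blast+
      moreover have "c1 = 0 \<or> b0 (x, x) = 0" using e(2)[OF V'(2) V'(2)] pu s0 V' by simp
      ultimately show False
        using e[OF V'(1) V'(1)] e(1)[OF V'(2) V'(2)] pu by auto
    qed
  qed
qed

lemma rep_iso_irreducible:
  assumes "representation K V" "irreducible_rep K W" "rep_iso K V W"
  shows "irreducible_rep K V"
proof -
  obtain T where T: "intertwiner K V W T" "bij_betw T (rep_space V) (rep_space W)"
    using assms(3) by (auto simp: rep_iso_iff)
  have W: "representation K W" "rep_space W \<noteq> {0}" "\<And>U. invariant_subspace K W U \<Longrightarrow> U = {0} \<or> U = rep_space W"
    using assms(2) unfolding irreducible_rep_iff by blast+
  note T' = intertwinerD[OF T(1)] and DV = representationD[OF assms(1)]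
  have inj: "inj_on T (rep_space V)" "T ` rep_space V = rep_space W" using T(2) by (auto simp: bij_betw_def)
  have T0: "T 0 = 0" "0 \<in> rep_space V" using linear_on_0[OF T'(1) DV(1)] fun_space.subspace_0[OF DV(1)] by auto
  show ?thesis
    unfolding irreducible_rep_iff
  proof (intro conjI allI impI assms(1))
    show "rep_space V \<noteq> {0}" using W(2) inj(2) T0(1) by (metis image_insert image_empty)
    fix U assume U: "invariant_subspace K V U"
    have Us: "subspace_fun U" "U \<subseteq> rep_space V" using U by (auto simp: invariant_subspace_def)
    have "intertwiner K (V\<lparr>rep_space := U\<rparr>) W T"
      using linear_on_subset[OF T'(1) Us(2)] subsetD[OF Us(2)] T'(2,3)
      unfolding intertwiner_def by (simp add: image_subset_iff)
    from image_invariant[OF representation_restrict[OF assms(1) U] this]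
    have "T ` U = {0} \<or> T ` U = T ` rep_space V" using W(3) inj(2) by simp
    then show "U = {0} \<or> U = rep_space V"
    proof
      assume "T ` U = {0}"
      then have "x = 0" if "x \<in> U" for x
        using inj_onD[OF inj(1), of x 0] T0 subsetD[OF Us(2) that] that by (metis imageI singletonD)
      then show ?thesis using fun_space.subspace_0[OF Us(1)] by blast
    next
      assume "T ` U = T ` rep_space V"
      then show ?thesis using inj_on_image_eq_iff[OF inj(1) Us(2)] by blast
    qed
  qed
qed

text \<open>No component is isomorphic to \<open>V\<close> if \<open>V\<close> is reducible; the multiplicity is then \<open>0\<close>.\<close>

theorem has_multiplicity_dim_forms:
  assumes K: "group K" "finite (carrier K)" and V: "representation K V" "finite_dim (rep_space V)"
    and W: "representation K W" "finite_dim (rep_space W)"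
  shows "has_multiplicity K V W
    (if fun_space.dim (forms K V V) = 1 then fun_space.dim (forms K W V) else 0)"
  unfolding has_multiplicity_def
proof (intro conjI allI impI W(1) exists_irreducible_decomposition[OF K W])
  fix k D assume dec: "irreducible_decomposition K W k D"
  show "card {i. i < k \<and> rep_iso K V (W\<lparr>rep_space := D i\<rparr>)} =
    (if fun_space.dim (forms K V V) = 1 then fun_space.dim (forms K W V) else 0)"
  proof (cases "irreducible_rep K V")
    case True
    then show ?thesis
      using card_isomorphic_components[OF K W(1) True V(2) dec] irreducible_iff_dim_forms[OF K V] by simp
  next
    case False
    have "irreducible_rep K (W\<lparr>rep_space := D i\<rparr>)" if "i < k" for i
      using dec that unfolding irreducible_decomposition_def by simp_all
    then have "{i. i < k \<and> rep_iso K V (W\<lparr>rep_space := D i\<rparr>)} = {}"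
      using rep_iso_irreducible[OF V(1)] False by blast
    then show ?thesis using False irreducible_iff_dim_forms[OF K V] by (auto simp del: Collect_empty_eq)
  qed
qed

section \<open>The irreducible representations of a finite group\<close>

definition regular_rep :: "('g, 'b) monoid_scheme \<Rightarrow> ('g, 'g) rep" where
  "regular_rep G =
     \<lparr>rep_space = {f. \<forall>x. x \<notin> carrier G \<longrightarrow> f x = 0},
      rep_act = (\<lambda>h f x. if x \<in> carrier G then f (x \<otimes>\<^bsub>G\<^esub> h) else 0)\<rparr>"

lemma representation_regular_rep:
  assumes "group G"
  shows "representation G (regular_rep G)"
proof -
  interpret group G by fact
  show ?thesis
    unfolding representation_def regular_rep_def
    by (auto intro!: fun_space.subspaceI linear_onI simp: fun_apply fun_eq_iff m_assoc)
qed

text \<open>A vector \<open>u\<close> is sent to the matrix coefficient \<open>x \<mapsto> (x u) i\<close>, where \<open>i\<close> is a coordinate at which some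
  vector of \<open>V\<close> does not vanish. The kernel of this map is an invariant subspace other than \<open>V\<close>.\<close>

lemma regular_rep_embedding:
  assumes G: "group G" and V: "irreducible_rep G V"
  obtains T where "intertwiner G V (regular_rep G) T"
    and "\<And>v. v \<in> rep_space V \<Longrightarrow> T v = 0 \<Longrightarrow> v = 0"
proof -
  interpret group G by fact
  have rV: "representation G V" "rep_space V \<noteq> {0}"
    and irr: "\<And>U. invariant_subspace G V U \<Longrightarrow> U = {0} \<or> U = rep_space V"
    using V unfolding irreducible_rep_iff by blast+
  note DV = representationD[OF rV(1)]
  obtain v where v: "v \<in> rep_space V" "v \<noteq> 0" using rV(2) fun_space.subspace_0[OF DV(1)] by blast
  then obtain i where i: "v i \<noteq> 0" by (auto simp: fun_eq_iff fun_apply)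
  define T where "T u = (\<lambda>x. if x \<in> carrier G then rep_act V x u i else 0)" for u
  have T: "intertwiner G V (regular_rep G) T"
    unfolding intertwiner_def
  proof (intro conjI ballI linear_onI)
    fix u w assume "u \<in> rep_space V" "w \<in> rep_space V"
    then show "T (u + w) = T u + T w"
      by (auto simp: T_def fun_eq_iff linear_on_add[OF DV(3)] fun_apply)
  next
    fix c u assume "u \<in> rep_space V"
    then show "T (cscale c u) = cscale c (T u)"
      by (auto simp: T_def fun_eq_iff linear_on_scale[OF DV(3)]) (auto simp: cscale_def)
  next
    fix g u assume "g \<in> carrier G" "u \<in> rep_space V"
    then show "T (rep_act V g u) = rep_act (regular_rep G) g (T u)"
      by (auto simp: T_def regular_rep_def fun_eq_iff DV(5))
  qed (auto simp: T_def regular_rep_def)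
  have "T v \<noteq> 0"
    using i v(1) DV(4) by (auto simp: T_def fun_eq_iff fun_apply intro!: exI[of _ "\<one>\<^bsub>G\<^esub>"])
  then have "{u \<in> rep_space V. T u = 0} = {0}"
    using irr[OF kernel_invariant[OF rV(1) representation_regular_rep[OF G] T]] v(1) by blast
  then show thesis using that[OF T] by blast
qed

lemma finite_dim_regular_rep: "finite (carrier G) \<Longrightarrow> finite_dim (rep_space (regular_rep G))"
  using finite_dim_finite_support[of "carrier G"] by (simp add: regular_rep_def)

lemma finite_dim_irreducible:
  assumes "group G" "finite (carrier G)" "irreducible_rep G V"
  shows "finite_dim (rep_space V)"
proof -
  obtain T where T: "intertwiner G V (regular_rep G) T" "\<And>v. v \<in> rep_space V \<Longrightarrow> T v = 0 \<Longrightarrow> v = 0"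
    using regular_rep_embedding[OF assms(1,3)] by blast
  have "representation G V" using assms(3) unfolding irreducible_rep_def by blast
  then show ?thesis
    using finite_dim_injective[OF intertwinerD(1)[OF T(1)] representationD(1) T(2) _ finite_dim_regular_rep[OF assms(2)]]
      intertwinerD(2)[OF T(1)] by blast
qed

text \<open>Every irreducible representation is isomorphic to a component of one fixed decomposition of the
  regular representation.\<close>

lemma finite_irreps:
  fixes G :: "('g, 'b) monoid_scheme"
  assumes G: "group G" "finite (carrier G)"
  shows "finite (irreps G)"
proof -
  let ?R = "regular_rep G"
  note R = representation_regular_rep[OF G(1)]
  obtain k D where dec: "irreducible_decomposition G ?R k D"
    using exists_irreducible_decomposition[OF G R finite_dim_regular_rep[OF G(2)]] by blast
  obtain \<pi> where \<pi>: "\<And>i. i < k \<Longrightarrow> intertwiner G ?R (?R\<lparr>rep_space := D i\<rparr>) (\<pi> i)"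
    and sum: "\<And>w. w \<in> rep_space ?R \<Longrightarrow> w = (\<Sum>i<k. \<pi> i w)"
    using decomposition_projections[OF R dec] by metis
  have irrD: "irreducible_rep G (?R\<lparr>rep_space := D i\<rparr>)" if "i < k" for i
    using dec that unfolding irreducible_decomposition_def by blast
  define c where "c i = {W :: ('g, nat) rep. irreducible_rep G W \<and> rep_iso G W (?R\<lparr>rep_space := D i\<rparr>)}" for i
  have "iso_class G V \<in> c ` {..<k}" if V: "irreducible_rep G V" for V :: "('g, nat) rep"
  proof -
    have rV: "representation G V" "rep_space V \<noteq> {0}" using V unfolding irreducible_rep_def by blast+
    obtain T where T: "intertwiner G V ?R T" "\<And>v. v \<in> rep_space V \<Longrightarrow> T v = 0 \<Longrightarrow> v = 0"
      using regular_rep_embedding[OF G(1) V] by blast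
    obtain v where v: "v \<in> rep_space V" "v \<noteq> 0"
      using rV(2) fun_space.subspace_0[OF representationD(1)[OF rV(1)]] by blast
    have "(\<Sum>i<k. \<pi> i (T v)) \<noteq> 0" using sum[OF intertwinerD(2)[OF T(1) v(1)]] T(2) v by metis
    then obtain i where i: "i < k" "\<pi> i (T v) \<noteq> 0" by (metis lessThan_iff sum.neutral)
    have "intertwiner G V (?R\<lparr>rep_space := D i\<rparr>) (\<pi> i \<circ> T)"
      by (rule intertwiner_compose[OF T(1) \<pi>[OF i(1)]])
    then have iso: "rep_iso G V (?R\<lparr>rep_space := D i\<rparr>)"
      unfolding rep_iso_iff using schur_bijective[OF V irrD[OF i(1)], of "\<pi> i \<circ> T" v] v(1) i(2) by auto
    have "iso_class G V = c i"
    proof (intro equalityI subsetI)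
      fix W assume "W \<in> iso_class G V"
      then have "irreducible_rep G W" "rep_iso G V W" by (auto simp: iso_class_def)
      then show "W \<in> c i" unfolding c_def using rep_iso_trans[OF rep_iso_sym[OF rV(1)] iso] by blast
    next
      fix W assume "W \<in> c i"
      then have W: "irreducible_rep G W" "rep_iso G W (?R\<lparr>rep_space := D i\<rparr>)" by (simp_all add: c_def)
      then have "representation G W" unfolding irreducible_rep_def by blast
      then show "W \<in> iso_class G V"
        unfolding iso_class_def using W(1) rep_iso_trans[OF iso rep_iso_sym[OF _ W(2)]] by blast
    qed
    then show ?thesis using i(1) by blast
  qed
  then have "irreps G \<subseteq> c ` {..<k}" unfolding irreps_def by blast
  then show ?thesis using finite_surj by blast
qed

lemma irrep_representative:
  assumes "x \<in> irreps G"
  shows "irreducible_rep G (SOME V. V \<in> x)" "(SOME V. V \<in> x) \<in> x"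
proof -
  obtain V where V: "irreducible_rep G V" "x = iso_class G V" using assms by (auto simp: irreps_def)
  then have "V \<in> x" by (simp add: iso_class_def rep_iso_refl)
  then show x: "(SOME V. V \<in> x) \<in> x" by (rule someI)
  then show "irreducible_rep G (SOME V. V \<in> x)" unfolding V(2) iso_class_def by blast
qed

lemma trivial_class_irrep:
  fixes G :: "('a, 'b) monoid_scheme"
  assumes "group G"
  shows "trivial_class G \<in> irreps G"
proof -
  have sub: "subspace_fun {f :: nat \<Rightarrow> complex. \<forall>i. i \<noteq> 0 \<longrightarrow> f i = 0}"
    by (rule fun_space.subspaceI) (auto simp: fun_apply)
  define e :: "nat \<Rightarrow> complex" where "e = (\<lambda>i. if i = 0 then 1 else 0)"
  have "irreducible_rep G trivial_rep"
    unfolding irreducible_rep_iff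
  proof (intro conjI allI impI)
    show "representation G (trivial_rep :: ('a, nat) rep)"
      using sub by (auto simp: representation_def trivial_rep_def linear_on_def)
    have "e \<in> rep_space trivial_rep" "e \<noteq> 0" by (auto simp: trivial_rep_def e_def fun_eq_iff fun_apply)
    then show "rep_space (trivial_rep :: ('a, nat) rep) \<noteq> {0}" by (metis singletonD trivial_rep_def rep.select_convs(1))
    fix U assume "invariant_subspace G trivial_rep U"
    then have U: "subspace_fun U" "U \<subseteq> {f. \<forall>i. i \<noteq> 0 \<longrightarrow> f i = 0}"
      by (simp_all add: invariant_subspace_def trivial_rep_def)
    show "U = {0} \<or> U = rep_space trivial_rep"
    proof (cases "U \<subseteq> {0}")
      case True
      then show ?thesis using fun_space.subspace_0[OF U(1)] by blast
    next
      case False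
      then obtain u where u: "u \<in> U" "u \<noteq> 0" by blast
      have u_off: "u i = 0" if "i \<noteq> 0" for i using subsetD[OF U(2) u(1)] that by simp
      have u0: "u 0 \<noteq> 0"
      proof
        assume "u 0 = 0"
        then have "u i = 0" for i using u_off by (cases "i = 0") simp_all
        then show False using u(2) by (simp add: fun_eq_iff fun_apply)
      qed
      have "f \<in> U" if "\<forall>i. i \<noteq> 0 \<longrightarrow> f i = 0" for f
      proof -
        have f: "f = cscale (f 0 / u 0) u"
        proof
          fix i show "f i = cscale (f 0 / u 0) u i"
            using that u0 u_off by (cases "i = 0") (simp_all add: cscale_def)
        qed
        show ?thesis by (subst f) (rule fun_space.subspace_scale[OF U(1) u(1)])
      qed
      then have "{f. \<forall>i. i \<noteq> 0 \<longrightarrow> f i = 0} \<subseteq> U" by blast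
      then show ?thesis using U(2) unfolding trivial_rep_def by simp
    qed
  qed
  then show ?thesis unfolding trivial_class_def irreps_def by blast
qed

text \<open>A representative of the class need not be the representation that defines the class.\<close>

lemma trivial_class_line:
  fixes G :: "('a, 'b) monoid_scheme"
  assumes "V \<in> trivial_class G"
  obtains e where "rep_space V = range (\<lambda>c. cscale c e)"
proof -
  have "rep_iso G trivial_rep V" using assms by (simp add: trivial_class_def iso_class_def)
  then obtain T where T: "linear_on (rep_space (trivial_rep :: ('a, nat) rep)) T"
    "T ` rep_space (trivial_rep :: ('a, nat) rep) = rep_space V"
    unfolding rep_iso_def bij_betw_def by blast
  define e :: "nat \<Rightarrow> complex" where "e = (\<lambda>i. if i = 0 then 1 else 0)"
  have e: "e \<in> rep_space (trivial_rep :: ('a, nat) rep)" by (auto simp: trivial_rep_def e_def)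
  have "rep_space (trivial_rep :: ('a, nat) rep) = range (\<lambda>c. cscale c e)"
  proof (intro equalityI subsetI)
    fix f assume "f \<in> rep_space (trivial_rep :: ('a, nat) rep)"
    then have "f = cscale (f 0) e" by (auto simp: trivial_rep_def e_def fun_eq_iff fun_apply)
    then show "f \<in> range (\<lambda>c. cscale c e)" by blast
  qed (auto simp: trivial_rep_def e_def fun_apply)
  then have "rep_space V = range (\<lambda>c. T (cscale c e))" using T(2) by (metis image_image)
  then have "rep_space V = range (\<lambda>c. cscale c (T e))" using linear_on_scale[OF T(1) e] by simp
  then show thesis by (rule that)
qed

section \<open>Tensor products\<close>

text \<open>A linear map of functions of one variable acts on functions of several variables by acting on one of
  them. Here \<open>ins z x\<close> is the point whose value of that variable is \<open>x\<close> and whose other variables are those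
  of \<open>z\<close>, and \<open>get z\<close> is the variable itself.\<close>

lemma slicewise_linear:
  assumes A: "linear_on U A" "subspace_fun U"
    and X: "\<And>F z. F \<in> X \<Longrightarrow> (\<lambda>x. F (ins z x)) \<in> U"
  shows "linear_on (fun_space.span X) (\<lambda>F z. A (\<lambda>x. F (ins z x)) (get z))"
proof -
  have "subspace_fun {F. \<forall>z. (\<lambda>x. F (ins z x)) \<in> U}"
    using fun_space.subspace_0[OF A(2)] fun_space.subspace_add[OF A(2)] fun_space.subspace_scale[OF A(2)]
    by (intro fun_space.subspaceI) (auto simp: plus_fun_def zero_fun_def cscale_def)
  then have "fun_space.span X \<subseteq> {F. \<forall>z. (\<lambda>x. F (ins z x)) \<in> U}"
    by (intro fun_space.span_minimal) (use X in auto)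
  then have slice: "(\<lambda>x. F (ins z x)) \<in> U" if "F \<in> fun_space.span X" for F z using that by blast
  show ?thesis
  proof (rule linear_onI)
    fix F F' assume F: "F \<in> fun_space.span X" "F' \<in> fun_space.span X"
    have "A (\<lambda>x. (F + F') (ins z x)) = A (\<lambda>x. F (ins z x)) + A (\<lambda>x. F' (ins z x))" for z
      using linear_on_add[OF A(1) slice[OF F(1)] slice[OF F(2)]] by (simp add: plus_fun_def)
    then show "(\<lambda>z. A (\<lambda>x. (F + F') (ins z x)) (get z)) =
        (\<lambda>z. A (\<lambda>x. F (ins z x)) (get z)) + (\<lambda>z. A (\<lambda>x. F' (ins z x)) (get z))"
      by (simp add: fun_eq_iff fun_apply)
  next
    fix c F assume F: "F \<in> fun_space.span X"
    have "A (\<lambda>x. (cscale c F) (ins z x)) = cscale c (A (\<lambda>x. F (ins z x)))" for z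
      using linear_on_scale[OF A(1) slice[OF F]] by (simp add: cscale_def)
    then show "(\<lambda>z. A (\<lambda>x. (cscale c F) (ins z x)) (get z)) = cscale c (\<lambda>z. A (\<lambda>x. F (ins z x)) (get z))"
      by (simp add: fun_eq_iff fun_apply)
  qed
qed

text \<open>Apply \<open>A\<close> to the first variable and then \<open>B\<close> to the second one. That these operations are defined for all
  functions in the span shows that the prescription on pure tensors is consistent.\<close>

lemma tensor_map_exists:
  assumes A: "linear_on U A" "subspace_fun U" and B: "linear_on W B" "subspace_fun W"
  obtains T where "linear_on (fun_space.span {pure_tensor u w | u w. u \<in> U \<and> w \<in> W}) T"
    and "\<And>u w. u \<in> U \<Longrightarrow> w \<in> W \<Longrightarrow> T (pure_tensor u w) = pure_tensor (A u) (B w)"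
proof -
  let ?X = "{pure_tensor u w | u w. u \<in> U \<and> w \<in> W}"
  let ?Y = "{pure_tensor u w | u w. u \<in> A ` U \<and> w \<in> W}"
  define S where "S F = (\<lambda>z. A (\<lambda>x. F (x, snd z)) (fst z))" for F :: "'a \<times> 'c \<Rightarrow> complex"
  define R where "R F = (\<lambda>z. B (\<lambda>y. F (fst z, y)) (snd z))" for F :: "'b \<times> 'c \<Rightarrow> complex"
  have SX: "S (pure_tensor u w) = pure_tensor (A u) w" if "u \<in> U" for u w
  proof -
    have "(\<lambda>x. pure_tensor u w (x, s)) = cscale (w s) u" for s
      by (simp add: pure_tensor_def cscale_def mult.commute)
    then show ?thesis
      unfolding S_def by (simp add: linear_on_scale[OF A(1) that])
        (simp add: pure_tensor_def fun_eq_iff cscale_def mult.commute)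
  qed
  have RY: "R (pure_tensor u w) = pure_tensor u (B w)" if "w \<in> W" for u w
  proof -
    have "(\<lambda>y. pure_tensor u w (s, y)) = cscale (u s) w" for s
      by (simp add: pure_tensor_def cscale_def)
    then show ?thesis
      unfolding R_def by (simp add: linear_on_scale[OF B(1) that])
        (simp add: pure_tensor_def fun_eq_iff cscale_def)
  qed
  have S: "linear_on (fun_space.span ?X) S"
    unfolding S_def
  proof (rule slicewise_linear[OF A])
    fix F z assume "F \<in> ?X"
    then obtain u w where "u \<in> U" "F = pure_tensor u w" by blast
    moreover have "(\<lambda>x. pure_tensor u w (x, snd z)) = cscale (w (snd z)) u"
      by (simp add: pure_tensor_def cscale_def mult.commute)
    ultimately show "(\<lambda>x. F (x, snd z)) \<in> U" using fun_space.subspace_scale[OF A(2)] by simp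
  qed
  have R: "linear_on (fun_space.span ?Y) R"
    unfolding R_def
  proof (rule slicewise_linear[OF B])
    fix F z assume "F \<in> ?Y"
    then obtain u w where "w \<in> W" "F = pure_tensor u w" by blast
    moreover have "(\<lambda>y. pure_tensor u w (fst z, y)) = cscale (u (fst z)) w"
      by (simp add: pure_tensor_def cscale_def)
    ultimately show "(\<lambda>y. F (fst z, y)) \<in> W" using fun_space.subspace_scale[OF B(2)] by simp
  qed
  have "S ` fun_space.span ?X \<subseteq> fun_space.span ?Y"
  proof clarify
    fix F assume F: "F \<in> fun_space.span ?X"
    show "S F \<in> fun_space.span ?Y"
    proof (rule linear_on_image_span[OF S _ _ F])
      fix F assume "F \<in> ?X"
      then show "S F \<in> fun_space.span ?Y" using SX by (auto intro!: fun_space.span_base)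
    qed simp
  qed
  then have "linear_on (fun_space.span ?X) (R \<circ> S)" by (rule linear_on_compose[OF S R])
  then show thesis by (rule that) (simp add: SX RY)
qed

text \<open>The variables are treated one after the other.\<close>

lemma tensor_family_map_exists:
  fixes A :: "'i \<Rightarrow> ('x \<Rightarrow> complex) \<Rightarrow> 'x \<Rightarrow> complex"
  assumes I: "finite I" and A: "\<And>i. i \<in> I \<Longrightarrow> linear_on (U i) (A i)" "\<And>i. i \<in> I \<Longrightarrow> subspace_fun (U i)"
  obtains T where "linear_on (fun_space.span {pure_tensor_family I u | u. \<forall>i\<in>I. u i \<in> U i}) T"
    and "\<And>u. (\<forall>i\<in>I. u i \<in> U i) \<Longrightarrow> T (pure_tensor_family I u) = pure_tensor_family I (\<lambda>i. A i (u i))"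
proof -
  let ?X = "{pure_tensor_family I u | u. \<forall>i\<in>I. u i \<in> U i}"
  have "\<exists>T. linear_on (fun_space.span ?X) T \<and>
      (\<forall>u. (\<forall>i\<in>I. u i \<in> U i) \<longrightarrow>
        T (pure_tensor_family I u) = pure_tensor_family I (\<lambda>i. if i \<in> J then A i (u i) else u i))"
    if "finite J" "J \<subseteq> I" for J
    using that
  proof (induction J rule: finite_induct)
    case empty
    show ?case by (rule exI[of _ id]) (simp add: linear_on_def)
  next
    case (insert j J)
    have j: "j \<in> I" using insert.prems by simp
    obtain T where T: "linear_on (fun_space.span ?X) T"
      "\<And>u. (\<forall>i\<in>I. u i \<in> U i) \<Longrightarrow> T (pure_tensor_family I u) = pure_tensor_family I (\<lambda>i. if i \<in> J then A i (u i) else u i)"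
      using insert by auto
    let ?Y = "{pure_tensor_family I u | u. u j \<in> U j}"
    have slice: "(\<lambda>x. pure_tensor_family I u (z(j := x))) = cscale (\<Prod>i\<in>I - {j}. u i (z i)) (u j)" for u z
    proof
      fix x
      have "pure_tensor_family I u (z(j := x)) = u j x * (\<Prod>i\<in>I - {j}. u i ((z(j := x)) i))"
        unfolding pure_tensor_family_def using prod.remove[OF I j, of "\<lambda>i. u i ((z(j := x)) i)"] by simp
      also have "(\<Prod>i\<in>I - {j}. u i ((z(j := x)) i)) = (\<Prod>i\<in>I - {j}. u i (z i))"
        by (intro prod.cong) auto
      finally show "pure_tensor_family I u (z(j := x)) = cscale (\<Prod>i\<in>I - {j}. u i (z i)) (u j) x"
        by (simp only: cscale_def mult.commute)
    qed
    define S where "S F = (\<lambda>z. A j (\<lambda>x. F (z(j := x))) (z j))" for F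
    have S: "linear_on (fun_space.span ?Y) S"
      unfolding S_def
    proof (rule slicewise_linear[OF A(1)[OF j] A(2)[OF j]])
      fix F z assume "F \<in> ?Y"
      then obtain u where u: "u j \<in> U j" "F = pure_tensor_family I u" by blast
      show "(\<lambda>x. F (z(j := x))) \<in> U j"
        unfolding u(2) slice by (rule fun_space.subspace_scale[OF A(2)[OF j] u(1)])
    qed
    have SY: "S (pure_tensor_family I u) = pure_tensor_family I (u(j := A j (u j)))" if "u j \<in> U j" for u
    proof
      fix z
      have "S (pure_tensor_family I u) z = (\<Prod>i\<in>I - {j}. u i (z i)) * A j (u j) (z j)"
        unfolding S_def slice linear_on_scale[OF A(1)[OF j] that] by (simp add: cscale_def)
      also have "(\<Prod>i\<in>I - {j}. u i (z i)) = (\<Prod>i\<in>I - {j}. (u(j := A j (u j))) i (z i))"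
        by (intro prod.cong) auto
      also have "\<dots> * A j (u j) (z j) = pure_tensor_family I (u(j := A j (u j))) z"
        unfolding pure_tensor_family_def
        using prod.remove[OF I j, of "\<lambda>i. (u(j := A j (u j))) i (z i)"] by (simp add: mult.commute)
      finally show "S (pure_tensor_family I u) z = pure_tensor_family I (u(j := A j (u j))) z" .
    qed
    have TY: "T ` fun_space.span ?X \<subseteq> fun_space.span ?Y"
    proof clarify
      fix F assume F: "F \<in> fun_space.span ?X"
      show "T F \<in> fun_space.span ?Y"
      proof (rule linear_on_image_span[OF T(1) _ _ F])
        fix F assume "F \<in> ?X"
        then obtain u where u: "\<forall>i\<in>I. u i \<in> U i" "F = pure_tensor_family I u" by blast
        show "T F \<in> fun_space.span ?Y"
          unfolding u(2) T(2)[OF u(1)] using u(1) j insert.hyps(2) by (intro fun_space.span_base) auto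
      qed simp
    qed
    show ?case
    proof (intro exI conjI allI impI)
      show "linear_on (fun_space.span ?X) (S \<circ> T)" by (rule linear_on_compose[OF T(1) S TY])
      fix u assume u: "\<forall>i\<in>I. u i \<in> U i"
      show "(S \<circ> T) (pure_tensor_family I u) = pure_tensor_family I (\<lambda>i. if i \<in> insert j J then A i (u i) else u i)"
      proof -
        let ?u = "\<lambda>i. if i \<in> J then A i (u i) else u i"
        have uj: "?u j = u j" using insert.hyps(2) by simp
        have "(S \<circ> T) (pure_tensor_family I u) = pure_tensor_family I (?u(j := A j (?u j)))"
          using T(2)[OF u] SY[of ?u] u j uj by simp
        also have "?u(j := A j (?u j)) = (\<lambda>i. if i \<in> insert j J then A i (u i) else u i)"
          unfolding uj by auto
        finally show ?thesis .
      qed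
    qed
  qed
  from this[OF I subset_refl] obtain T where T: "linear_on (fun_space.span ?X) T"
    "\<forall>u. (\<forall>i\<in>I. u i \<in> U i) \<longrightarrow> T (pure_tensor_family I u) = pure_tensor_family I (\<lambda>i. if i \<in> I then A i (u i) else u i)"
    by blast
  show thesis
  proof (rule that[OF T(1)])
    fix u assume u: "\<forall>i\<in>I. u i \<in> U i"
    show "T (pure_tensor_family I u) = pure_tensor_family I (\<lambda>i. A i (u i))"
      using T(2) u by (auto simp: pure_tensor_family_def fun_eq_iff intro!: prod.cong)
  qed
qed

lemma tensor_rep_space:
  "rep_space (tensor_rep V W) = fun_space.span {pure_tensor v w | v w. v \<in> rep_space V \<and> w \<in> rep_space W}"
  by (simp add: tensor_rep_def Let_def)

lemma pure_tensor_in_tensor_rep: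
  "v \<in> rep_space V \<Longrightarrow> w \<in> rep_space W \<Longrightarrow> pure_tensor v w \<in> rep_space (tensor_rep V W)"
  unfolding tensor_rep_space by (rule fun_space.span_base) blast

lemma tensor_rep_act:
  assumes V: "representation K V" and W: "representation K W" and g: "g \<in> carrier K"
  shows "linear_on (rep_space (tensor_rep V W)) (rep_act (tensor_rep V W) g)"
    and "v \<in> rep_space V \<Longrightarrow> w \<in> rep_space W \<Longrightarrow>
      rep_act (tensor_rep V W) g (pure_tensor v w) = pure_tensor (rep_act V g v) (rep_act W g w)"
proof -
  let ?P = "\<lambda>T. linear_on (rep_space (tensor_rep V W)) T \<and> (\<forall>v\<in>rep_space V. \<forall>w\<in>rep_space W.
    T (pure_tensor v w) = pure_tensor (rep_act V g v) (rep_act W g w))"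
  obtain T where T: "linear_on (rep_space (tensor_rep V W)) T"
    "\<And>v w. v \<in> rep_space V \<Longrightarrow> w \<in> rep_space W \<Longrightarrow>
      T (pure_tensor v w) = pure_tensor (rep_act V g v) (rep_act W g w)"
    using tensor_map_exists[OF representationD(3)[OF V g] representationD(1)[OF V]
        representationD(3)[OF W g] representationD(1)[OF W]]
    unfolding tensor_rep_space by blast
  have "\<exists>T. ?P T" by (rule exI[of _ T]) (simp add: T)
  then have "?P (SOME T. ?P T)" by (rule someI_ex)
  moreover have "rep_act (tensor_rep V W) g = (SOME T. ?P T)"
    unfolding tensor_rep_space by (simp add: tensor_rep_def Let_def)
  ultimately show "linear_on (rep_space (tensor_rep V W)) (rep_act (tensor_rep V W) g)"
    "v \<in> rep_space V \<Longrightarrow> w \<in> rep_space W \<Longrightarrow>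
      rep_act (tensor_rep V W) g (pure_tensor v w) = pure_tensor (rep_act V g v) (rep_act W g w)"
    by simp_all
qed

lemma representation_tensor_rep:
  assumes K: "group K" and V: "representation K V" and W: "representation K W"
  shows "representation K (tensor_rep V W)"
proof -
  interpret group K by fact
  let ?X = "{pure_tensor v w | v w. v \<in> rep_space V \<and> w \<in> rep_space W}"
  let ?S = "rep_space (tensor_rep V W)" and ?a = "rep_act (tensor_rep V W)"
  note S = tensor_rep_space[of V W]
  note a = tensor_rep_act[OF V W]
  note DV = representationD[OF V] and DW = representationD[OF W]
  have closed: "?a g F \<in> ?S" if "g \<in> carrier K" "F \<in> ?S" for g F
  proof (rule linear_on_image_span[OF a(1)[OF that(1), unfolded S] _ _ that(2)[unfolded S]])
    fix F assume "F \<in> ?X"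
    then obtain v w where vw: "v \<in> rep_space V" "w \<in> rep_space W" "F = pure_tensor v w" by blast
    show "?a g F \<in> ?S"
      using vw that(1) by (simp add: a(2) DV(2) DW(2) pure_tensor_in_tensor_rep)
  qed (simp add: S)
  show ?thesis
    unfolding representation_def
  proof (intro conjI ballI)
    show "subspace_fun ?S" by (simp add: S)
    fix g assume g: "g \<in> carrier K"
    show "?a g ` ?S \<subseteq> ?S" using closed g by blast
    show "linear_on ?S (?a g)" by (rule a(1)[OF g])
    fix h F assume h: "h \<in> carrier K" and F: "F \<in> ?S"
    have "linear_on ?S (?a g \<circ> ?a h)"
      using closed h by (intro linear_on_compose[OF a(1)[OF h] a(1)[OF g]]) blast
    note lin = this
    have "?a (g \<otimes>\<^bsub>K\<^esub> h) F = (?a g \<circ> ?a h) F"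
    proof (rule linear_on_eq_on_span[OF a(1)[OF m_closed[OF g h], unfolded S] lin[unfolded S] _ F[unfolded S]])
      fix F assume "F \<in> ?X"
      then obtain v w where vw: "v \<in> rep_space V" "w \<in> rep_space W" "F = pure_tensor v w" by blast
      show "?a (g \<otimes>\<^bsub>K\<^esub> h) F = (?a g \<circ> ?a h) F"
        using vw g h DV(2) DW(2) by (simp add: a(2) DV(5) DW(5))
    qed
    then show "?a (g \<otimes>\<^bsub>K\<^esub> h) F = ?a g (?a h F)" by simp
  next
    fix F assume F: "F \<in> ?S"
    have "linear_on (fun_space.span ?X) id" by (simp add: linear_on_def)
    note lin = this
    have "?a \<one>\<^bsub>K\<^esub> F = id F"
    proof (rule linear_on_eq_on_span[OF a(1)[OF one_closed, unfolded S] lin _ F[unfolded S]])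
      fix F assume "F \<in> ?X"
      then obtain v w where vw: "v \<in> rep_space V" "w \<in> rep_space W" "F = pure_tensor v w" by blast
      show "?a \<one>\<^bsub>K\<^esub> F = id F" using vw by (simp add: a(2)[OF one_closed] DV(4) DW(4))
    qed
    then show "?a \<one>\<^bsub>K\<^esub> F = F" by simp
  qed
qed

lemma finite_dim_tensor_rep:
  "finite_dim (rep_space V) \<Longrightarrow> finite_dim (rep_space W) \<Longrightarrow> finite_dim (rep_space (tensor_rep V W))"
  unfolding tensor_rep_space using finite_dim_pure_tensor by simp

section \<open>Wreath products\<close>

lemma carrier_wreath_group:
  "(\<sigma>, g) \<in> carrier (wreath_group n G) \<longleftrightarrow> \<sigma> permutes {1..n} \<and> g \<in> {1..n} \<rightarrow>\<^sub>E carrier G"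
  by (simp add: wreath_group_def sym_group_carrier)

lemma mult_wreath_group:
  "(\<sigma>, g) \<otimes>\<^bsub>wreath_group n G\<^esub> (\<tau>, h) = (\<sigma> \<circ> \<tau>, \<lambda>k\<in>{1..n}. g k \<otimes>\<^bsub>G\<^esub> h (inv' \<sigma> k))"
  by (auto simp: wreath_group_def sym_group_mult fun_eq_iff)

lemma one_wreath_group: "\<one>\<^bsub>wreath_group n G\<^esub> = (id, \<lambda>k\<in>{1..n}. \<one>\<^bsub>G\<^esub>)"
  by (simp add: wreath_group_def sym_group_one)

lemmas permutes_iff = permutes_in_image permutes_in_image[OF permutes_inv]

lemma group_wreath_group:
  assumes "group G"
  shows "group (wreath_group n G)"
proof -
  interpret group G by fact
  have inv_comp: "inv' (\<sigma> \<circ> \<tau>) k = inv' \<tau> (inv' \<sigma> k)"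
    if "\<sigma> permutes {1..n}" "\<tau> permutes {1..n}" for \<sigma> \<tau> :: "nat \<Rightarrow> nat" and k
    using that by (simp add: o_inv_distrib permutes_bij)
  show ?thesis
  proof (rule groupI)
    show "\<one>\<^bsub>wreath_group n G\<^esub> \<in> carrier (wreath_group n G)"
      by (simp add: one_wreath_group carrier_wreath_group permutes_id)
  next
    fix x y assume xy: "x \<in> carrier (wreath_group n G)" "y \<in> carrier (wreath_group n G)"
    obtain \<sigma> g \<tau> h where eq: "x = (\<sigma>, g)" "y = (\<tau>, h)" by (cases x, cases y)
    have "\<sigma> permutes {1..n}" "\<tau> permutes {1..n}" and gh: "\<And>k. k \<in> {1..n} \<Longrightarrow> g k \<in> carrier G"
      "\<And>k. k \<in> {1..n} \<Longrightarrow> h k \<in> carrier G"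
      using xy unfolding eq carrier_wreath_group by (simp_all add: PiE_iff)
    then show "x \<otimes>\<^bsub>wreath_group n G\<^esub> y \<in> carrier (wreath_group n G)"
      unfolding eq mult_wreath_group carrier_wreath_group
      by (simp add: permutes_compose PiE_iff permutes_iff del: atLeastAtMost_iff)
  next
    fix x y z assume xyz: "x \<in> carrier (wreath_group n G)" "y \<in> carrier (wreath_group n G)"
      "z \<in> carrier (wreath_group n G)"
    obtain \<sigma> g \<tau> h \<rho> f where eq: "x = (\<sigma>, g)" "y = (\<tau>, h)" "z = (\<rho>, f)" by (cases x, cases y, cases z)
    have p: "\<sigma> permutes {1..n}" "\<tau> permutes {1..n}" "\<rho> permutes {1..n}"
      and gh: "\<And>k. k \<in> {1..n} \<Longrightarrow> g k \<in> carrier G"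
      "\<And>k. k \<in> {1..n} \<Longrightarrow> h k \<in> carrier G" "\<And>k. k \<in> {1..n} \<Longrightarrow> f k \<in> carrier G"
      using xyz unfolding eq carrier_wreath_group by (simp_all add: PiE_iff)
    show "x \<otimes>\<^bsub>wreath_group n G\<^esub> y \<otimes>\<^bsub>wreath_group n G\<^esub> z = x \<otimes>\<^bsub>wreath_group n G\<^esub> (y \<otimes>\<^bsub>wreath_group n G\<^esub> z)"
      unfolding eq mult_wreath_group
      using p gh by (auto simp: comp_assoc fun_eq_iff inv_comp m_assoc permutes_iff simp del: atLeastAtMost_iff)
  next
    fix x assume x: "x \<in> carrier (wreath_group n G)"
    obtain \<sigma> g where eq: "x = (\<sigma>, g)" by (cases x)
    have p: "\<sigma> permutes {1..n}" and g: "g \<in> {1..n} \<rightarrow>\<^sub>E carrier G"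
      using x unfolding eq carrier_wreath_group by simp_all
    have gk: "\<And>k. k \<in> {1..n} \<Longrightarrow> g k \<in> carrier G" "\<And>k. k \<notin> {1..n} \<Longrightarrow> g k = undefined"
      using g by (auto simp: PiE_iff extensional_def)
    show "\<one>\<^bsub>wreath_group n G\<^esub> \<otimes>\<^bsub>wreath_group n G\<^esub> x = x"
      unfolding eq one_wreath_group mult_wreath_group using gk by (auto simp: fun_eq_iff inv_id)
    let ?y = "(inv' \<sigma>, \<lambda>k\<in>{1..n}. inv\<^bsub>G\<^esub> (g (\<sigma> k)))"
    have "?y \<in> carrier (wreath_group n G)"
      unfolding carrier_wreath_group using p gk(1)
      by (simp add: permutes_inv permutes_iff del: atLeastAtMost_iff)
    moreover have "?y \<otimes>\<^bsub>wreath_group n G\<^esub> x = \<one>\<^bsub>wreath_group n G\<^esub>"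
      unfolding eq one_wreath_group mult_wreath_group
      using p gk(1) by (auto simp: fun_eq_iff permutes_inv_o permutes_inv_inv permutes_iff l_inv simp del: atLeastAtMost_iff)
    ultimately show "\<exists>y\<in>carrier (wreath_group n G). y \<otimes>\<^bsub>wreath_group n G\<^esub> x = \<one>\<^bsub>wreath_group n G\<^esub>" by blast
  qed
qed

lemma finite_wreath_group:
  assumes "finite (carrier G)"
  shows "finite (carrier (wreath_group n G))"
  using assms finite_permutations[of "{1..n}"]
  by (auto simp: wreath_group_def sym_group_def intro!: finite_cartesian_product finite_PiE)

text \<open>The inclusion of the wreath products of two consecutive degrees, and the element that exchanges the
  letters \<open>j\<close> and \<open>n + 1\<close>.\<close>

definition wreath_ext ::
  "nat \<Rightarrow> ('g, 'b) monoid_scheme \<Rightarrow> (nat \<Rightarrow> nat) \<times> (nat \<Rightarrow> 'g) \<Rightarrow> (nat \<Rightarrow> nat) \<times> (nat \<Rightarrow> 'g)" where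
  "wreath_ext n G = (\<lambda>(\<sigma>, g). (\<sigma>, g(Suc n := \<one>\<^bsub>G\<^esub>)))"

definition wreath_swap ::
  "nat \<Rightarrow> ('g, 'b) monoid_scheme \<Rightarrow> nat \<Rightarrow> (nat \<Rightarrow> nat) \<times> (nat \<Rightarrow> 'g)" where
  "wreath_swap n G j = (transpose j (Suc n), \<lambda>k\<in>{1..Suc n}. \<one>\<^bsub>G\<^esub>)"

lemma wreath_ext_closed:
  assumes "group G" "k \<in> carrier (wreath_group n G)"
  shows "wreath_ext n G k \<in> carrier (wreath_group (Suc n) G)"
proof -
  interpret group G by fact
  obtain \<sigma> g where k: "k = (\<sigma>, g)" by (cases k)
  have "\<sigma> permutes {1..n}" "g \<in> {1..n} \<rightarrow>\<^sub>E carrier G"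
    using assms(2) unfolding k carrier_wreath_group by simp_all
  moreover have "\<sigma> permutes {1..Suc n}"
    by (rule permutes_subset[OF \<open>\<sigma> permutes {1..n}\<close>]) auto
  ultimately show ?thesis
    unfolding k wreath_ext_def by (auto simp: carrier_wreath_group PiE_iff extensional_def)
qed

lemma wreath_swap_closed:
  assumes "group G" "j \<in> {1..Suc n}"
  shows "wreath_swap n G j \<in> carrier (wreath_group (Suc n) G)"
proof -
  interpret group G by fact
  show ?thesis
    unfolding wreath_swap_def carrier_wreath_group using assms(2)
    by (auto intro!: permutes_swap_id)
qed

section \<open>Stable growth\<close>

text \<open>The letters in \<open>A\<close> are those involved in \<open>x\<close>. What matters is only that the other letters can be exchanged
  with the new letter \<open>n + 1\<close> so that the result comes from degree \<open>n\<close>, and that the number of letters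
  involved has a bound \<open>d\<close>, which will not depend on \<open>n\<close>.\<close>

definition grows_stably ::
  "('g, 'b) monoid_scheme \<Rightarrow> nat \<Rightarrow> nat
     \<Rightarrow> ((nat \<Rightarrow> nat) \<times> (nat \<Rightarrow> 'g), 'x) rep \<Rightarrow> ((nat \<Rightarrow> nat) \<times> (nat \<Rightarrow> 'g), 'y) rep \<Rightarrow> bool" where
  "grows_stably G d n V V' \<longleftrightarrow> (\<exists>\<iota>.
     linear_on (rep_space V) \<iota> \<and> \<iota> ` rep_space V \<subseteq> rep_space V' \<and>
     (\<forall>k\<in>carrier (wreath_group n G). \<forall>v\<in>rep_space V.
        \<iota> (rep_act V k v) = rep_act V' (wreath_ext n G k) (\<iota> v)) \<and>
     rep_space V' \<subseteq> fun_space.span {x \<in> rep_space V'. \<exists>A. finite A \<and> card A \<le> d \<and>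
       (\<forall>j\<in>{1..Suc n} - A. rep_act V' (wreath_swap n G j) x \<in> \<iota> ` rep_space V)})"

text \<open>A letter is involved in \<open>x \<otimes> y\<close> if it is involved in \<open>x\<close> or in \<open>y\<close>.\<close>

lemma grows_stably_tensor:
  assumes G: "group G"
    and V: "representation (wreath_group n G) V" "representation (wreath_group (Suc n) G) V'"
    and W: "representation (wreath_group n G) W" "representation (wreath_group (Suc n) G) W'"
    and gV: "grows_stably G d n V V'" and gW: "grows_stably G e n W W'"
  shows "grows_stably G (d + e) n (tensor_rep V W) (tensor_rep V' W')"
proof -
  note DV = representationD[OF V(1)] and DV' = representationD[OF V(2)]
    and DW = representationD[OF W(1)] and DW' = representationD[OF W(2)]
  define X where "X \<iota> = {x \<in> rep_space V'. \<exists>A. finite A \<and> card A \<le> d \<and>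
       (\<forall>j\<in>{1..Suc n} - A. rep_act V' (wreath_swap n G j) x \<in> \<iota> ` rep_space V)}" for \<iota>
  define Y where "Y \<kappa> = {x \<in> rep_space W'. \<exists>A. finite A \<and> card A \<le> e \<and>
       (\<forall>j\<in>{1..Suc n} - A. rep_act W' (wreath_swap n G j) x \<in> \<kappa> ` rep_space W)}" for \<kappa>
  obtain \<iota> where \<iota>: "linear_on (rep_space V) \<iota>" "\<iota> ` rep_space V \<subseteq> rep_space V'"
    "\<And>k v. k \<in> carrier (wreath_group n G) \<Longrightarrow> v \<in> rep_space V \<Longrightarrow>
      \<iota> (rep_act V k v) = rep_act V' (wreath_ext n G k) (\<iota> v)"
    "rep_space V' \<subseteq> fun_space.span (X \<iota>)"
    using gV unfolding grows_stably_def X_def by blast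
  obtain \<kappa> where \<kappa>: "linear_on (rep_space W) \<kappa>" "\<kappa> ` rep_space W \<subseteq> rep_space W'"
    "\<And>k v. k \<in> carrier (wreath_group n G) \<Longrightarrow> v \<in> rep_space W \<Longrightarrow>
      \<kappa> (rep_act W k v) = rep_act W' (wreath_ext n G k) (\<kappa> v)"
    "rep_space W' \<subseteq> fun_space.span (Y \<kappa>)"
    using gW unfolding grows_stably_def Y_def by blast
  let ?P = "{pure_tensor v w | v w. v \<in> rep_space V \<and> w \<in> rep_space W}"
  let ?T = "tensor_rep V W" and ?T' = "tensor_rep V' W'"
  obtain T where T: "linear_on (fun_space.span ?P) T"
    "\<And>v w. v \<in> rep_space V \<Longrightarrow> w \<in> rep_space W \<Longrightarrow> T (pure_tensor v w) = pure_tensor (\<iota> v) (\<kappa> w)"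
    using tensor_map_exists[OF \<iota>(1) DV(1) \<kappa>(1) DW(1)] by blast
  have \<iota>V: "\<iota> v \<in> rep_space V'" if "v \<in> rep_space V" for v using \<iota>(2) that by blast
  have \<kappa>W: "\<kappa> w \<in> rep_space W'" if "w \<in> rep_space W" for w using \<kappa>(2) that by blast
  have rT: "representation (wreath_group n G) ?T" "representation (wreath_group (Suc n) G) ?T'"
    using representation_tensor_rep group_wreath_group[OF G] V W by blast+
  have TP: "T F \<in> rep_space ?T'" if "F \<in> fun_space.span ?P" for F
  proof (rule linear_on_image_span[OF T(1) _ representationD(1)[OF rT(2)] that])
    fix F assume "F \<in> ?P"
    then obtain v w where vw: "v \<in> rep_space V" "w \<in> rep_space W" "F = pure_tensor v w" by blast
    show "T F \<in> rep_space ?T'"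
      unfolding vw(3) T(2)[OF vw(1,2)] by (rule pure_tensor_in_tensor_rep[OF \<iota>V[OF vw(1)] \<kappa>W[OF vw(2)]])
  qed
  have equi: "T (rep_act ?T k F) = rep_act ?T' (wreath_ext n G k) (T F)"
    if k: "k \<in> carrier (wreath_group n G)" and F: "F \<in> rep_space ?T" for k F
  proof -
    note k' = wreath_ext_closed[OF G k]
    have 1: "linear_on (fun_space.span ?P) (T \<circ> rep_act ?T k)"
      unfolding tensor_rep_space[symmetric]
      by (rule linear_on_compose[OF representationD(3)[OF rT(1) k] T(1)[folded tensor_rep_space]])
        (use representationD(2)[OF rT(1) k] in blast)
    have 2: "linear_on (fun_space.span ?P) (rep_act ?T' (wreath_ext n G k) \<circ> T)"
      by (rule linear_on_compose[OF T(1) representationD(3)[OF rT(2) k']]) (use TP in blast)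
    have "(T \<circ> rep_act ?T k) F = (rep_act ?T' (wreath_ext n G k) \<circ> T) F"
    proof (rule linear_on_eq_on_span[OF 1 2 _ F[unfolded tensor_rep_space]])
      fix F assume "F \<in> ?P"
      then obtain v w where vw: "v \<in> rep_space V" "w \<in> rep_space W" "F = pure_tensor v w" by blast
      show "(T \<circ> rep_act ?T k) F = (rep_act ?T' (wreath_ext n G k) \<circ> T) F"
        using vw by (simp add: tensor_rep_act(2)[OF V(1) W(1) k] tensor_rep_act(2)[OF V(2) W(2) k']
            T(2) DV(2)[OF k] DW(2)[OF k] \<iota>(3)[OF k] \<kappa>(3)[OF k] \<iota>V \<kappa>W)
    qed
    then show ?thesis by simp
  qed
  define Z where "Z = {x \<in> rep_space ?T'. \<exists>A. finite A \<and> card A \<le> d + e \<and>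
       (\<forall>j\<in>{1..Suc n} - A. rep_act ?T' (wreath_swap n G j) x \<in> T ` rep_space ?T)}"
  have Z: "pure_tensor x y \<in> Z" if x: "x \<in> X \<iota>" and y: "y \<in> Y \<kappa>" for x y
  proof -
    obtain A where A: "finite A" "card A \<le> d"
      "\<And>j. j \<in> {1..Suc n} - A \<Longrightarrow> rep_act V' (wreath_swap n G j) x \<in> \<iota> ` rep_space V"
      using x unfolding X_def by blast
    obtain B where B: "finite B" "card B \<le> e"
      "\<And>j. j \<in> {1..Suc n} - B \<Longrightarrow> rep_act W' (wreath_swap n G j) y \<in> \<kappa> ` rep_space W"
      using y unfolding Y_def by blast
    have xy: "x \<in> rep_space V'" "y \<in> rep_space W'" using x y unfolding X_def Y_def by blast+
    have "rep_act ?T' (wreath_swap n G j) (pure_tensor x y) \<in> T ` rep_space ?T"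
      if j: "j \<in> {1..Suc n} - (A \<union> B)" for j
    proof -
      obtain v where v: "v \<in> rep_space V" "rep_act V' (wreath_swap n G j) x = \<iota> v" using A(3)[of j] j by blast
      obtain w where w: "w \<in> rep_space W" "rep_act W' (wreath_swap n G j) y = \<kappa> w" using B(3)[of j] j by blast
      have s: "wreath_swap n G j \<in> carrier (wreath_group (Suc n) G)"
        using wreath_swap_closed[OF G] j by blast
      have "rep_act ?T' (wreath_swap n G j) (pure_tensor x y) = T (pure_tensor v w)"
        using v w xy by (simp add: tensor_rep_act(2)[OF V(2) W(2) s] T(2))
      then show ?thesis using pure_tensor_in_tensor_rep[OF v(1) w(1)] by blast
    qed
    moreover have "card (A \<union> B) \<le> d + e" using card_Un_le[of A B] A(2) B(2) by linarith
    ultimately show ?thesis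
      unfolding Z_def using pure_tensor_in_tensor_rep[OF xy] A(1) B(1) by blast
  qed
  have "rep_space ?T' \<subseteq> fun_space.span Z"
    unfolding tensor_rep_space
  proof (rule fun_space.span_minimal)
    show "{pure_tensor v w | v w. v \<in> rep_space V' \<and> w \<in> rep_space W'} \<subseteq> fun_space.span Z"
    proof clarify
      fix v w assume vw: "v \<in> rep_space V'" "w \<in> rep_space W'"
      have "pure_tensor v w \<in> fun_space.span {pure_tensor a b | a b. a \<in> X \<iota> \<and> b \<in> Y \<kappa>}"
        by (rule span_pure_tensor) (use vw \<iota>(4) \<kappa>(4) in blast)+
      also have "\<dots> \<subseteq> fun_space.span Z" by (rule fun_space.span_mono) (use Z in blast)
      finally show "pure_tensor v w \<in> fun_space.span Z" .
    qed
  qed simp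
  then show ?thesis
    unfolding grows_stably_def Z_def
    using T(1)[folded tensor_rep_space] TP[folded tensor_rep_space] equi by blast
qed

lemma grows_stably_iso:
  assumes G: "group G"
    and V: "representation (wreath_group n G) V" "representation (wreath_group (Suc n) G) V'"
    and iso: "rep_iso (wreath_group n G) V W" "rep_iso (wreath_group (Suc n) G) V' W'"
    and g: "grows_stably G d n V V'"
  shows "grows_stably G d n W W'"
proof -
  note DV = representationD[OF V(1)] and DV' = representationD[OF V(2)]
  obtain f where f: "intertwiner (wreath_group n G) V W f" "bij_betw f (rep_space V) (rep_space W)"
    using iso(1) unfolding rep_iso_iff by blast
  obtain f' where f': "intertwiner (wreath_group (Suc n) G) V' W' f'" "bij_betw f' (rep_space V') (rep_space W')"
    using iso(2) unfolding rep_iso_iff by blast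
  define h where "h = inv_into (rep_space V) f"
  have h: "intertwiner (wreath_group n G) W V h" "bij_betw h (rep_space W) (rep_space V)"
    using intertwiner_inverse[OF f V(1)] unfolding h_def by simp_all
  define X where "X \<iota> = {x \<in> rep_space V'. \<exists>A. finite A \<and> card A \<le> d \<and>
       (\<forall>j\<in>{1..Suc n} - A. rep_act V' (wreath_swap n G j) x \<in> \<iota> ` rep_space V)}" for \<iota>
  obtain \<iota> where \<iota>: "linear_on (rep_space V) \<iota>" "\<iota> ` rep_space V \<subseteq> rep_space V'"
    "\<And>k v. k \<in> carrier (wreath_group n G) \<Longrightarrow> v \<in> rep_space V \<Longrightarrow>
      \<iota> (rep_act V k v) = rep_act V' (wreath_ext n G k) (\<iota> v)"
    "rep_space V' \<subseteq> fun_space.span (X \<iota>)"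
    using g unfolding grows_stably_def X_def by blast
  have \<iota>V: "\<iota> v \<in> rep_space V'" if "v \<in> rep_space V" for v using \<iota>(2) that by blast
  let ?k = "f' \<circ> \<iota> \<circ> h"
  have lin: "linear_on (rep_space W) ?k"
  proof (rule linear_on_compose[OF intertwinerD(1)[OF h(1)]])
    show "linear_on (rep_space V) (f' \<circ> \<iota>)"
      by (rule linear_on_compose[OF \<iota>(1) intertwinerD(1)[OF f'(1)] \<iota>(2)])
    show "h ` rep_space W \<subseteq> rep_space V" using bij_betwE[OF h(2)] by blast
  qed
  have mem: "?k w \<in> rep_space W'" if "w \<in> rep_space W" for w
    using intertwinerD(2)[OF f'(1) \<iota>V[OF intertwinerD(2)[OF h(1) that]]] by simp
  have equi: "?k (rep_act W k w) = rep_act W' (wreath_ext n G k) (?k w)"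
    if "k \<in> carrier (wreath_group n G)" "w \<in> rep_space W" for k w
    using intertwinerD(2,3)[OF h(1)] intertwinerD(3)[OF f'(1) wreath_ext_closed[OF G that(1)]] \<iota>(3) \<iota>V that
    by simp
  define Y where "Y = {x \<in> rep_space W'. \<exists>A. finite A \<and> card A \<le> d \<and>
       (\<forall>j\<in>{1..Suc n} - A. rep_act W' (wreath_swap n G j) x \<in> ?k ` rep_space W)}"
  have XY: "f' x \<in> Y" if x: "x \<in> X \<iota>" for x
  proof -
    have x': "x \<in> rep_space V'" using x unfolding X_def by blast
    obtain A where A: "finite A" "card A \<le> d"
      "\<And>j. j \<in> {1..Suc n} - A \<Longrightarrow> rep_act V' (wreath_swap n G j) x \<in> \<iota> ` rep_space V"
      using x unfolding X_def by blast
    have "rep_act W' (wreath_swap n G j) (f' x) \<in> ?k ` rep_space W" if j: "j \<in> {1..Suc n} - A" for j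
    proof -
      have s: "wreath_swap n G j \<in> carrier (wreath_group (Suc n) G)"
        using wreath_swap_closed[OF G] j by blast
      obtain v where v: "v \<in> rep_space V" "rep_act V' (wreath_swap n G j) x = \<iota> v" using A(3)[OF j] by blast
      have "rep_act W' (wreath_swap n G j) (f' x) = f' (\<iota> v)"
        using intertwinerD(3)[OF f'(1) s x'] v(2) by simp
      also have "v = h (f v)" unfolding h_def using bij_betw_inv_into_left[OF f(2) v(1)] by simp
      finally have "rep_act W' (wreath_swap n G j) (f' x) = ?k (f v)" by simp
      then show ?thesis using intertwinerD(2)[OF f(1) v(1)] by blast
    qed
    then show ?thesis unfolding Y_def using A(1,2) intertwinerD(2)[OF f'(1) x'] by blast
  qed
  have spanX: "fun_space.span (X \<iota>) = rep_space V'"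
    using \<iota>(4) fun_space.span_minimal[OF _ DV'(1), of "X \<iota>"] unfolding X_def by blast
  have "w \<in> fun_space.span Y" if w: "w \<in> rep_space W'" for w
  proof -
    obtain v where v: "v \<in> rep_space V'" "w = f' v" using f'(2) w unfolding bij_betw_def by blast
    show ?thesis
      unfolding v(2)
      by (rule linear_on_image_span[of "X \<iota>"])
        (use intertwinerD(1)[OF f'(1)] v(1) XY in \<open>simp_all add: spanX fun_space.span_base\<close>)
  qed
  then show ?thesis
    unfolding grows_stably_def Y_def using lin mem equi by blast
qed

text \<open>Restriction of forms along the maps \<open>\<kappa> : W \<rightarrow> W'\<close> and \<open>\<iota> : V \<rightarrow> V'\<close> is injective. Indeed, for spanning
  vectors \<open>y\<close> of \<open>W'\<close> and \<open>x\<close> of \<open>V'\<close> one of the \<open>n + 1\<close> letters is involved neither in \<open>x\<close> nor in \<open>y\<close>. The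
  exchange of this letter with \<open>n + 1\<close> leaves \<open>B (y, x)\<close> unchanged and moves \<open>y\<close> and \<open>x\<close> into the images of
  \<open>\<kappa>\<close> and \<open>\<iota>\<close>, where the form vanishes if its restriction does.\<close>

theorem dim_forms_Suc_le:
  assumes G: "group G"
    and V: "representation (wreath_group n G) V" "representation (wreath_group (Suc n) G) V'"
    and W: "representation (wreath_group n G) W" "representation (wreath_group (Suc n) G) W'"
    and fd: "finite_dim (rep_space V)" "finite_dim (rep_space W)"
    and gW: "grows_stably G d n W W'" and gV: "grows_stably G e n V V'" and n: "d + e \<le> n"
  shows "fun_space.dim (forms (wreath_group (Suc n) G) W' V') \<le> fun_space.dim (forms (wreath_group n G) W V)"
proof -
  note DV = representationD[OF V(1)] and DV' = representationD[OF V(2)]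
    and DW = representationD[OF W(1)] and DW' = representationD[OF W(2)]
  define X where "X \<iota> = {x \<in> rep_space V'. \<exists>A. finite A \<and> card A \<le> e \<and>
       (\<forall>j\<in>{1..Suc n} - A. rep_act V' (wreath_swap n G j) x \<in> \<iota> ` rep_space V)}" for \<iota>
  define Y where "Y \<kappa> = {x \<in> rep_space W'. \<exists>A. finite A \<and> card A \<le> d \<and>
       (\<forall>j\<in>{1..Suc n} - A. rep_act W' (wreath_swap n G j) x \<in> \<kappa> ` rep_space W)}" for \<kappa>
  obtain \<iota> where \<iota>: "linear_on (rep_space V) \<iota>" "\<iota> ` rep_space V \<subseteq> rep_space V'"
    "\<And>k v. k \<in> carrier (wreath_group n G) \<Longrightarrow> v \<in> rep_space V \<Longrightarrow>
      \<iota> (rep_act V k v) = rep_act V' (wreath_ext n G k) (\<iota> v)"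
    "rep_space V' \<subseteq> fun_space.span (X \<iota>)"
    using gV unfolding grows_stably_def X_def by blast
  obtain \<kappa> where \<kappa>: "linear_on (rep_space W) \<kappa>" "\<kappa> ` rep_space W \<subseteq> rep_space W'"
    "\<And>k v. k \<in> carrier (wreath_group n G) \<Longrightarrow> v \<in> rep_space W \<Longrightarrow>
      \<kappa> (rep_act W k v) = rep_act W' (wreath_ext n G k) (\<kappa> v)"
    "rep_space W' \<subseteq> fun_space.span (Y \<kappa>)"
    using gW unfolding grows_stably_def Y_def by blast
  have \<iota>V: "\<iota> v \<in> rep_space V'" if "v \<in> rep_space V" for v using \<iota>(2) that by blast
  have \<kappa>W: "\<kappa> w \<in> rep_space W'" if "w \<in> rep_space W" for w using \<kappa>(2) that by blast
  have spanX: "fun_space.span (X \<iota>) = rep_space V'"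
    using \<iota>(4) fun_space.span_minimal[OF _ DV'(1), of "X \<iota>"] unfolding X_def by blast
  have spanY: "fun_space.span (Y \<kappa>) = rep_space W'"
    using \<kappa>(4) fun_space.span_minimal[OF _ DW'(1), of "Y \<kappa>"] unfolding Y_def by blast
  let ?F = "forms (wreath_group n G) W V" and ?F' = "forms (wreath_group (Suc n) G) W' V'"
  let ?R = "\<lambda>B. form_of W V (\<lambda>w v. B (\<kappa> w, \<iota> v))"
  show ?thesis
  proof (rule dim_injective_le)
    show "linear_on ?F' ?R" by (rule linear_onI) (auto simp: form_of_def fun_eq_iff fun_apply)
    show "?R ` ?F' \<subseteq> ?F"
    proof clarify
      fix B assume B: "B \<in> ?F'"
      note s = sesquilinear_onD[OF formsD(1)[OF B]]
      show "?R B \<in> ?F"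
      proof (rule form_of_in_forms[OF W(1) V(1)], unfold invariant_form_def, intro conjI ballI)
        show "sesquilinear_on (rep_space W) (rep_space V) (\<lambda>w v. B (\<kappa> w, \<iota> v))"
          by (rule sesquilinear_onI)
            (simp_all add: linear_on_add[OF \<iota>(1)] linear_on_add[OF \<kappa>(1)] linear_on_scale[OF \<iota>(1)]
              linear_on_scale[OF \<kappa>(1)] s \<iota>V \<kappa>W)
        show "B (\<kappa> (rep_act W g w), \<iota> (rep_act V g v)) = B (\<kappa> w, \<iota> v)"
          if "g \<in> carrier (wreath_group n G)" "w \<in> rep_space W" "v \<in> rep_space V" for g w v
          using that formsD(2)[OF B wreath_ext_closed[OF G that(1)] \<kappa>W \<iota>V] by (simp add: \<iota>(3) \<kappa>(3))
      qed
    qed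
    show "finite_dim ?F" by (rule finite_dim_forms[OF W(1) fd(2) V(1) fd(1)])
    fix B assume B: "B \<in> ?F'" and 0: "?R B = 0"
    have 0: "B (\<kappa> w, \<iota> v) = 0" if "w \<in> rep_space W" "v \<in> rep_space V" for w v
      using fun_cong[OF 0, of "(w, v)"] that by (simp add: form_of_def fun_apply)
    have XY0: "B (y, x) = 0" if y: "y \<in> Y \<kappa>" and x: "x \<in> X \<iota>" for x y
    proof -
      obtain A where A: "finite A" "card A \<le> e"
        "\<And>j. j \<in> {1..Suc n} - A \<Longrightarrow> rep_act V' (wreath_swap n G j) x \<in> \<iota> ` rep_space V"
        using x unfolding X_def by blast
      obtain C where C: "finite C" "card C \<le> d"
        "\<And>j. j \<in> {1..Suc n} - C \<Longrightarrow> rep_act W' (wreath_swap n G j) y \<in> \<kappa> ` rep_space W"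
        using y unfolding Y_def by blast
      have xy: "x \<in> rep_space V'" "y \<in> rep_space W'" using x y unfolding X_def Y_def by blast+
      have "card (A \<union> C) < card {1..Suc n}" using card_Un_le[of A C] A(2) C(2) n by simp
      then have "\<not> {1..Suc n} \<subseteq> A \<union> C" using card_mono[of "A \<union> C" "{1..Suc n}"] A(1) C(1) by auto
      then obtain j where j: "j \<in> {1..Suc n}" "j \<notin> A" "j \<notin> C" by blast
      obtain v where v: "v \<in> rep_space V" "rep_act V' (wreath_swap n G j) x = \<iota> v" using A(3)[of j] j by blast
      obtain w where w: "w \<in> rep_space W" "rep_act W' (wreath_swap n G j) y = \<kappa> w" using C(3)[of j] j by blast
      show ?thesis
        using formsD(2)[OF B wreath_swap_closed[OF G j(1)] xy(2,1)] v w 0 by simp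
    qed
    have "B (w, v) = 0" for w v
    proof (cases "w \<in> rep_space W' \<and> v \<in> rep_space V'")
      case True
      then show ?thesis
        using sesquilinear_on_eq_0[of "Y \<kappa>" "X \<iota>" "\<lambda>w v. B (w, v)" w v] XY0 formsD(1)[OF B]
        unfolding spanX spanY by simp
    next
      case False
      then show ?thesis using formsD(3)[OF B] by blast
    qed
    then show "B = 0" by (auto simp: fun_eq_iff fun_apply)
  qed (rule subspace_forms)+
qed

lemma eventually_constant_decreasing:
  fixes f :: "nat \<Rightarrow> nat"
  assumes "\<And>n. n \<ge> N \<Longrightarrow> f (Suc n) \<le> f n"
  obtains c M where "\<And>n. n \<ge> M \<Longrightarrow> f n = c"
proof -
  obtain M where M: "M \<ge> N" "\<And>n. n \<ge> N \<Longrightarrow> f M \<le> f n"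
    using ex_has_least_nat[of "\<lambda>n. n \<ge> N" N f] by blast
  have "f n \<le> f M" if "n \<ge> M" for n
    using that
  proof (induction n rule: dec_induct)
    case (step n)
    then show ?case using assms[of n] M(1) by linarith
  qed simp
  then show thesis using that[of M "f M"] M by (meson dual_order.trans le_antisym)
qed

theorem stable_multiplicity:
  fixes G :: "('g, 'b) monoid_scheme"
    and U :: "nat \<Rightarrow> ((nat \<Rightarrow> nat) \<times> (nat \<Rightarrow> 'g), 'x) rep"
    and V :: "nat \<Rightarrow> ((nat \<Rightarrow> nat) \<times> (nat \<Rightarrow> 'g), 'y) rep"
    and W :: "nat \<Rightarrow> ((nat \<Rightarrow> nat) \<times> (nat \<Rightarrow> 'g), 'z) rep"
  assumes G: "group G" "finite (carrier G)"
    and rep: "\<And>n. n \<ge> N \<Longrightarrow> representation (wreath_group n G) (U n)"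
      "\<And>n. n \<ge> N \<Longrightarrow> representation (wreath_group n G) (V n)"
      "\<And>n. n \<ge> N \<Longrightarrow> representation (wreath_group n G) (W n)"
    and fd: "\<And>n. n \<ge> N \<Longrightarrow> finite_dim (rep_space (U n))" "\<And>n. n \<ge> N \<Longrightarrow> finite_dim (rep_space (V n))"
      "\<And>n. n \<ge> N \<Longrightarrow> finite_dim (rep_space (W n))"
    and g: "\<And>n. n \<ge> N \<Longrightarrow> grows_stably G a n (U n) (U (Suc n))"
      "\<And>n. n \<ge> N \<Longrightarrow> grows_stably G b n (V n) (V (Suc n))"
      "\<And>n. n \<ge> N \<Longrightarrow> grows_stably G c n (W n) (W (Suc n))"
  shows "\<exists>m M. \<forall>n\<ge>M. has_multiplicity (wreath_group n G) (W n) (tensor_rep (U n) (V n)) m"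
proof -
  note K = group_wreath_group[OF G(1)] finite_wreath_group[OF G(2)]
  let ?T = "\<lambda>n. tensor_rep (U n) (V n)"
  let ?f = "\<lambda>n. fun_space.dim (forms (wreath_group n G) (?T n) (W n))"
  let ?e = "\<lambda>n. fun_space.dim (forms (wreath_group n G) (W n) (W n))"
  have repT: "representation (wreath_group n G) (?T n)" "finite_dim (rep_space (?T n))" if "n \<ge> N" for n
    using representation_tensor_rep[OF K(1) rep(1,2)[OF that]] finite_dim_tensor_rep[OF fd(1,2)[OF that]] .
  have gT: "grows_stably G (a + b) n (?T n) (?T (Suc n))" if "n \<ge> N" for n
    by (rule grows_stably_tensor[OF G(1) rep(1) rep(1) rep(2) rep(2) g(1) g(2)]) (use that in simp_all)
  obtain c0 M0 where 0: "\<And>n. n \<ge> M0 \<Longrightarrow> ?f n = c0"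
  proof (rule eventually_constant_decreasing[of "max N (a + b + c)" ?f])
    show "?f (Suc n) \<le> ?f n" if "n \<ge> max N (a + b + c)" for n
      by (rule dim_forms_Suc_le[OF G(1) rep(3) rep(3) repT(1) repT(1) fd(3) repT(2) gT g(3)])
        (use that in simp_all)
  qed blast
  obtain c1 M1 where 1: "\<And>n. n \<ge> M1 \<Longrightarrow> ?e n = c1"
  proof (rule eventually_constant_decreasing[of "max N (c + c)" ?e])
    show "?e (Suc n) \<le> ?e n" if "n \<ge> max N (c + c)" for n
      by (rule dim_forms_Suc_le[OF G(1) rep(3) rep(3) rep(3) rep(3) fd(3) fd(3) g(3) g(3)])
        (use that in simp_all)
  qed blast
  have "has_multiplicity (wreath_group n G) (W n) (?T n) (if c1 = 1 then c0 else 0)"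
    if "n \<ge> max N (max M0 M1)" for n
  proof -
    have n: "n \<ge> N" "n \<ge> M0" "n \<ge> M1" using that by simp_all
    show ?thesis
      using has_multiplicity_dim_forms[OF K rep(3)[OF n(1)] fd(3)[OF n(1)] repT[OF n(1)]]
      unfolding 0[OF n(2)] 1[OF n(3)] .
  qed
  then show ?thesis by blast
qed

section \<open>Polytabloids\<close>

text \<open>Here \<open>\<rho>\<close> prescribes a new row for every cell, and the columns are kept. If the cells are permuted in this
  way, then the sign of the permutation is a coefficient of a polytabloid; otherwise the coefficient is
  \<open>0\<close>. See \<open>polytabloid_eq_column_sign\<close>.\<close>

definition column_map :: "nat list \<Rightarrow> (nat \<times> nat \<Rightarrow> nat) \<Rightarrow> nat \<times> nat \<Rightarrow> nat \<times> nat" where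
  "column_map xs \<rho> = (\<lambda>c. if c \<in> cells xs then (\<rho> c, snd c) else c)"

definition column_sign :: "nat list \<Rightarrow> (nat \<times> nat \<Rightarrow> nat) \<Rightarrow> complex" where
  "column_sign xs \<rho> =
     (if column_map xs \<rho> permutes cells xs then of_int (sign (column_map xs \<rho>)) else 0)"

lemma cells_Sigma: "cells xs = (SIGMA i:{..<length xs}. {..<xs ! i})"
  by (auto simp: cells_def)

lemma finite_cells [simp]: "finite (cells xs)"
  by (simp add: cells_Sigma)

lemma card_cells: "card (cells xs) = sum_list xs"
  by (simp add: cells_Sigma sum_list_sum_nth atLeast0LessThan)

lemma tableaux_nonempty: obtains t where "t \<in> tableaux xs"
  using finite_same_card_bij[of "cells xs" "{1..sum_list xs}"] by (auto simp: tableaux_def card_cells)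

lemma column_map_cong: "(\<And>c. c \<in> cells xs \<Longrightarrow> \<rho> c = \<rho>' c) \<Longrightarrow> column_map xs \<rho> = column_map xs \<rho>'"
  by (auto simp: column_map_def)

lemma column_sign_cong: "(\<And>c. c \<in> cells xs \<Longrightarrow> \<rho> c = \<rho>' c) \<Longrightarrow> column_sign xs \<rho> = column_sign xs \<rho>'"
  unfolding column_sign_def using column_map_cong by metis

lemma cells_Cons: "(i, j) \<in> cells (k # ks) \<longleftrightarrow> (i = 0 \<and> j < k) \<or> (\<exists>i'. i = Suc i' \<and> (i', j) \<in> cells ks)"
  by (cases i) (auto simp: cells_def)

lemma cells_less_sum_list: "(i, j) \<in> cells ks \<Longrightarrow> j < sum_list ks"
  using elem_le_sum_list[of i ks] by (auto simp: cells_def)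

text \<open>From column \<open>sum_list ks\<close> on, only the first row has cells; a cell there is alone in its column and has to
  stay in its row.\<close>

lemma column_sign_short_column:
  assumes "sum_list ks \<le> j" "(0, j) \<in> cells (k # ks)" "\<rho> (0, j) \<noteq> 0"
  shows "column_sign (k # ks) \<rho> = 0"
proof -
  have "column_map (k # ks) \<rho> (0, j) = (\<rho> (0, j), j)" using assms(2) by (simp add: column_map_def)
  moreover have "(\<rho> (0, j), j) \<notin> cells (k # ks)"
    using assms(1,3) cells_less_sum_list[of _ j ks] by (auto simp: cells_Cons)
  ultimately have "\<not> column_map (k # ks) \<rho> permutes cells (k # ks)"
    using assms(2) by (metis permutes_in_image)
  then show ?thesis by (simp add: column_sign_def)
qed

lemma cells_Suc: "cells (Suc k # ks) = insert (0, k) (cells (k # ks))"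
  by (auto simp: cells_Cons less_Suc_eq)

text \<open>The new cell is alone in its column, hence fixed by the permutations that keep the columns.\<close>

lemma column_sign_extend:
  assumes "sum_list ks \<le> k"
  shows "column_sign (Suc k # ks) \<rho> = (if \<rho> (0, k) = 0 then column_sign (k # ks) \<rho> else 0)"
proof (cases "\<rho> (0, k) = 0")
  case False
  then show ?thesis
    using column_sign_short_column[OF assms, of "Suc k" \<rho>] by (simp add: cells_Cons)
next
  case True
  have notin: "(0, k) \<notin> cells (k # ks)" by (simp add: cells_Cons)
  have eq: "column_map (Suc k # ks) \<rho> = column_map (k # ks) \<rho>"
    using True notin by (auto simp: column_map_def cells_Suc)
  have "column_map (k # ks) \<rho> permutes cells (Suc k # ks) \<longleftrightarrow> column_map (k # ks) \<rho> permutes cells (k # ks)"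
  proof
    assume "column_map (k # ks) \<rho> permutes cells (Suc k # ks)"
    then show "column_map (k # ks) \<rho> permutes cells (k # ks)"
      by (rule permutes_superset) (use notin in \<open>auto simp: cells_Suc column_map_def\<close>)
  next
    assume "column_map (k # ks) \<rho> permutes cells (k # ks)"
    then show "column_map (k # ks) \<rho> permutes cells (Suc k # ks)"
      by (rule permutes_subset) (auto simp: cells_Suc)
  qed
  then show ?thesis using True by (simp add: column_sign_def eq)
qed

lemma column_sign_swap:
  assumes "sum_list ks \<le> j" "(0, j) \<in> cells (k # ks)" "sum_list ks \<le> j'" "(0, j') \<in> cells (k # ks)"
  shows "column_sign (k # ks) (\<rho> \<circ> transpose (0, j) (0, j')) = column_sign (k # ks) \<rho>"
proof (cases "\<rho> (0, j) = 0 \<and> \<rho> (0, j') = 0")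
  case True
  then have "\<rho> \<circ> transpose (0, j) (0, j') = \<rho>" by (auto simp: fun_eq_iff transpose_def)
  then show ?thesis by simp
next
  case False
  then have "column_sign (k # ks) \<rho> = 0"
    using column_sign_short_column[of ks j k \<rho>] column_sign_short_column[of ks j' k \<rho>] assms by blast
  moreover have "column_sign (k # ks) (\<rho> \<circ> transpose (0, j) (0, j')) = 0"
    using column_sign_short_column[of ks j k "\<rho> \<circ> transpose (0, j) (0, j')"]
      column_sign_short_column[of ks j' k "\<rho> \<circ> transpose (0, j) (0, j')"] assms False by auto
  ultimately show ?thesis by simp
qed

text \<open>The tabloids of any shape with entries \<open>1, \<dots>, m\<close>.\<close>

definition row_partition :: "nat \<Rightarrow> (nat \<Rightarrow> nat set) \<Rightarrow> bool" where
  "row_partition m T \<longleftrightarrow> (\<forall>k\<in>{1..m}. \<exists>!i. k \<in> T i) \<and> (\<forall>i. T i \<subseteq> {1..m})"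

definition row_of :: "(nat \<Rightarrow> nat set) \<Rightarrow> nat \<Rightarrow> nat" where
  "row_of T k = (THE i. k \<in> T i)"

lemma row_of_iff:
  assumes "row_partition m T" "k \<in> {1..m}"
  shows "k \<in> T i \<longleftrightarrow> row_of T k = i"
proof -
  have ex1: "\<exists>!i. k \<in> T i" using assms unfolding row_partition_def by blast
  show ?thesis unfolding row_of_def using theI'[OF ex1] ex1 by blast
qed

lemma row_partition_rows: "row_partition m (\<lambda>i. {k \<in> {1..m}. r k = i})"
  and row_of_rows: "k \<in> {1..m} \<Longrightarrow> row_of (\<lambda>i. {k \<in> {1..m}. r k = i}) k = r k"
proof -
  show 1: "row_partition m (\<lambda>i. {k \<in> {1..m}. r k = i})" by (auto simp: row_partition_def)
  show "row_of (\<lambda>i. {k \<in> {1..m}. r k = i}) k = r k" if "k \<in> {1..m}"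
    using row_of_iff[OF 1 that, of "r k"] that by simp
qed

lemma tabloid_eq_iff:
  assumes s: "s \<in> tableaux xs"
  shows "T = tabloid xs s \<longleftrightarrow> row_partition (sum_list xs) T \<and> (\<forall>c\<in>cells xs. row_of T (s c) = fst c)"
proof -
  have s': "s ` cells xs = {1..sum_list xs}" "inj_on s (cells xs)"
    using s by (auto simp: tableaux_def bij_betw_def)
  show ?thesis
  proof
    assume T: "T = tabloid xs s"
    have mem: "s c \<in> T i \<longleftrightarrow> fst c = i" if c: "c \<in> cells xs" for c i
    proof
      assume "s c \<in> T i"
      then obtain j where "(i, j) \<in> cells xs" "s c = s (i, j)" unfolding T tabloid_def by blast
      then show "fst c = i" using inj_onD[OF s'(2) _ c, of "(i, j)"] by (metis fst_conv)
    next
      assume "fst c = i"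
      then show "s c \<in> T i" unfolding T tabloid_def using c by (metis (mono_tags, lifting) mem_Collect_eq prod.collapse)
    qed
    have part: "row_partition (sum_list xs) T"
      unfolding row_partition_def
    proof (intro conjI ballI allI)
      fix k assume "k \<in> {1..sum_list xs}"
      then obtain c where "c \<in> cells xs" "k = s c" using s'(1) by blast
      then show "\<exists>!i. k \<in> T i" using mem by auto
    next
      fix i show "T i \<subseteq> {1..sum_list xs}" unfolding T tabloid_def using s'(1) by blast
    qed
    have "row_of T (s c) = fst c" if c: "c \<in> cells xs" for c
      using row_of_iff[OF part, of "s c" "fst c"] mem[OF c, of "fst c"] s'(1) c by blast
    then show "row_partition (sum_list xs) T \<and> (\<forall>c\<in>cells xs. row_of T (s c) = fst c)" using part by blast
  next
    assume *: "row_partition (sum_list xs) T \<and> (\<forall>c\<in>cells xs. row_of T (s c) = fst c)"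
    show "T = tabloid xs s"
    proof (rule ext, intro equalityI subsetI)
      fix i k assume k: "k \<in> T i"
      then have "k \<in> {1..sum_list xs}" using * unfolding row_partition_def by blast
      then obtain c where c: "c \<in> cells xs" "k = s c" using s'(1) by blast
      then have "row_of T k = i" using k row_of_iff[of "sum_list xs" T k i] * \<open>k \<in> {1..sum_list xs}\<close> by blast
      then have "c = (i, snd c)" using * c by (metis prod.collapse)
      then have "(i, snd c) \<in> cells xs" "k = s (i, snd c)" using c by metis+
      then show "k \<in> tabloid xs s i" unfolding tabloid_def by blast
    next
      fix i k assume "k \<in> tabloid xs s i"
      then obtain j where j: "(i, j) \<in> cells xs" "k = s (i, j)" unfolding tabloid_def by blast
      have "k \<in> {1..sum_list xs}" unfolding j(2) s'(1)[symmetric] using j(1) by (rule imageI)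
      then show "k \<in> T i" using row_of_iff[of "sum_list xs" T k i] * j by (metis fst_conv)
    qed
  qed
qed

lemma permutes_comp_tableau:
  assumes "p permutes {1..sum_list xs}" "t \<in> tableaux xs"
  shows "p \<circ> t \<in> tableaux xs"
  using assms bij_betw_trans[OF _ permutes_imp_bij] by (auto simp: tableaux_def)

text \<open>At most one element \<open>p\<close> of the column stabilizer of \<open>t\<close> carries \<open>t\<close> to a tableau with the rows of \<open>T\<close>, because
  \<open>p\<close> keeps the columns and \<open>T\<close> prescribes the rows. In terms of the cells, \<open>p\<close> is the inverse of the column
  map of the rows of \<open>T\<close>.\<close>

lemma polytabloid_eq_column_sign:
  assumes t: "t \<in> tableaux xs"
  shows "polytabloid xs t T =
    (if row_partition (sum_list xs) T then column_sign xs (\<lambda>c. row_of T (t c)) else 0)"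
proof (cases "row_partition (sum_list xs) T")
  case False
  then have "T \<noteq> tabloid xs (p \<circ> t)" if "p \<in> column_stabilizer xs t" for p
    using tabloid_eq_iff[OF permutes_comp_tableau[OF _ t]] that unfolding column_stabilizer_def by blast
  then show ?thesis using False by (simp add: polytabloid_def)
next
  case True
  let ?m = "sum_list xs" and ?C = "cells xs"
  define \<rho> where "\<rho> c = row_of T (t c)" for c
  define \<pi> where "\<pi> = column_map xs \<rho>"
  have t': "t ` ?C = {1..?m}" "inj_on t ?C" using t by (auto simp: tableaux_def bij_betw_def)
  have tC: "t c \<in> {1..?m}" if "c \<in> ?C" for c using t'(1) that by blast
  define S where "S = {p \<in> column_stabilizer xs t. \<forall>c\<in>?C. row_of T (p (t c)) = fst c}"
  have fin: "finite (column_stabilizer xs t)"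
    by (rule finite_subset[OF _ finite_permutations[of "{1..?m}"]]) (auto simp: column_stabilizer_def)
  have Teq: "T = tabloid xs (p \<circ> t) \<longleftrightarrow> (\<forall>c\<in>?C. row_of T (p (t c)) = fst c)" if "p \<in> column_stabilizer xs t" for p
    using tabloid_eq_iff[OF permutes_comp_tableau[OF _ t], of p T] that True unfolding column_stabilizer_def by simp
  have "polytabloid xs t T = (\<Sum>p\<in>column_stabilizer xs t. if \<forall>c\<in>?C. row_of T (p (t c)) = fst c then of_int (sign p) else 0)"
    unfolding polytabloid_def by (intro sum.cong refl) (simp add: Teq)
  also have "\<dots> = (\<Sum>p\<in>S. of_int (sign p))"
    unfolding S_def by (simp add: sum.inter_filter[OF fin])
  finally have poly: "polytabloid xs t T = (\<Sum>p\<in>S. of_int (sign p))" .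
  have S: "\<pi> c \<in> ?C \<and> p (t (\<pi> c)) = t c" if p: "p \<in> S" and c: "c \<in> ?C" for p c
  proof -
    have pm: "p permutes {1..?m}" and col: "\<And>i j. (i, j) \<in> ?C \<Longrightarrow> \<exists>i'. (i', j) \<in> ?C \<and> p (t (i, j)) = t (i', j)"
      and rows: "\<And>c. c \<in> ?C \<Longrightarrow> row_of T (p (t c)) = fst c"
      using p unfolding S_def column_stabilizer_def by auto
    have "inv' p (t c) \<in> {1..?m}" using permutes_in_image[OF permutes_inv[OF pm]] tC[OF c] by blast
    then obtain a b where ab: "(a, b) \<in> ?C" "inv' p (t c) = t (a, b)" using t'(1) by (metis imageE surj_pair)
    then have pab: "p (t (a, b)) = t c" using permutes_inverses(1)[OF pm] by metis
    obtain i' where "(i', b) \<in> ?C" "p (t (a, b)) = t (i', b)" using col[OF ab(1)] by blast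
    then have "c = (i', b)" using inj_onD[OF t'(2) _ c, of "(i', b)"] pab by simp
    moreover have "\<rho> c = a" using rows[OF ab(1)] pab by (simp add: \<rho>_def)
    ultimately have "\<pi> c = (a, b)" using c by (simp add: \<pi>_def column_map_def)
    then show ?thesis using ab(1) pab by simp
  qed
  have \<pi>_perm: "\<pi> permutes ?C" if p: "p \<in> S" for p
  proof (rule bij_imp_permutes)
    have "inj_on \<pi> ?C"
    proof (rule inj_onI)
      fix c d assume "c \<in> ?C" "d \<in> ?C" "\<pi> c = \<pi> d"
      then show "c = d" using S[OF p, of c] S[OF p, of d] inj_onD[OF t'(2), of c d] by metis
    qed
    moreover have "\<pi> ` ?C \<subseteq> ?C" using S[OF p] by blast
    ultimately show "bij_betw \<pi> ?C ?C" by (simp add: bij_betw_def endo_inj_surj)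
    show "\<pi> c = c" if "c \<notin> ?C" for c using that by (simp add: \<pi>_def column_map_def)
  qed
  show ?thesis
  proof (cases "\<pi> permutes ?C")
    case False
    then have "S = {}" using \<pi>_perm by blast
    then show ?thesis using False True by (simp add: poly column_sign_def \<pi>_def \<rho>_def[abs_def])
  next
    case \<pi>p: True
    define q where "q = map_permutation ?C t \<pi>"
    have q: "q permutes {1..?m}" "sign q = sign \<pi>" "\<And>c. c \<in> ?C \<Longrightarrow> q (t c) = t (\<pi> c)"
      unfolding q_def using map_permutation_permutes[OF _ \<pi>p, of t "{1..?m}"] t' \<pi>p
      by (auto simp: bij_betw_def sign_map_permutation map_permutation_apply)
    have iq: "inv' q (t (\<pi> c)) = t c" if "c \<in> ?C" for c
      using q(3)[OF that] permutes_inverses(2)[OF q(1)] by metis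
    have surj: "\<exists>c\<in>?C. d = \<pi> c" if "d \<in> ?C" for d
      using permutes_image[OF \<pi>p] that by blast
    have "inv' q \<in> S"
      unfolding S_def column_stabilizer_def
    proof (intro CollectI conjI ballI)
      show "inv' q permutes {1..?m}" by (rule permutes_inv[OF q(1)])
      show "case d of (i, j) \<Rightarrow> \<exists>i'. (i', j) \<in> ?C \<and> inv' q (t (i, j)) = t (i', j)" if d: "d \<in> ?C" for d
      proof -
        obtain c where c: "c \<in> ?C" "d = \<pi> c" using surj[OF d] by blast
        then have "snd c = snd d" by (simp add: \<pi>_def column_map_def)
        then show ?thesis using iq[OF c(1)] c by (cases c, cases d) auto
      qed
      show "row_of T (inv' q (t d)) = fst d" if d: "d \<in> ?C" for d
      proof -
        obtain c where c: "c \<in> ?C" "d = \<pi> c" using surj[OF d] by blast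
        have "fst d = \<rho> c" using c by (simp add: \<pi>_def column_map_def)
        then show ?thesis using iq[OF c(1)] c by (simp add: \<rho>_def)
      qed
    qed
    moreover have "p = inv' q" if p: "p \<in> S" for p
    proof
      fix k
      have pm: "p permutes {1..?m}" using p unfolding S_def column_stabilizer_def by blast
      show "p k = inv' q k"
      proof (cases "k \<in> {1..?m}")
        case True
        then obtain d where d: "d \<in> ?C" "k = t d" using t'(1) by blast
        obtain c where c: "c \<in> ?C" "d = \<pi> c" using surj[OF d(1)] by blast
        show ?thesis using S[OF p c(1)] iq[OF c(1)] c d by simp
      next
        case False
        then show ?thesis using permutes_not_in[OF pm] permutes_not_in[OF permutes_inv[OF q(1)]] by simp
      qed
    qed
    ultimately have "S = {inv' q}" by blast
    moreover have "sign (inv' q) = sign \<pi>"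
      using sign_inverse[of q] permutation_permutes q(1,2) by (metis finite_atLeastAtMost)
    ultimately show ?thesis
      using True \<pi>p by (simp add: poly column_sign_def \<pi>_def \<rho>_def[abs_def])
  qed
qed

lemma specht_act_polytabloid:
  assumes t: "t \<in> tableaux xs" and p: "p permutes {1..sum_list xs}"
  shows "rep_act (specht xs) p (polytabloid xs t) = polytabloid xs (p \<circ> t)"
proof
  fix T :: "nat \<Rightarrow> nat set"
  let ?T = "\<lambda>i. inv' p ` T i" and ?m = "sum_list xs"
  have mem: "k \<in> ?T i \<longleftrightarrow> p k \<in> T i" for k i
    using permutes_inverses[OF p] by (metis imageE image_eqI)
  have part: "row_partition ?m ?T \<longleftrightarrow> row_partition ?m T"
  proof
    assume T: "row_partition ?m ?T"
    show "row_partition ?m T"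
      unfolding row_partition_def
    proof (intro conjI ballI allI subsetI)
      fix k assume k: "k \<in> {1..?m}"
      have "inv' p k \<in> {1..?m}" using permutes_in_image[OF permutes_inv[OF p]] k by blast
      then have "\<exists>!i. inv' p k \<in> ?T i" using T unfolding row_partition_def by blast
      then show "\<exists>!i. k \<in> T i" unfolding mem permutes_inverses(1)[OF p] .
    next
      fix i k assume "k \<in> T i"
      then have "inv' p k \<in> ?T i" by blast
      then have "inv' p k \<in> {1..?m}" using T unfolding row_partition_def by blast
      then show "k \<in> {1..?m}" using permutes_in_image[OF permutes_inv[OF p]] by blast
    qed
  next
    assume T: "row_partition ?m T"
    show "row_partition ?m ?T"
      unfolding row_partition_def
    proof (intro conjI ballI allI subsetI)
      fix k assume "k \<in> {1..?m}"
      then have "p k \<in> {1..?m}" using permutes_in_image[OF p] by blast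
      then show "\<exists>!i. k \<in> ?T i" using T unfolding row_partition_def mem by blast
    next
      fix i k assume "k \<in> ?T i"
      then have "p k \<in> {1..?m}" using T unfolding row_partition_def mem by blast
      then show "k \<in> {1..?m}" using permutes_in_image[OF p] by blast
    qed
  qed
  have row: "row_of ?T k = row_of T (p k)" for k unfolding row_of_def mem ..
  show "rep_act (specht xs) p (polytabloid xs t) T = polytabloid xs (p \<circ> t) T"
    unfolding polytabloid_eq_column_sign[OF permutes_comp_tableau[OF p t]]
    by (simp add: specht_def polytabloid_eq_column_sign[OF t] part row)
qed

section \<open>A model of the irreducible representations of wreath products\<close>

text \<open>The model consists of functions of \<open>y\<close>, which assigns to each letter a quadruple \<open>(x, h, i, r)\<close>: an index
  \<open>x\<close> of a representation of \<open>G\<close>, an element \<open>h\<close> of \<open>G\<close> called the label, a coordinate \<open>i\<close> of \<open>V x\<close>, and a row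
  \<open>r\<close>. A vector \<open>v\<close> of \<open>V x\<close> is represented by its matrix coefficients \<open>(h, i) \<mapsto> (h v) i\<close> instead of its
  coordinates. In this way, \<open>G\<close> acts by translation of \<open>h\<close>, and the whole wreath product by substitutions in
  \<open>y\<close>.\<close>

locale wreath_model =
  fixes G :: "('g, 'b) monoid_scheme" and R :: "'r set" and V :: "'r \<Rightarrow> ('g, nat) rep"
  assumes G: "group G" and finite_R: "finite R"
    and V: "x \<in> R \<Longrightarrow> representation G (V x)" "x \<in> R \<Longrightarrow> finite_dim (rep_space (V x))"
begin

definition all_cells :: "('r \<Rightarrow> nat list) \<Rightarrow> ('r \<times> nat \<times> nat) set" where
  "all_cells lam = (SIGMA x:R. cells (lam x))"

definition label :: "'r \<times> 'g \<times> nat \<times> nat \<Rightarrow> 'g" where "label p = fst (snd p)"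
definition row :: "'r \<times> 'g \<times> nat \<times> nat \<Rightarrow> nat" where "row p = snd (snd (snd p))"

definition shift :: "'g \<Rightarrow> 'r \<times> 'g \<times> nat \<times> nat \<Rightarrow> 'r \<times> 'g \<times> nat \<times> nat" where
  "shift a p = (fst p, label p \<otimes>\<^bsub>G\<^esub> a, snd (snd p))"

definition site :: "'r \<Rightarrow> (nat \<Rightarrow> complex) \<Rightarrow> 'r \<times> 'g \<times> nat \<times> nat \<Rightarrow> complex" where
  "site x v p = (if fst p = x \<and> label p \<in> carrier G then rep_act (V x) (label p) v (fst (snd (snd p))) else 0)"

definition multi_sign :: "('r \<Rightarrow> nat list) \<Rightarrow> ('r \<times> nat \<times> nat \<Rightarrow> nat) \<Rightarrow> (nat \<Rightarrow> 'r \<times> 'g \<times> nat \<times> nat) \<Rightarrow> complex" where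
  "multi_sign lam \<Theta> y = (\<Prod>x\<in>R. column_sign (lam x) (\<lambda>c. row (y (\<Theta> (x, c)))))"

text \<open>The placement \<open>\<Theta>\<close> puts letters into the cells of all diagrams, and \<open>v q\<close> is the vector at the cell \<open>q\<close>. The
  factor \<open>multi_sign\<close> is the product of the values of polytabloids at the tabloids formed by the rows of the
  letters.\<close>

definition generator ::
  "('r \<Rightarrow> nat list) \<Rightarrow> ('r \<times> nat \<times> nat \<Rightarrow> nat) \<Rightarrow> ('r \<times> nat \<times> nat \<Rightarrow> nat \<Rightarrow> complex)
     \<Rightarrow> (nat \<Rightarrow> 'r \<times> 'g \<times> nat \<times> nat) \<Rightarrow> complex" where
  "generator lam \<Theta> v y =
     (\<Prod>q\<in>all_cells lam. site (fst q) (v q) (y (\<Theta> q))) * multi_sign lam \<Theta> y"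

definition placement ::
  "('r \<Rightarrow> nat list) \<Rightarrow> nat \<Rightarrow> ('r \<times> nat \<times> nat \<Rightarrow> nat) \<Rightarrow> ('r \<times> nat \<times> nat \<Rightarrow> nat \<Rightarrow> complex) \<Rightarrow> bool" where
  "placement lam n \<Theta> v \<longleftrightarrow> bij_betw \<Theta> (all_cells lam) {1..n} \<and>
     (\<forall>q\<in>all_cells lam. v q \<in> rep_space (V (fst q)))"

text \<open>At points with a label outside \<open>G\<close> the generators vanish, and so do their translates.\<close>

definition model_act ::
  "nat \<Rightarrow> (nat \<Rightarrow> nat) \<times> (nat \<Rightarrow> 'g) \<Rightarrow> ((nat \<Rightarrow> 'r \<times> 'g \<times> nat \<times> nat) \<Rightarrow> complex)
     \<Rightarrow> (nat \<Rightarrow> 'r \<times> 'g \<times> nat \<times> nat) \<Rightarrow> complex" where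
  "model_act n k f = (\<lambda>y. if \<forall>j\<in>{1..n}. label (y j) \<in> carrier G
     then f (\<lambda>j. shift (snd k (fst k j)) (y (fst k j))) else 0)"

definition model ::
  "('r \<Rightarrow> nat list) \<Rightarrow> nat \<Rightarrow> ((nat \<Rightarrow> nat) \<times> (nat \<Rightarrow> 'g), nat \<Rightarrow> 'r \<times> 'g \<times> nat \<times> nat) rep" where
  "model lam n =
     \<lparr>rep_space = fun_space.span {generator lam \<Theta> v | \<Theta> v. placement lam n \<Theta> v},
      rep_act = model_act n\<rparr>"

text \<open>The vectors at the cells after the action of \<open>k\<close>, which turns the placement \<open>\<Theta>\<close> into \<open>fst k \<circ> \<Theta>\<close>.\<close>

definition moved ::
  "(nat \<Rightarrow> nat) \<times> (nat \<Rightarrow> 'g) \<Rightarrow> ('r \<times> nat \<times> nat \<Rightarrow> nat) \<Rightarrow> ('r \<times> nat \<times> nat \<Rightarrow> nat \<Rightarrow> complex)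
     \<Rightarrow> 'r \<times> nat \<times> nat \<Rightarrow> nat \<Rightarrow> complex" where
  "moved k \<Theta> v q = rep_act (V (fst q)) (snd k (fst k (\<Theta> q))) (v q)"

lemma finite_all_cells [simp]: "finite (all_cells lam)"
  unfolding all_cells_def using finite_R by simp

lemma all_cells_iff: "(x, c) \<in> all_cells lam \<longleftrightarrow> x \<in> R \<and> c \<in> cells (lam x)"
  by (simp add: all_cells_def)

lemma generator_cong:
  assumes "\<And>q. q \<in> all_cells lam \<Longrightarrow> \<Theta> q = \<Theta>' q" "\<And>q. q \<in> all_cells lam \<Longrightarrow> v q = v' q"
  shows "generator lam \<Theta> v = generator lam \<Theta>' v'"
proof
  fix y
  have "multi_sign lam \<Theta> y = multi_sign lam \<Theta>' y"
    unfolding multi_sign_def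
    by (intro prod.cong refl column_sign_cong) (simp add: assms(1) all_cells_iff)
  moreover have "(\<Prod>q\<in>all_cells lam. site (fst q) (v q) (y (\<Theta> q))) =
      (\<Prod>q\<in>all_cells lam. site (fst q) (v' q) (y (\<Theta>' q)))"
    by (intro prod.cong refl) (simp add: assms)
  ultimately show "generator lam \<Theta> v y = generator lam \<Theta>' v' y" by (simp add: generator_def)
qed

lemma placementD:
  assumes "placement lam n \<Theta> v"
  shows "bij_betw \<Theta> (all_cells lam) {1..n}" "q \<in> all_cells lam \<Longrightarrow> v q \<in> rep_space (V (fst q))"
    "q \<in> all_cells lam \<Longrightarrow> \<Theta> q \<in> {1..n}" "\<Theta> ` all_cells lam = {1..n}"
  using assms by (auto simp: placement_def bij_betw_def)

lemma wreath_elt: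
  assumes "k \<in> carrier (wreath_group n G)"
  shows "fst k permutes {1..n}" "j \<in> {1..n} \<Longrightarrow> snd k j \<in> carrier G"
  using assms carrier_wreath_group[of "fst k" "snd k" n G] by (auto simp: PiE_iff)

lemma rep_cell:
  assumes "q \<in> all_cells lam"
  shows "representation G (V (fst q))"
  using V(1) assms by (auto simp: all_cells_def)

lemma placement_moved:
  assumes k: "k \<in> carrier (wreath_group n G)" and p: "placement lam n \<Theta> v"
  shows "placement lam n (fst k \<circ> \<Theta>) (moved k \<Theta> v)"
  unfolding placement_def
proof (intro conjI ballI)
  show "bij_betw (fst k \<circ> \<Theta>) (all_cells lam) {1..n}"
    by (rule bij_betw_trans[OF placementD(1)[OF p] permutes_imp_bij[OF wreath_elt(1)[OF k]]])
  fix q assume q: "q \<in> all_cells lam"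
  have "fst k (\<Theta> q) \<in> {1..n}"
    using placementD(3)[OF p q] permutes_in_image[OF wreath_elt(1)[OF k]] by blast
  then show "moved k \<Theta> v q \<in> rep_space (V (fst q))"
    unfolding moved_def
    by (intro representationD(2)[OF rep_cell[OF q]] wreath_elt(2)[OF k] placementD(2)[OF p q])
qed

lemma model_act_generator:
  assumes k: "k \<in> carrier (wreath_group n G)" and p: "placement lam n \<Theta> v"
  shows "model_act n k (generator lam \<Theta> v) = generator lam (fst k \<circ> \<Theta>) (moved k \<Theta> v)"
proof
  fix y
  interpret group G by (rule G)
  have in_n: "fst k (\<Theta> q) \<in> {1..n}" if "q \<in> all_cells lam" for q
    using placementD(3)[OF p that] permutes_in_image[OF wreath_elt(1)[OF k]] by blast
  show "model_act n k (generator lam \<Theta> v) y = generator lam (fst k \<circ> \<Theta>) (moved k \<Theta> v) y"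
  proof (cases "\<forall>j\<in>{1..n}. label (y j) \<in> carrier G")
    case True
    have "site (fst q) (v q) (shift (snd k (fst k (\<Theta> q))) (y (fst k (\<Theta> q)))) =
        site (fst q) (moved k \<Theta> v q) (y (fst k (\<Theta> q)))" if q: "q \<in> all_cells lam" for q
    proof -
      have l: "label (y (fst k (\<Theta> q))) \<in> carrier G" "snd k (fst k (\<Theta> q)) \<in> carrier G"
        using True in_n[OF q] wreath_elt(2)[OF k] by blast+
      show ?thesis
        using l m_closed[OF l] representationD(5)[OF rep_cell[OF q] l placementD(2)[OF p q]]
        by (simp add: site_def shift_def label_def moved_def)
    qed
    moreover have "row (shift a p) = row p" for a p by (simp add: row_def shift_def)
    ultimately show ?thesis
      using True by (simp add: model_act_def generator_def multi_sign_def)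
  next
    case False
    then obtain j where j: "j \<in> {1..n}" "label (y j) \<notin> carrier G" by blast
    have "j \<in> (fst k \<circ> \<Theta>) ` all_cells lam"
      using placementD(4)[OF placement_moved[OF k p]] j(1) by simp
    then obtain q where q: "q \<in> all_cells lam" "j = fst k (\<Theta> q)" by auto
    have "(\<Prod>q\<in>all_cells lam. site (fst q) (moved k \<Theta> v q) (y ((fst k \<circ> \<Theta>) q))) = 0"
      by (rule prod_zero) (use q j in \<open>auto simp: site_def intro!: bexI[of _ q]\<close>)
    then show ?thesis using False by (auto simp: model_act_def generator_def)
  qed
qed

lemma generator_in_model: "placement lam n \<Theta> v \<Longrightarrow> generator lam \<Theta> v \<in> rep_space (model lam n)"
  unfolding model_def by (auto intro: fun_space.span_base)

lemma linear_model_act: "linear_on S (model_act n k)"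
  by (rule linear_onI) (auto simp: model_act_def fun_eq_iff fun_apply)

lemma model_act_closed:
  assumes k: "k \<in> carrier (wreath_group n G)" and f: "f \<in> rep_space (model lam n)"
  shows "model_act n k f \<in> rep_space (model lam n)"
proof -
  have f': "f \<in> fun_space.span {generator lam \<Theta> v | \<Theta> v. placement lam n \<Theta> v}"
    using f by (simp add: model_def)
  show ?thesis
  proof (rule linear_on_image_span[OF linear_model_act _ _ f'])
    fix F assume "F \<in> {generator lam \<Theta> v | \<Theta> v. placement lam n \<Theta> v}"
    then obtain \<Theta> v where p: "placement lam n \<Theta> v" "F = generator lam \<Theta> v" by blast
    show "model_act n k F \<in> rep_space (model lam n)"
      unfolding p(2) model_act_generator[OF k p(1)] by (rule generator_in_model[OF placement_moved[OF k p(1)]])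
  qed (simp add: model_def)
qed

lemma model_eqI:
  assumes "linear_on (rep_space (model lam n)) A" "linear_on (rep_space (model lam n)) B"
    and "\<And>\<Theta> v. placement lam n \<Theta> v \<Longrightarrow> A (generator lam \<Theta> v) = B (generator lam \<Theta> v)"
    and "f \<in> rep_space (model lam n)"
  shows "A f = B f"
proof (rule linear_on_eq_on_span[where X = "{generator lam \<Theta> v | \<Theta> v. placement lam n \<Theta> v}"])
  show "linear_on (fun_space.span {generator lam \<Theta> v | \<Theta> v. placement lam n \<Theta> v}) A"
    "linear_on (fun_space.span {generator lam \<Theta> v | \<Theta> v. placement lam n \<Theta> v}) B"
    "f \<in> fun_space.span {generator lam \<Theta> v | \<Theta> v. placement lam n \<Theta> v}"
    using assms(1,2,4) by (simp_all add: model_def)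
qed (use assms(3) in blast)

lemma model_act_mult:
  assumes k: "k \<in> carrier (wreath_group n G)" and l: "l \<in> carrier (wreath_group n G)"
    and f: "f \<in> rep_space (model lam n)"
  shows "model_act n (k \<otimes>\<^bsub>wreath_group n G\<^esub> l) f = model_act n k (model_act n l f)"
proof -
  interpret W: group "wreath_group n G" by (rule group_wreath_group[OF G])
  have "model_act n (k \<otimes>\<^bsub>wreath_group n G\<^esub> l) f = (model_act n k \<circ> model_act n l) f"
  proof (rule model_eqI[OF _ _ _ f])
    show "linear_on (rep_space (model lam n)) (model_act n k \<circ> model_act n l)"
      by (rule linear_on_compose[OF linear_model_act linear_model_act subset_refl])
    fix \<Theta> v assume p: "placement lam n \<Theta> v"
    note kl = W.m_closed[OF k l]
    have m: "fst (k \<otimes>\<^bsub>wreath_group n G\<^esub> l) = fst k \<circ> fst l"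
      "\<And>j. j \<in> {1..n} \<Longrightarrow> snd (k \<otimes>\<^bsub>wreath_group n G\<^esub> l) j = snd k j \<otimes>\<^bsub>G\<^esub> snd l (inv' (fst k) j)"
      using mult_wreath_group[of n G "fst k" "snd k" "fst l" "snd l"] by simp_all
    have "model_act n (k \<otimes>\<^bsub>wreath_group n G\<^esub> l) (generator lam \<Theta> v) =
        generator lam (fst k \<circ> (fst l \<circ> \<Theta>)) (moved k (fst l \<circ> \<Theta>) (moved l \<Theta> v))"
      unfolding model_act_generator[OF kl p]
    proof (rule generator_cong)
      fix q assume q: "q \<in> all_cells lam"
      show "(fst (k \<otimes>\<^bsub>wreath_group n G\<^esub> l) \<circ> \<Theta>) q = (fst k \<circ> (fst l \<circ> \<Theta>)) q" by (simp add: m(1))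
      have 1: "fst l (\<Theta> q) \<in> {1..n}"
        using placementD(3)[OF p q] permutes_in_image[OF wreath_elt(1)[OF l]] by blast
      then have 2: "fst k (fst l (\<Theta> q)) \<in> {1..n}"
        using permutes_in_image[OF wreath_elt(1)[OF k]] by blast
      show "moved (k \<otimes>\<^bsub>wreath_group n G\<^esub> l) \<Theta> v q = moved k (fst l \<circ> \<Theta>) (moved l \<Theta> v) q"
        unfolding moved_def m(1)
        using m(2)[OF 2] permutes_inverses(2)[OF wreath_elt(1)[OF k]]
          representationD(5)[OF rep_cell[OF q] wreath_elt(2)[OF k 2] wreath_elt(2)[OF l 1] placementD(2)[OF p q]]
        by simp
    qed
    then show "model_act n (k \<otimes>\<^bsub>wreath_group n G\<^esub> l) (generator lam \<Theta> v) =
        (model_act n k \<circ> model_act n l) (generator lam \<Theta> v)"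
      by (simp add: model_act_generator[OF l p] model_act_generator[OF k placement_moved[OF l p]])
  qed (rule linear_model_act)
  then show ?thesis by simp
qed

lemma representation_model: "representation (wreath_group n G) (model lam n)"
proof -
  interpret W: group "wreath_group n G" by (rule group_wreath_group[OF G])
  have act: "rep_act (model lam n) = model_act n" by (simp add: model_def)
  show ?thesis
    unfolding representation_def act
  proof (intro conjI ballI)
    show "subspace_fun (rep_space (model lam n))" by (simp add: model_def)
    show "model_act n k ` rep_space (model lam n) \<subseteq> rep_space (model lam n)"
      if "k \<in> carrier (wreath_group n G)" for k using model_act_closed[OF that] by blast
    show "linear_on (rep_space (model lam n)) (model_act n k)" for k by (rule linear_model_act)
    show "model_act n (k \<otimes>\<^bsub>wreath_group n G\<^esub> l) f = model_act n k (model_act n l f)"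
      if "k \<in> carrier (wreath_group n G)" "l \<in> carrier (wreath_group n G)" "f \<in> rep_space (model lam n)" for k l f
      using that by (rule model_act_mult)
    fix f assume f: "f \<in> rep_space (model lam n)"
    have "model_act n \<one>\<^bsub>wreath_group n G\<^esub> f = id f"
    proof (rule model_eqI[OF linear_model_act _ _ f])
      show "linear_on (rep_space (model lam n)) id" by (simp add: linear_on_def)
      fix \<Theta> v assume p: "placement lam n \<Theta> v"
      have "model_act n \<one>\<^bsub>wreath_group n G\<^esub> (generator lam \<Theta> v) = generator lam \<Theta> v"
        unfolding model_act_generator[OF W.one_closed p]
      proof (rule generator_cong)
        fix q assume q: "q \<in> all_cells lam"
        show "moved \<one>\<^bsub>wreath_group n G\<^esub> \<Theta> v q = v q"
          using placementD(2,3)[OF p q] representationD(4)[OF rep_cell[OF q]]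
          by (simp add: moved_def one_wreath_group del: atLeastAtMost_iff One_nat_def)
      qed (simp add: one_wreath_group)
      then show "model_act n \<one>\<^bsub>wreath_group n G\<^esub> (generator lam \<Theta> v) = id (generator lam \<Theta> v)" by simp
    qed
    then show "model_act n \<one>\<^bsub>wreath_group n G\<^esub> f = f" by simp
  qed
qed

lemma linear_site:
  assumes "x \<in> R"
  shows "linear_on (rep_space (V x)) (site x)"
  using linear_on_add[OF representationD(3)[OF V(1)[OF assms]]]
    linear_on_scale[OF representationD(3)[OF V(1)[OF assms]]]
  by (intro linear_onI ext; simp add: site_def plus_fun_apply; simp add: cscale_def site_def)

text \<open>A generator is the product of a pure tensor with factors in a fixed finite-dimensional space and of one of
  finitely many sign functions.\<close>

lemma finite_dim_model: "finite_dim (rep_space (model lam n))"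
proof -
  define S where "S = (\<Union>x\<in>R. site x ` rep_space (V x))"
  define T where "T = {pure_tensor_family {1..n} a | a. \<forall>j\<in>{1..n}. a j \<in> S}"
  define M where "M = multi_sign lam ` (all_cells lam \<rightarrow>\<^sub>E {1..n})"
  have "finite_dim S"
    unfolding S_def
    by (intro finite_dim_UN finite_R finite_dim_image V(2) representationD(1)[OF V(1)] linear_site)
  then have T: "finite_dim T" unfolding T_def by (intro finite_dim_pure_tensor_family) auto
  have M: "finite_dim M"
    unfolding M_def by (intro finite_dim_finite finite_imageI finite_PiE) auto
  have "generator lam \<Theta> v \<in> {\<lambda>y. a (id y) * b (id y) | a b. a \<in> T \<and> b \<in> M}" if p: "placement lam n \<Theta> v" for \<Theta> v
  proof -
    let ?i = "inv_into (all_cells lam) \<Theta>"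
    note bij = placementD(1)[OF p]
    have i: "?i j \<in> all_cells lam" "\<Theta> (?i j) = j" if "j \<in> {1..n}" for j
      using bij_betwE[OF bij_betw_inv_into[OF bij]] bij_betw_inv_into_right[OF bij] that by blast+
    let ?a = "\<lambda>j. site (fst (?i j)) (v (?i j))"
    have prod: "(\<Prod>q\<in>all_cells lam. site (fst q) (v q) (y (\<Theta> q))) = pure_tensor_family {1..n} ?a y" for y
    proof -
      have "pure_tensor_family {1..n} ?a y = (\<Prod>q\<in>all_cells lam. ?a (\<Theta> q) (y (\<Theta> q)))"
        unfolding pure_tensor_family_def by (rule prod.reindex_bij_betw[OF bij, symmetric])
      also have "\<dots> = (\<Prod>q\<in>all_cells lam. site (fst q) (v q) (y (\<Theta> q)))"
        by (intro prod.cong refl) (simp add: bij_betw_inv_into_left[OF bij])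
      finally show ?thesis by simp
    qed
    have "?a j \<in> S" if "j \<in> {1..n}" for j
      unfolding S_def using i(1)[OF that] placementD(2)[OF p i(1)[OF that]] by (auto simp: all_cells_def)
    then have "pure_tensor_family {1..n} ?a \<in> T" unfolding T_def by blast
    moreover have "multi_sign lam \<Theta> = multi_sign lam (restrict \<Theta> (all_cells lam))"
      unfolding multi_sign_def
      by (intro ext prod.cong refl column_sign_cong) (simp add: all_cells_iff)
    then have "multi_sign lam \<Theta> \<in> M"
      unfolding M_def using placementD(3)[OF p] by (intro image_eqI[of _ _ "restrict \<Theta> (all_cells lam)"]) auto
    moreover have "generator lam \<Theta> v = (\<lambda>y. pure_tensor_family {1..n} ?a (id y) * multi_sign lam \<Theta> (id y))"
      by (simp add: fun_eq_iff generator_def prod)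
    ultimately show ?thesis by blast
  qed
  then have "{generator lam \<Theta> v | \<Theta> v. placement lam n \<Theta> v} \<subseteq>
      {\<lambda>y. a (id y) * b (id y) | a b. a \<in> T \<and> b \<in> M}" by blast
  from finite_dim_subset[OF finite_dim_product[OF T M] this] show ?thesis by (simp add: model_def)
qed

end

text \<open>The diagram at the index \<open>x0\<close> has a first row of variable length, above the fixed rows \<open>ks\<close>. Since \<open>V x0\<close> is
  the line of the multiples of \<open>e\<close>, there is essentially one choice for the vector at a new cell.\<close>

locale first_row = wreath_model +
  fixes x0 :: 'c and lam :: "'c \<Rightarrow> nat list" and ks :: "nat list" and e :: "nat \<Rightarrow> complex"
  assumes x0: "x0 \<in> R" and line: "rep_space (V x0) = range (\<lambda>c. cscale c e)"
begin

definition lam_row :: "nat \<Rightarrow> 'c \<Rightarrow> nat list" where "lam_row k = lam(x0 := k # ks)"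

text \<open>A finite set, independent of the length of the first row, that contains every cell at another index, below
  the first row, or in a column with several cells. Of the two copies of the cells of the fixed rows, the
  first covers the other indices and the second the rows below the first one at \<open>x0\<close>.\<close>

definition core :: "('c \<times> nat \<times> nat) set" where
  "core = all_cells (lam(x0 := ks)) \<union> (\<lambda>(x, i, j). (x, Suc i, j)) ` all_cells (lam(x0 := ks)) \<union> {x0} \<times> {0} \<times> {..<sum_list ks}"

lemma finite_core: "finite core" by (simp add: core_def)

lemma all_cells_Suc: "all_cells (lam_row (Suc k)) = insert (x0, 0, k) (all_cells (lam_row k))"
  using x0 by (auto simp: all_cells_def lam_row_def cells_Suc split: if_splits)

lemma new_cell: "(x0, 0, k) \<notin> all_cells (lam_row k)"
  by (simp add: all_cells_iff lam_row_def cells_Cons)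

lemma outside_core:
  assumes "q \<in> all_cells (lam_row k)" "q \<notin> core"
  obtains j where "q = (x0, 0, j)" "sum_list ks \<le> j" "(0, j) \<in> cells (k # ks)"
proof -
  obtain x i j where q: "q = (x, i, j)" by (cases q)
  have x: "x \<in> R" and c: "(i, j) \<in> cells (lam_row k x)" using assms(1) by (auto simp: q all_cells_iff)
  have "x = x0"
  proof (rule ccontr)
    assume "x \<noteq> x0"
    then have "q \<in> all_cells (lam(x0 := ks))" using x c by (simp add: q all_cells_iff lam_row_def)
    then show False using assms(2) by (simp add: core_def)
  qed
  then have c': "(i, j) \<in> cells (k # ks)" using c by (simp add: lam_row_def)
  have "i = 0"
  proof (rule ccontr)
    assume "i \<noteq> 0"
    then obtain i' where "i = Suc i'" "(i', j) \<in> cells ks" using c' by (auto simp: cells_Cons)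
    then have "q \<in> (\<lambda>(x, i, j). (x, Suc i, j)) ` all_cells (lam(x0 := ks))"
      using x \<open>x = x0\<close> by (auto simp: q all_cells_iff image_iff intro!: bexI[of _ "(x0, i', j)"])
    then show False using assms(2) by (simp add: core_def)
  qed
  then have "sum_list ks \<le> j" using assms(2) \<open>x = x0\<close> by (auto simp: q core_def)
  then show thesis using that q \<open>x = x0\<close> \<open>i = 0\<close> c' by simp
qed

text \<open>The tensor product with the vector \<open>e\<close> in the first row at the index \<open>x0\<close>, placed at the letter \<open>n + 1\<close>.\<close>

definition grow :: "((nat \<Rightarrow> 'c \<times> 'a \<times> nat \<times> nat) \<Rightarrow> complex) \<Rightarrow> nat \<Rightarrow> (nat \<Rightarrow> 'c \<times> 'a \<times> nat \<times> nat) \<Rightarrow> complex" where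
  "grow f n y = f y * (site x0 e (y (Suc n)) * (if row (y (Suc n)) = 0 then 1 else 0))"

lemma e_in: "e \<in> rep_space (V x0)"
  unfolding line by (rule range_eqI[of _ _ 1]) simp

lemma multi_sign_Suc:
  assumes "sum_list ks \<le> k"
  shows "multi_sign (lam_row (Suc k)) \<Theta> y =
    multi_sign (lam_row k) \<Theta> y * (if row (y (\<Theta> (x0, 0, k))) = 0 then 1 else 0)"
proof -
  have "multi_sign (lam_row m) \<Theta> y = column_sign (m # ks) (\<lambda>c. row (y (\<Theta> (x0, c)))) *
      (\<Prod>x\<in>R - {x0}. column_sign (lam x) (\<lambda>c. row (y (\<Theta> (x, c)))))" for m
    unfolding multi_sign_def lam_row_def prod.remove[OF finite_R x0] by simp
  then show ?thesis using column_sign_extend[OF assms] by simp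
qed

lemma generator_Suc:
  assumes k: "sum_list ks \<le> k" and \<Theta>: "\<Theta> (x0, 0, k) = Suc n" and v: "v (x0, 0, k) = cscale c e"
  shows "generator (lam_row (Suc k)) \<Theta> v = cscale c (grow (generator (lam_row k) \<Theta> v) n)"
proof
  fix y
  have site: "site x0 (v (x0, 0, k)) p = c * site x0 e p" for p
    unfolding v using fun_cong[OF linear_on_scale[OF linear_site[OF x0] e_in, of c], of p]
    by (simp only: cscale_def)
  show "generator (lam_row (Suc k)) \<Theta> v y = cscale c (grow (generator (lam_row k) \<Theta> v) n) y"
    unfolding generator_def grow_def all_cells_Suc multi_sign_Suc[OF k] cscale_def
    using new_cell[of k] \<Theta> by (simp add: site)
qed

lemma placement_Suc_iff:
  assumes "\<Theta> (x0, 0, k) = Suc n"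
  shows "placement (lam_row (Suc k)) (Suc n) \<Theta> v \<longleftrightarrow>
    placement (lam_row k) n \<Theta> v \<and> v (x0, 0, k) \<in> rep_space (V x0)"
proof -
  have "{1..Suc n} = insert (Suc n) {1..n}" by auto
  moreover have "bij_betw \<Theta> (insert (x0, 0, k) (all_cells (lam_row k))) (insert (Suc n) {1..n}) \<longleftrightarrow>
      bij_betw \<Theta> (all_cells (lam_row k)) {1..n}"
    using notIn_Un_bij_betw3[OF new_cell[of k], of \<Theta> "{1..n}"] assms by simp
  ultimately show ?thesis by (auto simp: placement_def all_cells_Suc)
qed

text \<open>Two cells of the first row that are alone in their columns may be exchanged, with their letters and
  vectors.\<close>

lemma swap_free_cells:
  assumes j: "sum_list ks \<le> j" "(0, j) \<in> cells (k # ks)" and j': "sum_list ks \<le> j'" "(0, j') \<in> cells (k # ks)"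
  defines "s \<equiv> transpose (x0, 0, j) (x0, 0, j')"
  shows "generator (lam_row k) (\<Theta> \<circ> s) (v \<circ> s) = generator (lam_row k) \<Theta> v"
    and "placement (lam_row k) n \<Theta> v \<Longrightarrow> placement (lam_row k) n (\<Theta> \<circ> s) (v \<circ> s)"
proof -
  have mem: "(x0, 0, j) \<in> all_cells (lam_row k)" "(x0, 0, j') \<in> all_cells (lam_row k)"
    using x0 j(2) j'(2) by (simp_all add: all_cells_iff lam_row_def)
  then have bij: "bij_betw s (all_cells (lam_row k)) (all_cells (lam_row k))"
    unfolding s_def by (intro permutes_imp_bij permutes_swap_id)
  have fst_s: "fst (s q) = fst q" for q by (auto simp: s_def transpose_def)
  have s0: "s (x0, c) = (x0, transpose (0, j) (0, j') c)" for c by (auto simp: s_def transpose_def)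
  have s1: "s (x, c) = (x, c)" if "x \<noteq> x0" for x c using that by (auto simp: s_def transpose_def)
  show "generator (lam_row k) (\<Theta> \<circ> s) (v \<circ> s) = generator (lam_row k) \<Theta> v"
  proof
    fix y
    have "(\<Prod>q\<in>all_cells (lam_row k). site (fst q) ((v \<circ> s) q) (y ((\<Theta> \<circ> s) q))) =
        (\<Prod>q\<in>all_cells (lam_row k). site (fst (s q)) (v (s q)) (y (\<Theta> (s q))))"
      by (simp add: fst_s)
    also have "\<dots> = (\<Prod>q\<in>all_cells (lam_row k). site (fst q) (v q) (y (\<Theta> q)))"
      by (rule prod.reindex_bij_betw[OF bij])
    finally have 1: "(\<Prod>q\<in>all_cells (lam_row k). site (fst q) ((v \<circ> s) q) (y ((\<Theta> \<circ> s) q))) =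
        (\<Prod>q\<in>all_cells (lam_row k). site (fst q) (v q) (y (\<Theta> q)))" .
    have "column_sign (lam_row k x) (\<lambda>c. row (y ((\<Theta> \<circ> s) (x, c)))) =
        column_sign (lam_row k x) (\<lambda>c. row (y (\<Theta> (x, c))))" for x
    proof (cases "x = x0")
      case True
      then show ?thesis
        using column_sign_swap[OF j j', of "\<lambda>c. row (y (\<Theta> (x0, c)))"] by (simp add: s0 lam_row_def comp_def)
    qed (simp add: s1)
    then have "multi_sign (lam_row k) (\<Theta> \<circ> s) y = multi_sign (lam_row k) \<Theta> y" by (simp add: multi_sign_def)
    then show "generator (lam_row k) (\<Theta> \<circ> s) (v \<circ> s) y = generator (lam_row k) \<Theta> v y"
      unfolding generator_def 1 by simp
  qed
  show "placement (lam_row k) n (\<Theta> \<circ> s) (v \<circ> s)" if p: "placement (lam_row k) n \<Theta> v"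
    unfolding placement_def
  proof (intro conjI ballI)
    show "bij_betw (\<Theta> \<circ> s) (all_cells (lam_row k)) {1..n}" by (rule bij_betw_trans[OF bij placementD(1)[OF p]])
    fix q assume "q \<in> all_cells (lam_row k)"
    then have "s q \<in> all_cells (lam_row k)" using bij_betwE[OF bij] by blast
    from placementD(2)[OF p this] show "(v \<circ> s) q \<in> rep_space (V (fst q))" by (simp add: fst_s)
  qed
qed

lemma linear_grow: "linear_on S (\<lambda>f. grow f n)"
  by (rule linear_onI) (auto simp: grow_def fun_eq_iff fun_apply algebra_simps)

lemma grow_generator:
  assumes k: "sum_list ks \<le> k" and p: "placement (lam_row k) n \<Theta> v"
  defines "\<Theta>' \<equiv> \<Theta>((x0, 0, k) := Suc n)" and "v' \<equiv> v((x0, 0, k) := e)"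
  shows "grow (generator (lam_row k) \<Theta> v) n = generator (lam_row (Suc k)) \<Theta>' v'"
    and "placement (lam_row (Suc k)) (Suc n) \<Theta>' v'"
proof -
  have cong: "\<Theta> q = \<Theta>' q" "v q = v' q" if "q \<in> all_cells (lam_row k)" for q
    using that new_cell[of k] by (auto simp: \<Theta>'_def v'_def)
  have "generator (lam_row (Suc k)) \<Theta>' v' = cscale 1 (grow (generator (lam_row k) \<Theta>' v') n)"
    by (rule generator_Suc[OF k]) (simp_all add: \<Theta>'_def v'_def)
  also have "generator (lam_row k) \<Theta>' v' = generator (lam_row k) \<Theta> v"
    by (rule generator_cong) (simp_all add: cong)
  finally show "grow (generator (lam_row k) \<Theta> v) n = generator (lam_row (Suc k)) \<Theta>' v'" by simp
  have "bij_betw \<Theta>' (all_cells (lam_row k)) {1..n} \<longleftrightarrow> bij_betw \<Theta> (all_cells (lam_row k)) {1..n}"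
    by (rule bij_betw_cong) (simp add: cong)
  then have "placement (lam_row k) n \<Theta>' v'"
    using p cong(2) by (simp add: placement_def)
  then show "placement (lam_row (Suc k)) (Suc n) \<Theta>' v'"
    using placement_Suc_iff[of \<Theta>' k n v'] e_in by (simp add: \<Theta>'_def v'_def)
qed

text \<open>A letter outside \<open>\<Theta> ` core\<close> is placed in a cell of the first row that is alone in its column. After the
  exchange of this letter with \<open>n + 1\<close>, and of this cell with the last cell of the row, the letter \<open>n + 1\<close>
  is in the last cell, and the generator is a multiple of one that has grown.\<close>

theorem model_grows_stably:
  assumes k: "sum_list ks \<le> k"
  shows "grows_stably G (card core) n (model (lam_row k) n) (model (lam_row (Suc k)) (Suc n))"
proof -
  let ?M = "model (lam_row k) n" and ?M' = "model (lam_row (Suc k)) (Suc n)" and ?p = "(x0, 0, k) :: 'c \<times> nat \<times> nat"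
  define \<iota> where "\<iota> f = grow f n" for f
  have lin: "linear_on S \<iota>" for S unfolding \<iota>_def by (rule linear_grow)
  have act: "rep_act ?M = model_act n" "rep_act ?M' = model_act (Suc n)" by (simp_all add: model_def)
  have mem: "\<iota> f \<in> rep_space ?M'" if f: "f \<in> rep_space ?M" for f
  proof (rule linear_on_image_span[OF lin _ _ f[unfolded model_def rep.select_convs]])
    fix F assume "F \<in> {generator (lam_row k) \<Theta> v | \<Theta> v. placement (lam_row k) n \<Theta> v}"
    then obtain \<Theta> v where p: "placement (lam_row k) n \<Theta> v" "F = generator (lam_row k) \<Theta> v" by blast
    show "\<iota> F \<in> rep_space ?M'"
      unfolding p(2) \<iota>_def grow_generator(1)[OF k p(1)] by (rule generator_in_model[OF grow_generator(2)[OF k p(1)]])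
  qed (simp add: model_def)
  have equi: "\<iota> (model_act n g f) = model_act (Suc n) (wreath_ext n G g) (\<iota> f)"
    if g: "g \<in> carrier (wreath_group n G)" and f: "f \<in> rep_space ?M" for g f
  proof -
    note g' = wreath_ext_closed[OF G g]
    have fst': "fst (wreath_ext n G g) = fst g" and snd': "snd (wreath_ext n G g) = (snd g)(Suc n := \<one>\<^bsub>G\<^esub>)"
      by (simp_all add: wreath_ext_def case_prod_beta)
    have last: "fst g (Suc n) = Suc n" using permutes_not_in[OF wreath_elt(1)[OF g]] by simp
    have "(\<iota> \<circ> model_act n g) f = (model_act (Suc n) (wreath_ext n G g) \<circ> \<iota>) f"
    proof (rule model_eqI[OF _ _ _ f])
      show "linear_on (rep_space ?M) (\<iota> \<circ> model_act n g)"
        by (rule linear_on_compose[OF linear_model_act lin subset_refl])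
      show "linear_on (rep_space ?M) (model_act (Suc n) (wreath_ext n G g) \<circ> \<iota>)"
        by (rule linear_on_compose[OF lin linear_model_act subset_refl])
      fix \<Theta> v assume p: "placement (lam_row k) n \<Theta> v"
      have "\<iota> (model_act n g (generator (lam_row k) \<Theta> v)) =
          generator (lam_row (Suc k)) ((fst g \<circ> \<Theta>)(?p := Suc n)) ((moved g \<Theta> v)(?p := e))"
        unfolding \<iota>_def model_act_generator[OF g p] by (rule grow_generator(1)[OF k placement_moved[OF g p]])
      also have "\<dots> = generator (lam_row (Suc k)) (fst (wreath_ext n G g) \<circ> (\<Theta>(?p := Suc n)))
          (moved (wreath_ext n G g) (\<Theta>(?p := Suc n)) (v(?p := e)))"
      proof (rule generator_cong)
        fix q assume q: "q \<in> all_cells (lam_row (Suc k))"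
        show "((fst g \<circ> \<Theta>)(?p := Suc n)) q = (fst (wreath_ext n G g) \<circ> (\<Theta>(?p := Suc n))) q"
          by (simp add: fst' last)
        show "((moved g \<Theta> v)(?p := e)) q = moved (wreath_ext n G g) (\<Theta>(?p := Suc n)) (v(?p := e)) q"
        proof (cases "q = ?p")
          case True
          then show ?thesis
            using representationD(4)[OF V(1)[OF x0] e_in] by (simp add: moved_def fst' snd' last)
        next
          case False
          then have "\<Theta> q \<in> {1..n}" using placementD(3)[OF p, of q] q by (simp add: all_cells_Suc)
          then have "fst g (\<Theta> q) \<in> {1..n}" using permutes_in_image[OF wreath_elt(1)[OF g]] by blast
          then show ?thesis using False by (simp add: moved_def fst' snd')
        qed
      qed
      also have "\<dots> = model_act (Suc n) (wreath_ext n G g) (\<iota> (generator (lam_row k) \<Theta> v))"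
        unfolding \<iota>_def grow_generator(1)[OF k p]
        by (rule model_act_generator[OF g' grow_generator(2)[OF k p], symmetric])
      finally show "(\<iota> \<circ> model_act n g) (generator (lam_row k) \<Theta> v) =
          (model_act (Suc n) (wreath_ext n G g) \<circ> \<iota>) (generator (lam_row k) \<Theta> v)" by simp
    qed
    then show ?thesis by simp
  qed
  define X where "X = {x \<in> rep_space ?M'. \<exists>A. finite A \<and> card A \<le> card core \<and>
     (\<forall>j\<in>{1..Suc n} - A. model_act (Suc n) (wreath_swap n G j) x \<in> \<iota> ` rep_space ?M)}"
  have gen: "generator (lam_row (Suc k)) \<Theta> v \<in> X" if p: "placement (lam_row (Suc k)) (Suc n) \<Theta> v" for \<Theta> v
  proof -
    let ?A = "\<Theta> ` core"
    have "model_act (Suc n) (wreath_swap n G j) (generator (lam_row (Suc k)) \<Theta> v) \<in> \<iota> ` rep_space ?M"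
      if j: "j \<in> {1..Suc n} - ?A" for j
    proof -
      have s: "wreath_swap n G j \<in> carrier (wreath_group (Suc n) G)" using wreath_swap_closed[OF G] j by blast
      let ?\<Theta> = "fst (wreath_swap n G j) \<circ> \<Theta>" and ?v = "moved (wreath_swap n G j) \<Theta> v"
      note p1 = placement_moved[OF s p]
      obtain q where q: "q \<in> all_cells (lam_row (Suc k))" "\<Theta> q = j" using placementD(4)[OF p] j by (metis DiffD1 imageE)
      have "q \<notin> core" using j q(2) by blast
      then obtain i where i: "q = (x0, 0, i)" "sum_list ks \<le> i" "(0, i) \<in> cells (Suc k # ks)"
        using outside_core[OF q(1)] by blast
      have kc: "(0, k) \<in> cells (Suc k # ks)" by (simp add: cells_Cons)
      let ?s = "transpose (x0, 0, i) ?p"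
      note sw = swap_free_cells[OF i(2,3) k kc, where \<Theta> = ?\<Theta> and v = ?v]
      have p2: "placement (lam_row (Suc k)) (Suc n) (?\<Theta> \<circ> ?s) (?v \<circ> ?s)" by (rule sw(2)[OF p1])
      have last: "(?\<Theta> \<circ> ?s) ?p = Suc n" using q(2) i(1) by (simp add: wreath_swap_def)
      have p3: "placement (lam_row k) n (?\<Theta> \<circ> ?s) (?v \<circ> ?s)" "(?v \<circ> ?s) ?p \<in> rep_space (V x0)"
        using placement_Suc_iff[where \<Theta> = "?\<Theta> \<circ> ?s" and k = k and n = n, OF last] p2 by blast+
      obtain c where c: "(?v \<circ> ?s) ?p = cscale c e" using p3(2) unfolding line by blast
      have "model_act (Suc n) (wreath_swap n G j) (generator (lam_row (Suc k)) \<Theta> v) =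
          generator (lam_row (Suc k)) (?\<Theta> \<circ> ?s) (?v \<circ> ?s)"
        unfolding model_act_generator[OF s p] sw(1) ..
      also have "\<dots> = cscale c (\<iota> (generator (lam_row k) (?\<Theta> \<circ> ?s) (?v \<circ> ?s)))"
        unfolding \<iota>_def
        by (rule generator_Suc[where \<Theta> = "?\<Theta> \<circ> ?s" and v = "?v \<circ> ?s", OF k last c])
      also have "\<dots> = \<iota> (cscale c (generator (lam_row k) (?\<Theta> \<circ> ?s) (?v \<circ> ?s)))"
        using linear_on_scale[OF lin[of UNIV]] by simp
      finally show ?thesis
        using fun_space.subspace_scale[OF representationD(1)[OF representation_model] generator_in_model[OF p3(1)]]
        by blast
    qed
    then show ?thesis
      unfolding X_def using generator_in_model[OF p] finite_core card_image_le[OF finite_core] by blast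
  qed
  have "rep_space ?M' \<subseteq> fun_space.span X"
    unfolding model_def rep.select_convs by (rule fun_space.span_mono) (use gen in blast)
  then show ?thesis
    unfolding grows_stably_def act X_def[symmetric]
    by (intro exI[of _ \<iota>] conjI lin) (use mem equi X_def in auto)
qed

end

section \<open>The induced representation and its model\<close>

lemma wreath_rep_space:
  "rep_space (wreath_rep m V W) =
     fun_space.span {pure_tensor (pure_tensor_family {1..m} v) w | v w.
       (\<forall>k\<in>{1..m}. v k \<in> rep_space V) \<and> w \<in> rep_space W}"
  by (simp add: wreath_rep_def Let_def)

text \<open>The prescription on pure tensors is a permutation of the factors, followed by linear maps of the single
  factors.\<close>

lemma wreath_rep_act:
  fixes V :: "('g, 'x) rep" and W :: "(nat \<Rightarrow> nat, 'y) rep"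
  assumes V: "representation G V" and W: "subspace_fun (rep_space W)"
    and \<sigma>: "\<sigma> permutes {1..m}" "linear_on (rep_space W) (rep_act W \<sigma>)"
    and g: "\<And>k. k \<in> {1..m} \<Longrightarrow> g k \<in> carrier G"
  shows "linear_on (rep_space (wreath_rep m V W)) (rep_act (wreath_rep m V W) (\<sigma>, g))"
    and "(\<And>k. k \<in> {1..m} \<Longrightarrow> v k \<in> rep_space V) \<Longrightarrow> w \<in> rep_space W \<Longrightarrow>
      rep_act (wreath_rep m V W) (\<sigma>, g) (pure_tensor (pure_tensor_family {1..m} v) w) =
      pure_tensor (pure_tensor_family {1..m} (\<lambda>k. rep_act V (g k) (v (inv' \<sigma> k)))) (rep_act W \<sigma> w)"
proof -
  let ?X = "{pure_tensor_family {1..m} v | v. \<forall>k\<in>{1..m}. v k \<in> rep_space V}"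
  let ?Y = "{pure_tensor (pure_tensor_family {1..m} v) w | v w. (\<forall>k\<in>{1..m}. v k \<in> rep_space V) \<and> w \<in> rep_space W}"
  let ?P = "\<lambda>T. linear_on (fun_space.span ?Y) T \<and> (\<forall>v w. (\<forall>k\<in>{1..m}. v k \<in> rep_space V) \<and> w \<in> rep_space W \<longrightarrow>
    T (pure_tensor (pure_tensor_family {1..m} v) w) =
    pure_tensor (pure_tensor_family {1..m} (\<lambda>k. rep_act V (g k) (v (inv' \<sigma> k)))) (rep_act W \<sigma> w))"
  obtain T1 where T1: "linear_on (fun_space.span ?X) T1"
    "\<And>v. (\<forall>k\<in>{1..m}. v k \<in> rep_space V) \<Longrightarrow>
      T1 (pure_tensor_family {1..m} v) = pure_tensor_family {1..m} (\<lambda>k. rep_act V (g k) (v k))"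
    using tensor_family_map_exists[of "{1..m}" "\<lambda>_. rep_space V" "\<lambda>k. rep_act V (g k)"]
      representationD(3)[OF V g] representationD(1)[OF V] by blast
  define S where "S F = (\<lambda>x. F (x \<circ> \<sigma>))" for F :: "(nat \<Rightarrow> 'x) \<Rightarrow> complex"
  have S: "linear_on A S" for A by (rule linear_onI) (auto simp: S_def fun_eq_iff fun_apply)
  have Sv: "S (pure_tensor_family {1..m} v) = pure_tensor_family {1..m} (\<lambda>k. v (inv' \<sigma> k))" for v
  proof
    fix x
    have "pure_tensor_family {1..m} (\<lambda>k. v (inv' \<sigma> k)) x = (\<Prod>k\<in>{1..m}. v (inv' \<sigma> (\<sigma> k)) (x (\<sigma> k)))"
      unfolding pure_tensor_family_def by (rule prod.reindex_bij_betw[OF permutes_imp_bij[OF \<sigma>(1)], symmetric])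
    then show "S (pure_tensor_family {1..m} v) x = pure_tensor_family {1..m} (\<lambda>k. v (inv' \<sigma> k)) x"
      by (simp add: S_def pure_tensor_family_def permutes_inverses(2)[OF \<sigma>(1)])
  qed
  have perm: "\<forall>k\<in>{1..m}. v (inv' \<sigma> k) \<in> rep_space V" if "\<forall>k\<in>{1..m}. v k \<in> rep_space V" for v
    using that permutes_in_image[OF permutes_inv[OF \<sigma>(1)]] by blast
  have SX: "S ` fun_space.span ?X \<subseteq> fun_space.span ?X"
  proof clarify
    fix F assume F: "F \<in> fun_space.span ?X"
    show "S F \<in> fun_space.span ?X"
    proof (rule linear_on_image_span[OF S _ _ F])
      fix F assume "F \<in> ?X"
      then obtain v where v: "\<forall>k\<in>{1..m}. v k \<in> rep_space V" "F = pure_tensor_family {1..m} v" by blast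
      show "S F \<in> fun_space.span ?X" unfolding v(2) Sv using perm[OF v(1)] by (intro fun_space.span_base) blast
    qed simp
  qed
  have lin: "linear_on (fun_space.span ?X) (T1 \<circ> S)" by (rule linear_on_compose[OF S T1(1) SX])
  obtain T where T: "linear_on (fun_space.span {pure_tensor u w | u w. u \<in> fun_space.span ?X \<and> w \<in> rep_space W}) T"
    "\<And>u w. u \<in> fun_space.span ?X \<Longrightarrow> w \<in> rep_space W \<Longrightarrow> T (pure_tensor u w) = pure_tensor ((T1 \<circ> S) u) (rep_act W \<sigma> w)"
    using tensor_map_exists[OF lin fun_space.subspace_span \<sigma>(2) W] by blast
  have XB: "pure_tensor_family {1..m} v \<in> fun_space.span ?X" if "\<forall>k\<in>{1..m}. v k \<in> rep_space V" for v
    using that by (intro fun_space.span_base) blast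
  have "?P T"
  proof (intro conjI allI impI)
    show "linear_on (fun_space.span ?Y) T"
      by (rule linear_on_subset[OF T(1) fun_space.span_mono]) (use XB in blast)
    fix v w assume vw: "(\<forall>k\<in>{1..m}. v k \<in> rep_space V) \<and> w \<in> rep_space W"
    show "T (pure_tensor (pure_tensor_family {1..m} v) w) =
        pure_tensor (pure_tensor_family {1..m} (\<lambda>k. rep_act V (g k) (v (inv' \<sigma> k)))) (rep_act W \<sigma> w)"
      using vw T(2)[OF XB] Sv[of v] T1(2)[OF perm] by simp
  qed
  then have "?P (SOME T. ?P T)" by (rule someI[of ?P])
  moreover have "rep_act (wreath_rep m V W) (\<sigma>, g) = (SOME T. ?P T)"
    by (simp add: wreath_rep_def Let_def)
  ultimately have *: "?P (rep_act (wreath_rep m V W) (\<sigma>, g))" by simp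
  then show "linear_on (rep_space (wreath_rep m V W)) (rep_act (wreath_rep m V W) (\<sigma>, g))"
    unfolding wreath_rep_space by blast
  show "(\<And>k. k \<in> {1..m} \<Longrightarrow> v k \<in> rep_space V) \<Longrightarrow> w \<in> rep_space W \<Longrightarrow>
      rep_act (wreath_rep m V W) (\<sigma>, g) (pure_tensor (pure_tensor_family {1..m} v) w) =
      pure_tensor (pure_tensor_family {1..m} (\<lambda>k. rep_act V (g k) (v (inv' \<sigma> k)))) (rep_act W \<sigma> w)"
    using * by blast
qed

lemma ext_tensor_rep_space:
  "rep_space (ext_tensor_rep I V) =
     fun_space.span {pure_tensor_family I v | v. \<forall>i\<in>I. v i \<in> rep_space (V i)}"
  by (simp add: ext_tensor_rep_def Let_def)

lemma ext_tensor_rep_act: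
  assumes "finite I" "\<And>i. i \<in> I \<Longrightarrow> subspace_fun (rep_space (V i))"
    and "\<And>i. i \<in> I \<Longrightarrow> linear_on (rep_space (V i)) (rep_act (V i) (h i))"
  shows "linear_on (rep_space (ext_tensor_rep I V)) (rep_act (ext_tensor_rep I V) h)"
    and "(\<And>i. i \<in> I \<Longrightarrow> v i \<in> rep_space (V i)) \<Longrightarrow>
      rep_act (ext_tensor_rep I V) h (pure_tensor_family I v) =
      pure_tensor_family I (\<lambda>i. rep_act (V i) (h i) (v i))"
proof -
  let ?X = "{pure_tensor_family I v | v. \<forall>i\<in>I. v i \<in> rep_space (V i)}"
  let ?P = "\<lambda>T. linear_on (fun_space.span ?X) T \<and> (\<forall>v. (\<forall>i\<in>I. v i \<in> rep_space (V i)) \<longrightarrow>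
    T (pure_tensor_family I v) = pure_tensor_family I (\<lambda>i. rep_act (V i) (h i) (v i)))"
  obtain T where T: "linear_on (fun_space.span ?X) T"
    "\<And>v. (\<forall>i\<in>I. v i \<in> rep_space (V i)) \<Longrightarrow>
      T (pure_tensor_family I v) = pure_tensor_family I (\<lambda>i. rep_act (V i) (h i) (v i))"
    using tensor_family_map_exists[of I "\<lambda>i. rep_space (V i)" "\<lambda>i. rep_act (V i) (h i)", OF assms(1,3,2)]
    by blast
  then have "?P T" by blast
  then have "?P (SOME T. ?P T)" by (rule someI[of ?P])
  moreover have "rep_act (ext_tensor_rep I V) h = (SOME T. ?P T)"
    by (simp add: ext_tensor_rep_def Let_def)
  ultimately have *: "?P (rep_act (ext_tensor_rep I V) h)" by simp
  then show "linear_on (rep_space (ext_tensor_rep I V)) (rep_act (ext_tensor_rep I V) h)"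
    unfolding ext_tensor_rep_space by blast
  show "(\<And>i. i \<in> I \<Longrightarrow> v i \<in> rep_space (V i)) \<Longrightarrow>
      rep_act (ext_tensor_rep I V) h (pure_tensor_family I v) =
      pure_tensor_family I (\<lambda>i. rep_act (V i) (h i) (v i))"
    using * by blast
qed

lemma representation_iso_transport:
  assumes V: "representation K V" and T: "intertwiner K V W T" "bij_betw T (rep_space V) (rep_space W)"
    and K: "group K"
  shows "representation K W"
proof -
  interpret group K by fact
  note DV = representationD[OF V] and DT = intertwinerD[OF T(1)]
  have W: "rep_space W = T ` rep_space V" using T(2) by (simp add: bij_betw_def)
  have add: "T u + T v = T (u + v)" "u + v \<in> rep_space V" if "u \<in> rep_space V" "v \<in> rep_space V" for u v
    using linear_on_add[OF DT(1) that] fun_space.subspace_add[OF DV(1) that] by simp_all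
  have scale: "cscale c (T u) = T (cscale c u)" "cscale c u \<in> rep_space V" if "u \<in> rep_space V" for u c
    using linear_on_scale[OF DT(1) that] fun_space.subspace_scale[OF DV(1) that] by simp_all
  show ?thesis
    unfolding representation_def W
  proof (intro conjI ballI)
    show "subspace_fun (T ` rep_space V)" by (rule subspace_image_linear_on[OF DT(1) DV(1)])
    fix g assume g: "g \<in> carrier K"
    show "rep_act W g ` T ` rep_space V \<subseteq> T ` rep_space V"
    proof clarify
      fix u assume u: "u \<in> rep_space V"
      show "rep_act W g (T u) \<in> T ` rep_space V"
        unfolding DT(3)[OF g u, symmetric] using DV(2)[OF g u] by (rule imageI)
    qed
    show "linear_on (T ` rep_space V) (rep_act W g)"
    proof (rule linear_onI)
      fix a b assume "a \<in> T ` rep_space V" "b \<in> T ` rep_space V"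
      then obtain u v where uv: "u \<in> rep_space V" "v \<in> rep_space V" "a = T u" "b = T v" by blast
      have "rep_act W g (a + b) = T (rep_act V g (u + v))"
        unfolding uv(3,4) add(1)[OF uv(1,2)] DT(3)[OF g add(2)[OF uv(1,2)]] ..
      also have "\<dots> = rep_act W g a + rep_act W g b"
        unfolding linear_on_add[OF DV(3)[OF g] uv(1,2)]
          add(1)[OF DV(2)[OF g uv(1)] DV(2)[OF g uv(2)], symmetric] DT(3)[OF g uv(1)] DT(3)[OF g uv(2)] uv(3,4) ..
      finally show "rep_act W g (a + b) = rep_act W g a + rep_act W g b" .
    next
      fix c a assume "a \<in> T ` rep_space V"
      then obtain u where u: "u \<in> rep_space V" "a = T u" by blast
      have "rep_act W g (cscale c a) = T (rep_act V g (cscale c u))"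
        unfolding u(2) scale(1)[OF u(1)] DT(3)[OF g scale(2)[OF u(1)]] ..
      also have "\<dots> = cscale c (rep_act W g a)"
        unfolding linear_on_scale[OF DV(3)[OF g] u(1)] scale(1)[OF DV(2)[OF g u(1)], symmetric]
          DT(3)[OF g u(1)] u(2) ..
      finally show "rep_act W g (cscale c a) = cscale c (rep_act W g a)" .
    qed
    fix h a assume h: "h \<in> carrier K" and "a \<in> T ` rep_space V"
    then obtain u where u: "u \<in> rep_space V" "a = T u" by blast
    show "rep_act W (g \<otimes>\<^bsub>K\<^esub> h) a = rep_act W g (rep_act W h a)"
      unfolding u(2) DT(3)[OF m_closed[OF g h] u(1), symmetric] DV(5)[OF g h u(1)]
        DT(3)[OF g DV(2)[OF h u(1)]] DT(3)[OF h u(1)] ..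
  next
    fix a assume "a \<in> T ` rep_space V"
    then obtain u where u: "u \<in> rep_space V" "a = T u" by blast
    show "rep_act W \<one>\<^bsub>K\<^esub> a = a" unfolding u(2) DT(3)[OF one_closed u(1), symmetric] DV(4)[OF u(1)] ..
  qed
qed

text \<open>The ingredients of the induced representation, for the diagrams \<open>lam\<close>. The bijection \<open>e\<close> from
  the disjoint union of the blocks \<open>{1..size_at x}\<close> to \<open>{1..N}\<close> is arbitrary, and \<open>pos\<close> is its inverse.\<close>

locale induction_model = wreath_model +
  fixes lam :: "'c \<Rightarrow> nat list"
begin

definition size_at :: "'c \<Rightarrow> nat" where "size_at x = sum_list (lam x)"
definition N :: nat where "N = (\<Sum>x\<in>R. size_at x)"
definition blocks :: "('c \<times> nat) set" where "blocks = (SIGMA x:R. {1..size_at x})"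
definition e :: "'c \<times> nat \<Rightarrow> nat" where "e = block_bij R size_at"
definition pos :: "nat \<Rightarrow> 'c \<times> nat" where "pos = inv_into blocks e"
definition H :: "('c \<Rightarrow> (nat \<Rightarrow> nat) \<times> (nat \<Rightarrow> 'a)) monoid" where
  "H = product_group R (\<lambda>x. wreath_group (size_at x) G)"
abbreviation K :: "((nat \<Rightarrow> nat) \<times> (nat \<Rightarrow> 'a)) monoid" where "K \<equiv> wreath_group N G"
definition \<phi> :: "('c \<Rightarrow> (nat \<Rightarrow> nat) \<times> (nat \<Rightarrow> 'a)) \<Rightarrow> (nat \<Rightarrow> nat) \<times> (nat \<Rightarrow> 'a)" where
  "\<phi> = block_embedding R size_at"
definition U :: "('c \<Rightarrow> (nat \<Rightarrow> nat) \<times> (nat \<Rightarrow> 'a), 'c \<Rightarrow> (nat \<Rightarrow> nat) \<times> (nat \<Rightarrow> nat set)) rep" where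
  "U = ext_tensor_rep R (\<lambda>x. wreath_rep (size_at x) (V x) (specht (lam x)))"
definition Ind :: "((nat \<Rightarrow> nat) \<times> (nat \<Rightarrow> 'a),
    ((nat \<Rightarrow> nat) \<times> (nat \<Rightarrow> 'a)) \<times> ('c \<Rightarrow> (nat \<Rightarrow> nat) \<times> (nat \<Rightarrow> nat set))) rep" where
  "Ind = induced_rep H K \<phi> U"

lemma e_bij: "bij_betw e blocks {1..N}"
proof -
  have "finite blocks" "card blocks = N" using finite_R by (simp_all add: blocks_def N_def)
  then have "\<exists>f. bij_betw f blocks {1..N}" by (intro finite_same_card_bij) auto
  then show ?thesis unfolding e_def block_bij_def blocks_def N_def by (rule someI_ex)
qed

lemma pos_e [simp]: "q \<in> blocks \<Longrightarrow> pos (e q) = q"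
  unfolding pos_def by (rule bij_betw_inv_into_left[OF e_bij])

lemma e_pos: "j \<in> {1..N} \<Longrightarrow> e (pos j) = j" "j \<in> {1..N} \<Longrightarrow> pos j \<in> blocks"
  unfolding pos_def using bij_betw_inv_into_right[OF e_bij] bij_betwE[OF bij_betw_inv_into[OF e_bij]] by blast+

lemma e_in: "q \<in> blocks \<Longrightarrow> e q \<in> {1..N}"
  using bij_betwE[OF e_bij] by blast

lemma blocks_iff: "(x, k) \<in> blocks \<longleftrightarrow> x \<in> R \<and> k \<in> {1..size_at x}"
  by (simp add: blocks_def)

lemma block_obtain:
  assumes "j \<in> {1..N}"
  obtains x k where "x \<in> R" "k \<in> {1..size_at x}" "j = e (x, k)" "pos j = (x, k)"
  using e_pos[OF assms] blocks_iff by (metis surj_pair)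

lemma H_elt:
  assumes "h \<in> carrier H" "x \<in> R"
  shows "fst (h x) permutes {1..size_at x}" "k \<in> {1..size_at x} \<Longrightarrow> snd (h x) k \<in> carrier G"
proof -
  have "h x \<in> carrier (wreath_group (size_at x) G)" using assms by (auto simp: H_def PiE_iff)
  then show "fst (h x) permutes {1..size_at x}" "k \<in> {1..size_at x} \<Longrightarrow> snd (h x) k \<in> carrier G"
    using wreath_elt by blast+
qed

lemma \<phi>_apply:
  assumes "(x, k) \<in> blocks"
  shows "fst (\<phi> h) (e (x, k)) = e (x, fst (h x) k)" "snd (\<phi> h) (e (x, k)) = snd (h x) k"
proof -
  have "inv_into (SIGMA x:R. {1..size_at x}) (block_bij R size_at) (block_bij R size_at (x, k)) = (x, k)"
    using pos_e[OF assms] unfolding pos_def e_def blocks_def .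
  moreover have "block_bij R size_at (x, k) \<in> {1..\<Sum>x\<in>R. size_at x}"
    using e_in[OF assms] unfolding e_def N_def .
  ultimately show "fst (\<phi> h) (e (x, k)) = e (x, fst (h x) k)" "snd (\<phi> h) (e (x, k)) = snd (h x) k"
    unfolding \<phi>_def block_embedding_def Let_def e_def by simp_all
qed

lemma \<phi>_outside:
  assumes "j \<notin> {1..N}"
  shows "fst (\<phi> h) j = j" "snd (\<phi> h) j = undefined"
  using assms unfolding \<phi>_def block_embedding_def Let_def N_def by auto

lemma \<phi>_closed:
  assumes h: "h \<in> carrier H"
  shows "\<phi> h \<in> carrier K"
proof -
  have blk: "(x, fst (h x) k) \<in> blocks" if "(x, k) \<in> blocks" for x k
    using that permutes_in_image[OF H_elt(1)[OF h]] unfolding blocks_iff by blast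
  have into: "fst (\<phi> h) j \<in> {1..N}" if j: "j \<in> {1..N}" for j
  proof -
    obtain x k where "x \<in> R" "k \<in> {1..size_at x}" "j = e (x, k)" using block_obtain[OF j] by metis
    then show ?thesis using \<phi>_apply(1)[of x k h] blk[of x k] e_in blocks_iff by metis
  qed
  have "inj_on (fst (\<phi> h)) {1..N}"
  proof (rule inj_onI)
    fix i j assume ij: "i \<in> {1..N}" "j \<in> {1..N}" "fst (\<phi> h) i = fst (\<phi> h) j"
    obtain x k where i: "x \<in> R" "k \<in> {1..size_at x}" "i = e (x, k)" using block_obtain[OF ij(1)] by metis
    obtain y l where j: "y \<in> R" "l \<in> {1..size_at y}" "j = e (y, l)" using block_obtain[OF ij(2)] by metis
    have b: "(x, k) \<in> blocks" "(y, l) \<in> blocks" using i j by (simp_all add: blocks_iff)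
    have "(x, fst (h x) k) = (y, fst (h y) l)"
      using ij(3) unfolding i(3) j(3) \<phi>_apply(1)[OF b(1)] \<phi>_apply(1)[OF b(2)]
      using pos_e[OF blk[OF b(1)]] pos_e[OF blk[OF b(2)]] by metis
    then have conj: "x = y \<and> fst (h x) k = fst (h y) l" by (rule iffD1[OF prod.inject])
    then have "x = y" "fst (h x) k = fst (h x) l" by metis+
    then show "i = j" using permutes_inj[OF H_elt(1)[OF h i(1)]] i(3) j(3) by (simp add: inj_eq)
  qed
  then have "bij_betw (fst (\<phi> h)) {1..N} {1..N}"
    using into by (simp add: bij_betw_def endo_inj_surj image_subset_iff del: atLeastAtMost_iff)
  then have 1: "fst (\<phi> h) permutes {1..N}" by (rule bij_imp_permutes) (rule \<phi>_outside(1))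
  have "snd (\<phi> h) j \<in> carrier G" if j: "j \<in> {1..N}" for j
  proof -
    obtain x k where "x \<in> R" "k \<in> {1..size_at x}" "j = e (x, k)" using block_obtain[OF j] by metis
    then show ?thesis using \<phi>_apply(2)[of x k h] H_elt(2)[OF h] blocks_iff by metis
  qed
  then have "snd (\<phi> h) \<in> {1..N} \<rightarrow>\<^sub>E carrier G" using \<phi>_outside(2) by (auto simp: PiE_iff extensional_def)
  then show ?thesis
    using 1 carrier_wreath_group[of "fst (\<phi> h)" "snd (\<phi> h)" N G] unfolding prod.collapse by blast
qed

text \<open>The block subgroup consists of all elements whose permutation preserves the blocks.\<close>

lemma \<phi>_surj:
  assumes k: "k \<in> carrier K" and blk: "\<And>x l. (x, l) \<in> blocks \<Longrightarrow> fst (pos (fst k (e (x, l)))) = x"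
  shows "k \<in> \<phi> ` carrier H"
proof -
  define s where "s x l = (if l \<in> {1..size_at x} then snd (pos (fst k (e (x, l)))) else l)" for x l
  define h where "h = (\<lambda>x\<in>R. (s x, \<lambda>l\<in>{1..size_at x}. snd k (e (x, l))))"
  note \<sigma> = wreath_elt(1)[OF k]
  have pos: "pos (fst k (e (x, l))) = (x, s x l)" "fst k (e (x, l)) = e (x, s x l)" "(x, s x l) \<in> blocks"
    if b: "(x, l) \<in> blocks" for x l
  proof -
    have j: "fst k (e (x, l)) \<in> {1..N}" using e_in[OF b] permutes_in_image[OF \<sigma>] by blast
    have "l \<in> {1..size_at x}" using b blocks_iff by blast
    then show p: "pos (fst k (e (x, l))) = (x, s x l)"
      using blk[OF b] by (simp add: s_def prod_eq_iff del: atLeastAtMost_iff)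
    show "fst k (e (x, l)) = e (x, s x l)" "(x, s x l) \<in> blocks" using e_pos[OF j] unfolding p by simp_all
  qed
  have sp: "s x permutes {1..size_at x}" if x: "x \<in> R" for x
  proof (rule bij_imp_permutes)
    have inj: "inj_on (s x) {1..size_at x}"
    proof (rule inj_onI)
      fix l l' assume l: "l \<in> {1..size_at x}" "l' \<in> {1..size_at x}" "s x l = s x l'"
      then have b: "(x, l) \<in> blocks" "(x, l') \<in> blocks" using x blocks_iff by blast+
      have "fst k (e (x, l)) = fst k (e (x, l'))" unfolding pos(2)[OF b(1)] pos(2)[OF b(2)] l(3) ..
      then have "e (x, l) = e (x, l')" by (rule injD[OF permutes_inj[OF \<sigma>]])
      then have "(x, l) = (x, l')" by (rule inj_onD[OF bij_betw_imp_inj_on[OF e_bij] _ b])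
      then show "l = l'" by blast
    qed
    have "s x ` {1..size_at x} \<subseteq> {1..size_at x}"
    proof (rule image_subsetI)
      fix l assume "l \<in> {1..size_at x}"
      then have "(x, l) \<in> blocks" using x blocks_iff by blast
      from pos(3)[OF this] show "s x l \<in> {1..size_at x}" using blocks_iff by blast
    qed
    then have "s x ` {1..size_at x} = {1..size_at x}"
      by (rule endo_inj_surj[OF finite_atLeastAtMost _ inj])
    then show "bij_betw (s x) {1..size_at x} {1..size_at x}" using inj unfolding bij_betw_def by blast
    show "s x l = l" if "l \<notin> {1..size_at x}" for l unfolding s_def using that by (rule if_not_P)
  qed
  have lab: "snd k (e (x, l)) \<in> carrier G" if "(x, l) \<in> blocks" for x l
    using wreath_elt(2)[OF k e_in[OF that]] .
  have "h \<in> carrier H"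
    unfolding H_def carrier_product_group
  proof (rule PiE_I)
    fix x assume x: "x \<in> R"
    have "(\<lambda>l\<in>{1..size_at x}. snd k (e (x, l))) \<in> {1..size_at x} \<rightarrow>\<^sub>E carrier G"
      using lab x blocks_iff by (intro restrict_PiE_iff[THEN iffD2] ballI) blast
    then have "(s x, \<lambda>l\<in>{1..size_at x}. snd k (e (x, l))) \<in> carrier (wreath_group (size_at x) G)"
      using sp[OF x] by (simp only: carrier_wreath_group simp_thms)
    then show "h x \<in> carrier (wreath_group (size_at x) G)"
      unfolding h_def using x by (simp only: restrict_apply if_True)
  qed (simp add: h_def)
  moreover have "\<phi> h = k"
  proof (rule prod_eqI; rule ext)
    fix j
    show "fst (\<phi> h) j = fst k j"
    proof (cases "j \<in> {1..N}")
      case True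
      obtain x l where b: "x \<in> R" "l \<in> {1..size_at x}" "j = e (x, l)" using block_obtain[OF True] by metis
      then have "(x, l) \<in> blocks" by (simp add: blocks_iff)
      then show ?thesis using \<phi>_apply(1)[of x l h] pos(2)[of x l] b by (simp add: h_def)
    qed (use \<phi>_outside(1) permutes_not_in[OF \<sigma>] in simp)
    show "snd (\<phi> h) j = snd k j"
    proof (cases "j \<in> {1..N}")
      case True
      obtain x l where b: "x \<in> R" "l \<in> {1..size_at x}" "j = e (x, l)" using block_obtain[OF True] by metis
      then have "(x, l) \<in> blocks" by (simp add: blocks_iff)
      then show ?thesis using \<phi>_apply(2)[of x l h] b by (simp add: h_def)
    next
      case False
      then have "snd k j = undefined"
        using k carrier_wreath_group[of "fst k" "snd k" N G] by (auto simp: PiE_iff extensional_def)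
      then show ?thesis using False \<phi>_outside(2) by simp
    qed
  qed
  ultimately show ?thesis by blast
qed

definition pure :: "('c \<Rightarrow> nat \<times> nat \<Rightarrow> nat) \<Rightarrow> ('c \<Rightarrow> nat \<Rightarrow> nat \<Rightarrow> complex)
    \<Rightarrow> ('c \<Rightarrow> (nat \<Rightarrow> nat) \<times> (nat \<Rightarrow> nat set)) \<Rightarrow> complex" where
  "pure t w = pure_tensor_family R (\<lambda>x.
     pure_tensor (pure_tensor_family {1..size_at x} (w x)) (polytabloid (lam x) (t x)))"

definition admissible :: "('c \<Rightarrow> nat \<times> nat \<Rightarrow> nat) \<Rightarrow> ('c \<Rightarrow> nat \<Rightarrow> nat \<Rightarrow> complex) \<Rightarrow> bool" where
  "admissible t w \<longleftrightarrow> (\<forall>x\<in>R. t x \<in> tableaux (lam x) \<and> (\<forall>k\<in>{1..size_at x}. w x k \<in> rep_space (V x)))"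

lemma polytabloid_in_specht: "t \<in> tableaux xs \<Longrightarrow> polytabloid xs t \<in> rep_space (specht xs)"
  by (simp add: specht_def fun_space.span_base)

lemma linear_specht_act: "linear_on S (rep_act (specht xs) p)"
  by (rule linear_onI) (auto simp: specht_def fun_eq_iff fun_apply)

lemma pure_factor_in:
  assumes "admissible t w" "x \<in> R"
  shows "pure_tensor (pure_tensor_family {1..size_at x} (w x)) (polytabloid (lam x) (t x))
    \<in> rep_space (wreath_rep (size_at x) (V x) (specht (lam x)))"
  unfolding wreath_rep_space
  by (rule fun_space.span_base) (use assms polytabloid_in_specht in \<open>unfold admissible_def, blast\<close>)

text \<open>By multilinearity, polytabloids suffice as the factors in the Specht modules.\<close>

lemma U_space: "rep_space U = fun_space.span {pure t w | t w. admissible t w}"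
proof (intro equalityI)
  show "fun_space.span {pure t w | t w. admissible t w} \<subseteq> rep_space U"
    unfolding U_def ext_tensor_rep_space pure_def using pure_factor_in
    by (intro fun_space.span_mono) blast
  define A where "A x = {pure_tensor (pure_tensor_family {1..size_at x} w) (polytabloid (lam x) t) | w t.
    (\<forall>k\<in>{1..size_at x}. w k \<in> rep_space (V x)) \<and> t \<in> tableaux (lam x)}" for x
  have A: "rep_space (wreath_rep (size_at x) (V x) (specht (lam x))) \<subseteq> fun_space.span (A x)" for x
    unfolding wreath_rep_space
  proof (rule fun_space.span_minimal[OF _ fun_space.subspace_span], clarify)
    fix v w assume v: "\<forall>k\<in>{1..size_at x}. v k \<in> rep_space (V x)" and w: "w \<in> rep_space (specht (lam x))"
    let ?B = "{pure_tensor a b | a b. a \<in> {pure_tensor_family {1..size_at x} v} \<and> b \<in> polytabloid (lam x) ` tableaux (lam x)}"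
    have "pure_tensor (pure_tensor_family {1..size_at x} v) w \<in> fun_space.span ?B"
      by (rule span_pure_tensor) (use w in \<open>simp_all add: fun_space.span_base specht_def\<close>)
    also have "fun_space.span ?B \<subseteq> fun_space.span (A x)"
      by (rule fun_space.span_mono) (use v in \<open>unfold A_def, blast\<close>)
    finally show "pure_tensor (pure_tensor_family {1..size_at x} v) w \<in> fun_space.span (A x)" .
  qed
  show "rep_space U \<subseteq> fun_space.span {pure t w | t w. admissible t w}"
    unfolding U_def ext_tensor_rep_space
  proof (rule fun_space.span_minimal[OF _ fun_space.subspace_span], clarify)
    fix v assume v: "\<forall>x\<in>R. v x \<in> rep_space (wreath_rep (size_at x) (V x) (specht (lam x)))"
    have "pure_tensor_family R v \<in> fun_space.span {pure_tensor_family R a | a. \<forall>x\<in>R. a x \<in> A x}"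
      by (rule span_pure_tensor_family[OF finite_R]) (use v A in blast)
    also have "\<dots> \<subseteq> fun_space.span {pure t w | t w. admissible t w}"
    proof (rule fun_space.span_mono, clarify)
      fix a assume "\<forall>x\<in>R. a x \<in> A x"
      then have "\<forall>x\<in>R. \<exists>p. a x = pure_tensor (pure_tensor_family {1..size_at x} (fst p)) (polytabloid (lam x) (snd p)) \<and>
          (\<forall>k\<in>{1..size_at x}. fst p k \<in> rep_space (V x)) \<and> snd p \<in> tableaux (lam x)"
        unfolding A_def by fastforce
      from bchoice[OF this] obtain p where p: "\<forall>x\<in>R. a x = pure_tensor (pure_tensor_family {1..size_at x} (fst (p x))) (polytabloid (lam x) (snd (p x))) \<and>
          (\<forall>k\<in>{1..size_at x}. fst (p x) k \<in> rep_space (V x)) \<and> snd (p x) \<in> tableaux (lam x)" by blast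
      have "pure_tensor_family R a = pure (\<lambda>x. snd (p x)) (\<lambda>x. fst (p x))"
        unfolding pure_def pure_tensor_family_def[of R] using p by (intro ext prod.cong refl) simp
      moreover have "admissible (\<lambda>x. snd (p x)) (\<lambda>x. fst (p x))" unfolding admissible_def using p by blast
      ultimately show "\<exists>t w. pure_tensor_family R a = pure t w \<and> admissible t w" by blast
    qed
    finally show "pure_tensor_family R v \<in> fun_space.span {pure t w | t w. admissible t w}" .
  qed
qed

lemma pure_in_U: "admissible t w \<Longrightarrow> pure t w \<in> rep_space U"
  unfolding U_space by (rule fun_space.span_base) blast

lemma subspace_U: "subspace_fun (rep_space U)"
  by (simp add: U_space)

lemma U_act:
  assumes h: "h \<in> carrier H"
  shows "linear_on (rep_space U) (rep_act U h)"
    and "admissible t w \<Longrightarrow> rep_act U h (pure t w) =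
      pure (\<lambda>x. fst (h x) \<circ> t x) (\<lambda>x k. rep_act (V x) (snd (h x) k) (w x (inv' (fst (h x)) k)))"
proof -
  let ?W = "\<lambda>x. wreath_rep (size_at x) (V x) (specht (lam x))"
  have sp: "subspace_fun (rep_space (specht xs))" for xs by (simp add: specht_def)
  have W: "linear_on (rep_space (?W x)) (rep_act (?W x) (h x))"
    "\<And>v w. (\<And>k. k \<in> {1..size_at x} \<Longrightarrow> v k \<in> rep_space (V x)) \<Longrightarrow> w \<in> rep_space (specht (lam x)) \<Longrightarrow>
      rep_act (?W x) (h x) (pure_tensor (pure_tensor_family {1..size_at x} v) w) =
      pure_tensor (pure_tensor_family {1..size_at x} (\<lambda>k. rep_act (V x) (snd (h x) k) (v (inv' (fst (h x)) k))))
        (rep_act (specht (lam x)) (fst (h x)) w)" if x: "x \<in> R" for x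
    using wreath_rep_act[where g = "snd (h x)",
        OF V(1)[OF x] sp[of "lam x"] H_elt(1)[OF h x] linear_specht_act H_elt(2)[OF h x]]
    unfolding prod.collapse by blast+
  have sub: "subspace_fun (rep_space (?W x))" for x by (simp add: wreath_rep_space)
  show "linear_on (rep_space U) (rep_act U h)"
    unfolding U_def by (rule ext_tensor_rep_act(1)[OF finite_R sub W(1)])
  assume a: "admissible t w"
  have "rep_act U h (pure t w) = pure_tensor_family R (\<lambda>x. rep_act (?W x) (h x)
      (pure_tensor (pure_tensor_family {1..size_at x} (w x)) (polytabloid (lam x) (t x))))"
    unfolding U_def pure_def by (rule ext_tensor_rep_act(2)[OF finite_R sub W(1) pure_factor_in[OF a]])
  also have "\<dots> = pure (\<lambda>x. fst (h x) \<circ> t x) (\<lambda>x k. rep_act (V x) (snd (h x) k) (w x (inv' (fst (h x)) k)))"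
    unfolding pure_def pure_tensor_family_def[of R]
  proof (rule ext, rule prod.cong[OF refl])
    fix \<xi> :: "'c \<Rightarrow> (nat \<Rightarrow> nat) \<times> (nat \<Rightarrow> nat set)" and x assume x: "x \<in> R"
    have tx: "t x \<in> tableaux (lam x)" "\<And>k. k \<in> {1..size_at x} \<Longrightarrow> w x k \<in> rep_space (V x)"
      using a x unfolding admissible_def by blast+
    have "rep_act (?W x) (h x) (pure_tensor (pure_tensor_family {1..size_at x} (w x)) (polytabloid (lam x) (t x))) =
        pure_tensor (pure_tensor_family {1..size_at x} (\<lambda>k. rep_act (V x) (snd (h x) k) (w x (inv' (fst (h x)) k))))
          (rep_act (specht (lam x)) (fst (h x)) (polytabloid (lam x) (t x)))"
      by (rule W(2)[OF x tx(2) polytabloid_in_specht[OF tx(1)]])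
    also have "rep_act (specht (lam x)) (fst (h x)) (polytabloid (lam x) (t x)) = polytabloid (lam x) (fst (h x) \<circ> t x)"
      by (rule specht_act_polytabloid[OF tx(1) H_elt(1)[OF h x, unfolded size_at_def]])
    finally show "rep_act (?W x) (h x) (pure_tensor (pure_tensor_family {1..size_at x} (w x)) (polytabloid (lam x) (t x))) (\<xi> x) =
        pure_tensor (pure_tensor_family {1..size_at x} (\<lambda>k. rep_act (V x) (snd (h x) k) (w x (inv' (fst (h x)) k))))
          (polytabloid (lam x) (fst (h x) \<circ> t x)) (\<xi> x)"
      by (rule fun_cong)
  qed
  finally show "rep_act U h (pure t w) =
      pure (\<lambda>x. fst (h x) \<circ> t x) (\<lambda>x k. rep_act (V x) (snd (h x) k) (w x (inv' (fst (h x)) k)))" .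
qed

end

context induction_model
begin

text \<open>The point at which every letter has the index of its block, the label \<open>1\<close>, the coordinate prescribed by \<open>\<xi>\<close>
  and the row prescribed by the tabloid in \<open>\<xi>\<close>. Restriction to these points is an \<open>H\<close>-equivariant map from the
  model to \<open>U\<close>.\<close>

definition point :: "('c \<Rightarrow> (nat \<Rightarrow> nat) \<times> (nat \<Rightarrow> nat set)) \<Rightarrow> nat \<Rightarrow> 'c \<times> 'a \<times> nat \<times> nat" where
  "point \<xi> j = (fst (pos j), \<one>\<^bsub>G\<^esub>, fst (\<xi> (fst (pos j))) (snd (pos j)),
     row_of (snd (\<xi> (fst (pos j)))) (snd (pos j)))"

definition restr :: "((nat \<Rightarrow> 'c \<times> 'a \<times> nat \<times> nat) \<Rightarrow> complex)
    \<Rightarrow> ('c \<Rightarrow> (nat \<Rightarrow> nat) \<times> (nat \<Rightarrow> nat set)) \<Rightarrow> complex" where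
  "restr f \<xi> = (if \<forall>x\<in>R. row_partition (size_at x) (snd (\<xi> x)) then f (point \<xi>) else 0)"

abbreviation M :: "((nat \<Rightarrow> nat) \<times> (nat \<Rightarrow> 'a), nat \<Rightarrow> 'c \<times> 'a \<times> nat \<times> nat) rep" where
  "M \<equiv> model lam N"

lemma linear_restr: "linear_on S restr"
  by (rule linear_onI) (auto simp: restr_def fun_eq_iff fun_apply)

text \<open>If every letter lies in the block of the index of its cell, then the placement consists of one tableau for
  each block, and the product over all cells is a product over the blocks.\<close>

lemma restr_generator:
  assumes a: "admissible t w" and \<Theta>: "\<And>x c. (x, c) \<in> all_cells lam \<Longrightarrow> \<Theta> (x, c) = e (x, t x c)"
    and v: "\<And>x c. (x, c) \<in> all_cells lam \<Longrightarrow> v (x, c) = w x (t x c)"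
  shows "restr (generator lam \<Theta> v) = pure t w"
proof
  fix \<xi>
  have t: "bij_betw (t x) (cells (lam x)) {1..size_at x}" "t x \<in> tableaux (lam x)"
    "\<And>k. k \<in> {1..size_at x} \<Longrightarrow> w x k \<in> rep_space (V x)" if "x \<in> R" for x
    using a that unfolding admissible_def tableaux_def size_at_def by blast+
  have pure: "pure t w \<xi> = (\<Prod>x\<in>R. (\<Prod>k\<in>{1..size_at x}. w x k (fst (\<xi> x) k)) * polytabloid (lam x) (t x) (snd (\<xi> x)))"
    by (simp add: pure_def pure_tensor_family_def pure_tensor_def case_prod_beta)
  show "restr (generator lam \<Theta> v) \<xi> = pure t w \<xi>"
  proof (cases "\<forall>x\<in>R. row_partition (size_at x) (snd (\<xi> x))")
    case False
    then obtain x where x: "x \<in> R" "\<not> row_partition (size_at x) (snd (\<xi> x))" by blast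
    then have "polytabloid (lam x) (t x) (snd (\<xi> x)) = 0"
      using polytabloid_eq_column_sign[OF t(2)[OF x(1)]] by (simp add: size_at_def)
    then have "pure t w \<xi> = 0"
      unfolding pure by (intro prod_zero finite_R bexI[OF _ x(1)]) simp
    then show ?thesis using False by (simp only: restr_def if_False)
  next
    case True
    have pt: "point \<xi> (\<Theta> (x, c)) = (x, \<one>\<^bsub>G\<^esub>, fst (\<xi> x) (t x c), row_of (snd (\<xi> x)) (t x c))"
      and tc: "t x c \<in> {1..size_at x}" if xc: "(x, c) \<in> all_cells lam" for x c
    proof -
      have x: "x \<in> R" "c \<in> cells (lam x)" using xc all_cells_iff by blast+
      show "t x c \<in> {1..size_at x}" using bij_betwE[OF t(1)[OF x(1)]] x(2) by blast
      then have "pos (\<Theta> (x, c)) = (x, t x c)"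
        unfolding \<Theta>[OF xc] using x(1) by (intro pos_e) (simp add: blocks_iff)
      then show "point \<xi> (\<Theta> (x, c)) = (x, \<one>\<^bsub>G\<^esub>, fst (\<xi> x) (t x c), row_of (snd (\<xi> x)) (t x c))"
        by (simp add: point_def)
    qed
    have one: "\<one>\<^bsub>G\<^esub> \<in> carrier G" using group.is_monoid[OF G] monoid.one_closed by blast
    have "site x (v (x, c)) (point \<xi> (\<Theta> (x, c))) = w x (t x c) (fst (\<xi> x) (t x c))"
      if xc: "(x, c) \<in> all_cells lam" for x c
    proof -
      have x: "x \<in> R" using xc all_cells_iff by blast
      show ?thesis
        unfolding pt[OF xc] v[OF xc] site_def label_def
        using one representationD(4)[OF V(1)[OF x] t(3)[OF x tc[OF xc]]] by simp
    qed
    then have "(\<Prod>q\<in>all_cells lam. site (fst q) (v q) (point \<xi> (\<Theta> q))) =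
        (\<Prod>(x, c)\<in>all_cells lam. w x (t x c) (fst (\<xi> x) (t x c)))"
      by (intro prod.cong refl) (auto simp: case_prod_beta)
    also have "\<dots> = (\<Prod>x\<in>R. \<Prod>c\<in>cells (lam x). w x (t x c) (fst (\<xi> x) (t x c)))"
      unfolding all_cells_def by (rule prod.Sigma[symmetric]) (simp_all add: finite_R)
    also have "\<dots> = (\<Prod>x\<in>R. \<Prod>k\<in>{1..size_at x}. w x k (fst (\<xi> x) k))"
    proof (rule prod.cong[OF refl])
      fix x assume x: "x \<in> R"
      show "(\<Prod>c\<in>cells (lam x). w x (t x c) (fst (\<xi> x) (t x c))) = (\<Prod>k\<in>{1..size_at x}. w x k (fst (\<xi> x) k))"
        by (rule prod.reindex_bij_betw[OF t(1)[OF x], of "\<lambda>k. w x k (fst (\<xi> x) k)"])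
    qed
    finally have 1: "(\<Prod>q\<in>all_cells lam. site (fst q) (v q) (point \<xi> (\<Theta> q))) =
        (\<Prod>x\<in>R. \<Prod>k\<in>{1..size_at x}. w x k (fst (\<xi> x) k))" .
    have "column_sign (lam x) (\<lambda>c. row (point \<xi> (\<Theta> (x, c)))) = polytabloid (lam x) (t x) (snd (\<xi> x))"
      if x: "x \<in> R" for x
    proof -
      have "column_sign (lam x) (\<lambda>c. row (point \<xi> (\<Theta> (x, c)))) = column_sign (lam x) (\<lambda>c. row_of (snd (\<xi> x)) (t x c))"
        by (rule column_sign_cong) (simp add: pt all_cells_iff x row_def)
      then show ?thesis
        using True x polytabloid_eq_column_sign[OF t(2)[OF x], of "snd (\<xi> x)"] by (simp add: size_at_def)
    qed
    then have "multi_sign lam \<Theta> (point \<xi>) = (\<Prod>x\<in>R. polytabloid (lam x) (t x) (snd (\<xi> x)))"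
      unfolding multi_sign_def by (intro prod.cong refl)
    then show ?thesis
      unfolding pure prod.distrib restr_def generator_def 1 using True by simp
  qed
qed

definition standard :: "('c \<times> nat \<times> nat \<Rightarrow> nat) \<Rightarrow> bool" where
  "standard \<Theta> \<longleftrightarrow> (\<forall>q\<in>all_cells lam. fst (pos (\<Theta> q)) = fst q)"

lemma restr_nonstandard:
  assumes "\<not> standard \<Theta>"
  shows "restr (generator lam \<Theta> v) = 0"
proof
  fix \<xi>
  obtain q where q: "q \<in> all_cells lam" "fst (pos (\<Theta> q)) \<noteq> fst q" using assms unfolding standard_def by blast
  have "(\<Prod>q\<in>all_cells lam. site (fst q) (v q) (point \<xi> (\<Theta> q))) = 0"
    by (rule prod_zero[OF finite_all_cells bexI[OF _ q(1)]]) (simp add: site_def point_def q(2))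
  then show "restr (generator lam \<Theta> v) \<xi> = 0 \<xi>" by (simp add: restr_def generator_def zero_fun_apply)
qed

lemma standard_data:
  assumes p: "placement lam N \<Theta> v" and s: "standard \<Theta>"
  obtains t w where "admissible t w" "\<And>x c. (x, c) \<in> all_cells lam \<Longrightarrow> \<Theta> (x, c) = e (x, t x c)"
    "\<And>x c. (x, c) \<in> all_cells lam \<Longrightarrow> v (x, c) = w x (t x c)"
proof -
  define t where "t x c = snd (pos (\<Theta> (x, c)))" for x c
  define w where "w x k = v (x, inv_into (cells (lam x)) (t x) k)" for x k
  have pos: "pos (\<Theta> (x, c)) = (x, t x c)" "(x, t x c) \<in> blocks" "\<Theta> (x, c) = e (x, t x c)"
    if xc: "(x, c) \<in> all_cells lam" for x c
  proof -
    have "fst (pos (\<Theta> (x, c))) = x" using s xc unfolding standard_def by fastforce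
    then show pos: "pos (\<Theta> (x, c)) = (x, t x c)" by (simp add: t_def prod_eq_iff)
    show "(x, t x c) \<in> blocks" "\<Theta> (x, c) = e (x, t x c)"
      using e_pos[OF placementD(3)[OF p xc]] pos by simp_all
  qed
  have t: "bij_betw (t x) (cells (lam x)) {1..size_at x}" if x: "x \<in> R" for x
  proof (rule bij_betw_imageI)
    show "inj_on (t x) (cells (lam x))"
    proof (rule inj_onI)
      fix c c' assume c: "c \<in> cells (lam x)" "c' \<in> cells (lam x)" "t x c = t x c'"
      then have xc: "(x, c) \<in> all_cells lam" "(x, c') \<in> all_cells lam" using x all_cells_iff by blast+
      have "\<Theta> (x, c) = \<Theta> (x, c')" unfolding pos(3)[OF xc(1)] pos(3)[OF xc(2)] c(3) ..
      then have "(x, c) = (x, c')" by (rule inj_onD[OF bij_betw_imp_inj_on[OF placementD(1)[OF p]] _ xc])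
      then show "c = c'" by blast
    qed
    show "t x ` cells (lam x) = {1..size_at x}"
    proof (intro equalityI subsetI)
      fix k assume "k \<in> t x ` cells (lam x)"
      then obtain c where c: "c \<in> cells (lam x)" "k = t x c" by blast
      then have "(x, c) \<in> all_cells lam" using x all_cells_iff by blast
      from pos(2)[OF this] show "k \<in> {1..size_at x}" unfolding c(2) using blocks_iff by blast
    next
      fix k assume "k \<in> {1..size_at x}"
      then have b: "(x, k) \<in> blocks" using x blocks_iff by blast
      then have "e (x, k) \<in> \<Theta> ` all_cells lam" unfolding placementD(4)[OF p] by (rule e_in)
      then obtain y c where yc: "(y, c) \<in> all_cells lam" "e (x, k) = \<Theta> (y, c)" by (metis imageE surj_pair)
      have "(x, k) = (y, t y c)" using pos(1)[OF yc(1)] pos_e[OF b] unfolding yc(2) by simp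
      then show "k \<in> t x ` cells (lam x)" using yc(1) all_cells_iff by blast
    qed
  qed
  have wv: "w x (t x c) = v (x, c)" if xc: "(x, c) \<in> all_cells lam" for x c
    unfolding w_def using bij_betw_inv_into_left[OF t] xc all_cells_iff by metis
  show thesis
  proof (rule that)
    show "admissible t w"
      unfolding admissible_def
    proof (intro ballI conjI)
      fix x assume x: "x \<in> R"
      show "t x \<in> tableaux (lam x)" using t[OF x] by (simp add: tableaux_def size_at_def)
      fix k assume k: "k \<in> {1..size_at x}"
      have "inv_into (cells (lam x)) (t x) k \<in> cells (lam x)"
        using bij_betwE[OF bij_betw_inv_into[OF t[OF x]]] k by blast
      then have "(x, inv_into (cells (lam x)) (t x) k) \<in> all_cells lam" using x all_cells_iff by blast
      from placementD(2)[OF p this] show "w x k \<in> rep_space (V x)" by (simp add: w_def)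
    qed
  qed (use pos(3) wv in simp_all)
qed

lemma restr_in_U:
  assumes f: "f \<in> rep_space M"
  shows "restr f \<in> rep_space U"
proof (rule linear_on_image_span[OF linear_restr _ subspace_U f[unfolded model_def rep.select_convs]])
  fix F assume "F \<in> {generator lam \<Theta> v | \<Theta> v. placement lam N \<Theta> v}"
  then obtain \<Theta> v where p: "placement lam N \<Theta> v" "F = generator lam \<Theta> v" by blast
  show "restr F \<in> rep_space U"
  proof (cases "standard \<Theta>")
    case True
    obtain t w where "admissible t w" "\<And>x c. (x, c) \<in> all_cells lam \<Longrightarrow> \<Theta> (x, c) = e (x, t x c)"
      "\<And>x c. (x, c) \<in> all_cells lam \<Longrightarrow> v (x, c) = w x (t x c)"
      using standard_data[OF p(1) True] by blast
    then show ?thesis unfolding p(2) using restr_generator pure_in_U by metis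
  next
    case False
    show ?thesis unfolding p(2) restr_nonstandard[OF False] by (rule fun_space.subspace_0[OF subspace_U])
  qed
qed

text \<open>Elements of the block subgroup move letters within their blocks, so that standard placements remain
  standard and the other ones remain non-standard.\<close>

lemma restr_equivariant:
  assumes h: "h \<in> carrier H" and f: "f \<in> rep_space M"
  shows "restr (model_act N (\<phi> h) f) = rep_act U h (restr f)"
proof -
  have "(restr \<circ> model_act N (\<phi> h)) f = (rep_act U h \<circ> restr) f"
  proof (rule model_eqI[OF _ _ _ f])
    show "linear_on (rep_space M) (restr \<circ> model_act N (\<phi> h))"
      by (rule linear_on_compose[OF linear_model_act linear_restr subset_refl])
    show "linear_on (rep_space M) (rep_act U h \<circ> restr)"
      by (rule linear_on_compose[OF linear_restr U_act(1)[OF h]]) (use restr_in_U in blast)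
    fix \<Theta> v assume p: "placement lam N \<Theta> v"
    note act = model_act_generator[OF \<phi>_closed[OF h] p]
    show "(restr \<circ> model_act N (\<phi> h)) (generator lam \<Theta> v) = (rep_act U h \<circ> restr) (generator lam \<Theta> v)"
    proof (cases "standard \<Theta>")
      case True
      obtain t w where a: "admissible t w" and \<Theta>: "\<And>x c. (x, c) \<in> all_cells lam \<Longrightarrow> \<Theta> (x, c) = e (x, t x c)"
        and v: "\<And>x c. (x, c) \<in> all_cells lam \<Longrightarrow> v (x, c) = w x (t x c)"
        using standard_data[OF p True] by blast
      let ?t = "\<lambda>x. fst (h x) \<circ> t x"
      let ?w = "\<lambda>x k. rep_act (V x) (snd (h x) k) (w x (inv' (fst (h x)) k))"
      have t: "t x \<in> tableaux (lam x)" "\<And>k. k \<in> {1..size_at x} \<Longrightarrow> w x k \<in> rep_space (V x)" if "x \<in> R" for x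
        using a that unfolding admissible_def by blast+
      have a': "admissible ?t ?w"
        unfolding admissible_def
      proof (intro ballI conjI)
        fix x assume x: "x \<in> R"
        show "?t x \<in> tableaux (lam x)"
          by (rule permutes_comp_tableau[OF H_elt(1)[OF h x, unfolded size_at_def] t(1)[OF x]])
        fix k assume k: "k \<in> {1..size_at x}"
        have "inv' (fst (h x)) k \<in> {1..size_at x}"
          using permutes_in_image[OF permutes_inv[OF H_elt(1)[OF h x]]] k by blast
        then show "?w x k \<in> rep_space (V x)"
          by (intro representationD(2)[OF V(1)[OF x]] H_elt(2)[OF h x k] t(2)[OF x])
      qed
      have blk: "(x, t x c) \<in> blocks" if "(x, c) \<in> all_cells lam" for x c
      proof -
        have x: "x \<in> R" "c \<in> cells (lam x)" using that all_cells_iff by blast+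
        have "bij_betw (t x) (cells (lam x)) {1..size_at x}"
          using t(1)[OF x(1)] unfolding tableaux_def size_at_def by blast
        from bij_betwE[OF this] show ?thesis using x unfolding blocks_iff by blast
      qed
      have \<Theta>h: "fst (\<phi> h) (\<Theta> (x, c)) = e (x, ?t x c)" if "(x, c) \<in> all_cells lam" for x c
        unfolding \<Theta>[OF that] using \<phi>_apply(1)[OF blk[OF that]] by simp
      have blk': "(x, ?t x c) \<in> blocks" if xc: "(x, c) \<in> all_cells lam" for x c
        using blk[OF xc] permutes_in_image[OF H_elt(1)[OF h]] unfolding blocks_iff comp_def by blast
      have "restr (generator lam (fst (\<phi> h) \<circ> \<Theta>) (moved (\<phi> h) \<Theta> v)) = pure ?t ?w"
      proof (rule restr_generator[OF a'])
        fix x c assume xc: "(x, c) \<in> all_cells lam"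
        then have x: "x \<in> R" using all_cells_iff by blast
        show "(fst (\<phi> h) \<circ> \<Theta>) (x, c) = e (x, ?t x c)" using \<Theta>h[OF xc] by simp
        show "moved (\<phi> h) \<Theta> v (x, c) = ?w x (?t x c)"
          unfolding moved_def fst_conv \<Theta>h[OF xc] \<phi>_apply(2)[OF blk'[OF xc]] v[OF xc]
          by (simp add: permutes_inverses(2)[OF H_elt(1)[OF h x]])
      qed
      then show ?thesis using act restr_generator[OF a \<Theta> v] U_act(2)[OF h a] by simp
    next
      case False
      have "\<not> standard (fst (\<phi> h) \<circ> \<Theta>)"
      proof
        assume s: "standard (fst (\<phi> h) \<circ> \<Theta>)"
        have "fst (pos (\<Theta> q)) = fst q" if q: "q \<in> all_cells lam" for q
        proof -
          obtain x k where j: "x \<in> R" "k \<in> {1..size_at x}" "\<Theta> q = e (x, k)" "pos (\<Theta> q) = (x, k)"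
            using block_obtain[OF placementD(3)[OF p q]] by metis
          then have b: "(x, k) \<in> blocks" "(x, fst (h x) k) \<in> blocks"
            using permutes_in_image[OF H_elt(1)[OF h j(1)]] unfolding blocks_iff by blast+
          have "fst (pos (fst (\<phi> h) (\<Theta> q))) = fst q" using s q unfolding standard_def by simp
          then show ?thesis unfolding j(3) \<phi>_apply(1)[OF b(1)] pos_e[OF b(2)] pos_e[OF b(1)] by simp
        qed
        then show False using False unfolding standard_def by blast
      qed
      then show ?thesis
        using act restr_nonstandard False linear_on_0[OF U_act(1)[OF h] subspace_U] by simp
    qed
  qed
  then show ?thesis by simp
qed

text \<open>The map that corresponds to the restriction under Frobenius reciprocity.\<close>

definition frob :: "((nat \<Rightarrow> 'c \<times> 'a \<times> nat \<times> nat) \<Rightarrow> complex)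
    \<Rightarrow> ((nat \<Rightarrow> nat) \<times> (nat \<Rightarrow> 'a)) \<times> ('c \<Rightarrow> (nat \<Rightarrow> nat) \<times> (nat \<Rightarrow> nat set)) \<Rightarrow> complex" where
  "frob f = (\<lambda>(k, \<xi>). if k \<in> carrier K then restr (model_act N k f) \<xi> else 0)"

lemma frob_slice: "k \<in> carrier K \<Longrightarrow> (\<lambda>\<xi>. frob f (k, \<xi>)) = restr (model_act N k f)"
  by (simp add: frob_def)

lemma linear_frob: "linear_on S frob"
proof (rule linear_onI)
  fix f g
  have "restr (model_act N k (f + g)) = restr (model_act N k f) + restr (model_act N k g)" for k
    using linear_on_add[OF linear_model_act[of UNIV]] linear_on_add[OF linear_restr[of UNIV]] by simp
  then show "frob (f + g) = frob f + frob g" by (auto simp: frob_def fun_eq_iff fun_apply)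
next
  fix c f
  have "restr (model_act N k (cscale c f)) = cscale c (restr (model_act N k f))" for k
    using linear_on_scale[OF linear_model_act[of UNIV]] linear_on_scale[OF linear_restr[of UNIV]] by simp
  then show "frob (cscale c f) = cscale c (frob f)" by (auto simp: frob_def fun_eq_iff cscale_def)
qed

lemma frob_in_Ind:
  assumes f: "f \<in> rep_space M"
  shows "frob f \<in> rep_space Ind"
proof -
  have "(\<lambda>\<xi>. frob f (\<phi> h \<otimes>\<^bsub>K\<^esub> k, \<xi>)) = rep_act U h (\<lambda>\<xi>. frob f (k, \<xi>))"
    if h: "h \<in> carrier H" and k: "k \<in> carrier K" for h k
  proof -
    note hk = monoid.m_closed[OF group.is_monoid[OF group_wreath_group[OF G]] \<phi>_closed[OF h] k]
    show ?thesis
      unfolding frob_slice[OF hk] frob_slice[OF k] model_act_mult[OF \<phi>_closed[OF h] k f]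
      by (rule restr_equivariant[OF h model_act_closed[OF k f]])
  qed
  moreover have "(\<lambda>\<xi>. frob f (k, \<xi>)) \<in> rep_space U" if k: "k \<in> carrier K" for k
    unfolding frob_slice[OF k] by (rule restr_in_U[OF model_act_closed[OF k f]])
  ultimately show ?thesis unfolding Ind_def induced_rep_def by (simp add: frob_def)
qed

lemma Ind_act: "rep_act Ind g F = (\<lambda>(k, \<xi>). if k \<in> carrier K then F (k \<otimes>\<^bsub>K\<^esub> g, \<xi>) else 0)"
  by (simp add: Ind_def induced_rep_def fun_eq_iff)

lemma frob_equivariant:
  assumes g: "g \<in> carrier K" and f: "f \<in> rep_space M"
  shows "frob (model_act N g f) = rep_act Ind g (frob f)"
proof -
  have closed: "k \<otimes>\<^bsub>K\<^esub> g \<in> carrier K" if "k \<in> carrier K" for k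
    using monoid.m_closed[OF group.is_monoid[OF group_wreath_group[OF G]] that g] .
  show ?thesis
  proof (rule ext, clarify)
    fix s l \<xi>
    show "frob (model_act N g f) ((s, l), \<xi>) = rep_act Ind g (frob f) ((s, l), \<xi>)"
    proof (cases "(s, l) \<in> carrier K")
      case True
      show ?thesis
        unfolding Ind_act frob_def using True closed[OF True] model_act_mult[OF True g f] by simp
    qed (simp add: frob_def Ind_act)
  qed
qed

lemma model_local:
  assumes f: "f \<in> rep_space M" and y: "\<And>j. j \<in> {1..N} \<Longrightarrow> y j = y' j"
  shows "f y = f y'"
proof -
  have "subspace_fun {f :: _ \<Rightarrow> complex. f y = f y'}"
    by (rule fun_space.subspaceI) (auto simp: fun_apply)
  moreover have "{generator lam \<Theta> v | \<Theta> v. placement lam N \<Theta> v} \<subseteq> {f. f y = f y'}"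
  proof clarify
    fix \<Theta> v assume p: "placement lam N \<Theta> v"
    have *: "y (\<Theta> q) = y' (\<Theta> q)" if "q \<in> all_cells lam" for q using y placementD(3)[OF p that] .
    have "multi_sign lam \<Theta> y = multi_sign lam \<Theta> y'"
      unfolding multi_sign_def by (intro prod.cong refl column_sign_cong) (simp add: * all_cells_iff)
    moreover have "(\<Prod>q\<in>all_cells lam. site (fst q) (v q) (y (\<Theta> q))) = (\<Prod>q\<in>all_cells lam. site (fst q) (v q) (y' (\<Theta> q)))"
      by (intro prod.cong refl) (simp add: *)
    ultimately show "generator lam \<Theta> v y = generator lam \<Theta> v y'" by (simp add: generator_def)
  qed
  ultimately have "fun_space.span {generator lam \<Theta> v | \<Theta> v. placement lam N \<Theta> v} \<subseteq> {f. f y = f y'}"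
    by (intro fun_space.span_minimal)
  then show ?thesis using f unfolding model_def by auto
qed

lemma model_support:
  assumes f: "f \<in> rep_space M" and y: "f y \<noteq> 0"
  obtains \<Theta> where "bij_betw \<Theta> (all_cells lam) {1..N}"
    "\<And>q. q \<in> all_cells lam \<Longrightarrow> fst (y (\<Theta> q)) = fst q \<and> label (y (\<Theta> q)) \<in> carrier G"
proof -
  have "\<exists>\<Theta> v. placement lam N \<Theta> v \<and> generator lam \<Theta> v y \<noteq> 0"
  proof (rule ccontr)
    assume "\<not> ?thesis"
    then have "{generator lam \<Theta> v | \<Theta> v. placement lam N \<Theta> v} \<subseteq> {f. f y = 0}" by blast
    moreover have "subspace_fun {f :: _ \<Rightarrow> complex. f y = 0}"
      by (rule fun_space.subspaceI) (auto simp: fun_apply)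
    ultimately have "fun_space.span {generator lam \<Theta> v | \<Theta> v. placement lam N \<Theta> v} \<subseteq> {f. f y = 0}"
      by (rule fun_space.span_minimal)
    then show False using f y unfolding model_def by auto
  qed
  then obtain \<Theta> v where p: "placement lam N \<Theta> v" and nz: "generator lam \<Theta> v y \<noteq> 0" by blast
  have "site (fst q) (v q) (y (\<Theta> q)) \<noteq> 0" if q: "q \<in> all_cells lam" for q
  proof
    assume "site (fst q) (v q) (y (\<Theta> q)) = 0"
    then have "(\<Prod>q\<in>all_cells lam. site (fst q) (v q) (y (\<Theta> q))) = 0"
      by (intro prod_zero[OF finite_all_cells bexI[OF _ q]])
    then show False using nz by (simp add: generator_def)
  qed
  then have "fst (y (\<Theta> q)) = fst q \<and> label (y (\<Theta> q)) \<in> carrier G" if "q \<in> all_cells lam" for q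
    using that unfolding site_def by meson
  then show thesis using that[OF placementD(1)[OF p]] by blast
qed

text \<open>If a function of the model does not vanish at \<open>y\<close>, then the indices in \<open>y\<close> are those of some placement. Hence a
  permutation \<open>s\<close> moves every letter into the block of its index. Together with the labels of \<open>y\<close> it is an
  element \<open>k\<close> of the wreath product such that the value at \<open>y\<close> is the value of the translate by \<open>k\<close> at a
  point of the form \<open>point \<xi>\<close>.\<close>

lemma frob_injective:
  assumes f: "f \<in> rep_space M" and 0: "frob f = 0"
  shows "f = 0"
proof (rule ext, rule ccontr)
  fix y assume "f y \<noteq> 0 y"
  then have fy: "f y \<noteq> 0" by (simp add: zero_fun_apply)
  obtain \<Theta> where \<Theta>: "bij_betw \<Theta> (all_cells lam) {1..N}"
    and y: "\<And>q. q \<in> all_cells lam \<Longrightarrow> fst (y (\<Theta> q)) = fst q \<and> label (y (\<Theta> q)) \<in> carrier G"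
    using model_support[OF f fy] by blast
  define \<tau> where "\<tau> x = (SOME t. t \<in> tableaux (lam x))" for x
  have \<tau>: "bij_betw (\<tau> x) (cells (lam x)) {1..size_at x}" for x
  proof -
    have "\<tau> x \<in> tableaux (lam x)" unfolding \<tau>_def using tableaux_nonempty by (metis someI)
    then show ?thesis by (simp add: tableaux_def size_at_def)
  qed
  have \<tau>_in: "\<tau> x c \<in> {1..size_at x}" if "c \<in> cells (lam x)" for x c
    using bij_betwE[OF \<tau>[of x]] that by blast
  have \<tau>_inv: "inv_into (cells (lam x)) (\<tau> x) k \<in> cells (lam x)" if "k \<in> {1..size_at x}" for x k
    using bij_betwE[OF bij_betw_inv_into[OF \<tau>[of x]]] that by blast
  have "bij_betw (\<lambda>(x, c). (x, \<tau> x c)) (all_cells lam) blocks"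
    unfolding all_cells_def blocks_def
  proof (rule bij_betwI[where g = "\<lambda>(x, k). (x, inv_into (cells (lam x)) (\<tau> x) k)"])
    show "(\<lambda>(x, c). (x, \<tau> x c)) \<in> (SIGMA x:R. cells (lam x)) \<rightarrow> (SIGMA x:R. {1..size_at x})"
      using \<tau>_in by (auto simp del: atLeastAtMost_iff)
    show "(\<lambda>(x, k). (x, inv_into (cells (lam x)) (\<tau> x) k)) \<in> (SIGMA x:R. {1..size_at x}) \<rightarrow> (SIGMA x:R. cells (lam x))"
      using \<tau>_inv by (auto simp del: atLeastAtMost_iff)
  qed (auto simp: bij_betw_inv_into_left[OF \<tau>] bij_betw_inv_into_right[OF \<tau>] simp del: atLeastAtMost_iff)
  then have T: "bij_betw (e \<circ> (\<lambda>(x, c). (x, \<tau> x c))) (all_cells lam) {1..N}"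
    by (rule bij_betw_trans[OF _ e_bij])
  define s where "s j = (if j \<in> {1..N} then (e \<circ> (\<lambda>(x, c). (x, \<tau> x c))) (inv_into (all_cells lam) \<Theta> j) else j)" for j
  have "bij_betw ((e \<circ> (\<lambda>(x, c). (x, \<tau> x c))) \<circ> inv_into (all_cells lam) \<Theta>) {1..N} {1..N}"
    by (rule bij_betw_trans[OF bij_betw_inv_into[OF \<Theta>] T])
  then have "bij_betw s {1..N} {1..N}"
    by (rule iffD1[OF bij_betw_cong, rotated]) (simp add: s_def)
  then have s: "s permutes {1..N}" by (rule bij_imp_permutes) (unfold s_def, rule if_not_P)
  have sj: "pos (s j) = (fst (y j), snd (pos (s j)))" "label (y j) \<in> carrier G" if j: "j \<in> {1..N}" for j
  proof -
    obtain x c where xc: "inv_into (all_cells lam) \<Theta> j = (x, c)" by (metis surj_pair)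
    then have q: "(x, c) \<in> all_cells lam" "\<Theta> (x, c) = j"
      using bij_betwE[OF bij_betw_inv_into[OF \<Theta>]] bij_betw_inv_into_right[OF \<Theta> j] j by metis+
    have "(x, \<tau> x c) \<in> blocks"
      using q(1) \<tau>_in unfolding all_cells_iff blocks_iff by blast
    then have "pos (s j) = (x, \<tau> x c)" unfolding s_def using j xc by simp
    moreover have "fst (y j) = x" "label (y j) \<in> carrier G" using y[OF q(1)] unfolding q(2) by simp_all
    ultimately show "pos (s j) = (fst (y j), snd (pos (s j)))" "label (y j) \<in> carrier G" by simp_all
  qed
  define k where "k = (s, \<lambda>j\<in>{1..N}. label (y (inv' s j)))"
  define \<xi> where "\<xi> x = ((\<lambda>l. fst (snd (snd (y (inv' s (e (x, l))))))),
    (\<lambda>i. {l \<in> {1..size_at x}. row (y (inv' s (e (x, l)))) = i}))" for x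
  have inv_in: "inv' s j \<in> {1..N}" if "j \<in> {1..N}" for j
    using permutes_in_image[OF permutes_inv[OF s]] that by blast
  have s_in: "s j \<in> {1..N}" if "j \<in> {1..N}" for j using permutes_in_image[OF s] that by blast
  have k: "k \<in> carrier K"
    unfolding k_def carrier_wreath_group using s sj(2)[OF inv_in] by (intro conjI restrict_PiE_iff[THEN iffD2]) auto
  have valid: "\<forall>x\<in>R. row_partition (size_at x) (snd (\<xi> x))" 
    unfolding \<xi>_def snd_conv by (intro ballI row_partition_rows)
  have lab: "\<forall>j\<in>{1..N}. label (point \<xi> j) \<in> carrier G"
    using group.is_monoid[OF G] by (simp add: point_def label_def monoid.one_closed)
  have "shift (snd k (fst k j)) (point \<xi> (fst k j)) = y j" if j: "j \<in> {1..N}" for j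
  proof -
    have inv: "inv' s (s j) = j" by (rule permutes_inverses(2)[OF s])
    obtain x l where xl: "x \<in> R" "l \<in> {1..size_at x}" "s j = e (x, l)" "pos (s j) = (x, l)"
      using block_obtain[OF s_in[OF j]] by metis
    have x: "fst (y j) = x" using sj(1)[OF j] unfolding xl(4) by simp
    have l: "label (y j) \<in> carrier G" by (rule sj(2)[OF j])
    have sl: "snd k (s j) = label (y j)" unfolding k_def using s_in[OF j] inv by simp
    have ix: "inv' s (e (x, l)) = j" unfolding xl(3)[symmetric] by (rule inv)
    have r: "row_of (snd (\<xi> x)) l = row (y j)"
      unfolding \<xi>_def snd_conv using row_of_rows[OF xl(2), of "\<lambda>l. row (y (inv' s (e (x, l))))"] ix by simp
    have i: "fst (\<xi> x) l = fst (snd (snd (y j)))" by (simp add: \<xi>_def ix)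
    have "shift (snd k (fst k j)) (point \<xi> (fst k j)) = (x, \<one>\<^bsub>G\<^esub> \<otimes>\<^bsub>G\<^esub> label (y j), fst (snd (snd (y j))), row (y j))"
      using sl by (simp add: k_def shift_def point_def xl(4) label_def i r)
    also have "\<dots> = y j"
      using monoid.l_one[OF group.is_monoid[OF G] l] x by (simp add: label_def row_def prod_eq_iff)
    finally show ?thesis .
  qed
  then have "f (\<lambda>j. shift (snd k (fst k j)) (point \<xi> (fst k j))) = f y" by (rule model_local[OF f])
  then have "frob f (k, \<xi>) = f y"
    using k valid lab by (simp add: frob_def restr_def model_act_def)
  then show False using fy 0 by (simp add: zero_fun_apply)
qed

text \<open>The element of the induced representation that is supported on the block subgroup and has the value \<open>u\<close> at
  the identity. Translates of such elements span the induced representation.\<close>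

lemma bump_in_image:
  assumes u: "u \<in> rep_space U"
  shows "(\<lambda>(k, \<xi>). if k \<in> \<phi> ` carrier H then rep_act U (inv_into (carrier H) \<phi> k) u \<xi> else 0)
    \<in> frob ` rep_space M" (is "?bump u \<in> _")
proof -
  have inv: "inv_into (carrier H) \<phi> k \<in> carrier H" "\<phi> (inv_into (carrier H) \<phi> k) = k" if "k \<in> \<phi> ` carrier H" for k
    by (rule inv_into_into[OF that], rule f_inv_into_f[OF that])
  have "linear_on (rep_space U) ?bump"
  proof (rule linear_onI)
    fix u v assume uv: "u \<in> rep_space U" "v \<in> rep_space U"
    show "?bump (u + v) = ?bump u + ?bump v"
    proof (rule ext)
      fix z :: "((nat \<Rightarrow> nat) \<times> (nat \<Rightarrow> 'a)) \<times> ('c \<Rightarrow> (nat \<Rightarrow> nat) \<times> (nat \<Rightarrow> nat set))"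
      obtain k \<xi> where z: "z = (k, \<xi>)" by (cases z)
      show "?bump (u + v) z = (?bump u + ?bump v) z"
      proof (cases "k \<in> \<phi> ` carrier H")
        case True
        show ?thesis unfolding z using True linear_on_add[OF U_act(1)[OF inv(1)[OF True]] uv] by (simp add: plus_fun_apply)
      qed (simp add: z plus_fun_apply)
    qed
  next
    fix c u assume u: "u \<in> rep_space U"
    show "?bump (cscale c u) = cscale c (?bump u)"
    proof (rule ext)
      fix z :: "((nat \<Rightarrow> nat) \<times> (nat \<Rightarrow> 'a)) \<times> ('c \<Rightarrow> (nat \<Rightarrow> nat) \<times> (nat \<Rightarrow> nat set))"
      obtain k \<xi> where z: "z = (k, \<xi>)" by (cases z)
      show "?bump (cscale c u) z = cscale c (?bump u) z"
      proof (cases "k \<in> \<phi> ` carrier H")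
        case True
        show ?thesis unfolding z using True linear_on_scale[OF U_act(1)[OF inv(1)[OF True]] u] by (simp add: cscale_def)
      qed (simp add: z cscale_def)
    qed
  qed
  note lin = this[unfolded U_space]
  have sub: "subspace_fun (frob ` rep_space M)"
    by (rule subspace_image_linear_on[OF linear_frob representationD(1)[OF representation_model]])
  show ?thesis
  proof (rule linear_on_image_span[OF lin _ sub u[unfolded U_space]])
    fix F assume "F \<in> {pure t w | t w. admissible t w}"
    then obtain t w where a: "admissible t w" and F: "F = pure t w" by blast
    define \<Theta> where "\<Theta> q = e (fst q, t (fst q) (snd q))" for q
    define v where "v q = w (fst q) (t (fst q) (snd q))" for q
    have t: "bij_betw (t x) (cells (lam x)) {1..size_at x}"
      "\<And>k. k \<in> {1..size_at x} \<Longrightarrow> w x k \<in> rep_space (V x)" if "x \<in> R" for x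
      using a that unfolding admissible_def tableaux_def size_at_def by blast+
    have blk: "(fst q, t (fst q) (snd q)) \<in> blocks" if "q \<in> all_cells lam" for q
    proof -
      have x: "fst q \<in> R" "snd q \<in> cells (lam (fst q))" using that unfolding all_cells_def by auto
      show ?thesis using bij_betwE[OF t(1)[OF x(1)]] x unfolding blocks_iff by blast
    qed
    have "bij_betw (\<lambda>q. (fst q, t (fst q) (snd q))) (all_cells lam) blocks"
    proof (rule bij_betw_imageI)
      show "inj_on (\<lambda>q. (fst q, t (fst q) (snd q))) (all_cells lam)"
      proof (rule inj_onI)
        fix q q' assume q: "q \<in> all_cells lam" "q' \<in> all_cells lam"
          "(fst q, t (fst q) (snd q)) = (fst q', t (fst q') (snd q'))"
        obtain x c x' c' where eq: "q = (x, c)" "q' = (x', c')" by (metis surj_pair)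
        have x: "x' = x" "t x c = t x c'" using q(3) unfolding eq by auto
        have "x \<in> R" "c \<in> cells (lam x)" "c' \<in> cells (lam x)"
          using q(1,2) unfolding eq x(1) all_cells_iff by blast+
        then have "c = c'" using inj_onD[OF bij_betw_imp_inj_on[OF t(1)] x(2)] by blast
        then show "q = q'" unfolding eq x(1) by simp
      qed
      show "(\<lambda>q. (fst q, t (fst q) (snd q))) ` all_cells lam = blocks"
      proof (intro equalityI subsetI)
        fix b assume "b \<in> blocks"
        then obtain x k where b: "b = (x, k)" "x \<in> R" "k \<in> {1..size_at x}" unfolding blocks_def by blast
        then obtain c where "c \<in> cells (lam x)" "k = t x c" using bij_betw_imp_surj_on[OF t(1)] by blast
        then show "b \<in> (\<lambda>q. (fst q, t (fst q) (snd q))) ` all_cells lam"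
          using b by (intro image_eqI[of _ _ "(x, c)"]) (simp_all add: all_cells_iff)
      qed (use blk in blast)
    qed
    from bij_betw_trans[OF this e_bij] have "bij_betw \<Theta> (all_cells lam) {1..N}"
      by (simp add: \<Theta>_def[abs_def] comp_def)
    moreover have "v q \<in> rep_space (V (fst q))" if q: "q \<in> all_cells lam" for q
      unfolding v_def using blk[OF q] t(2)[of "fst q" "t (fst q) (snd q)"] blocks_iff by blast
    ultimately have p: "placement lam N \<Theta> v" unfolding placement_def by blast
    have restr: "restr (generator lam \<Theta> v) = pure t w"
      by (rule restr_generator[OF a]) (simp_all add: \<Theta>_def v_def)
    note gM = generator_in_model[OF p]
    have "?bump (pure t w) = frob (generator lam \<Theta> v)"
    proof (rule ext)
      fix z :: "((nat \<Rightarrow> nat) \<times> (nat \<Rightarrow> 'a)) \<times> ('c \<Rightarrow> (nat \<Rightarrow> nat) \<times> (nat \<Rightarrow> nat set))"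
      obtain k \<xi> where z: "z = (k, \<xi>)" by (cases z)
      have "(if k \<in> \<phi> ` carrier H then rep_act U (inv_into (carrier H) \<phi> k) (pure t w) \<xi> else 0) =
          frob (generator lam \<Theta> v) (k, \<xi>)"
      proof (cases "k \<in> carrier K")
        case kK: True
        show ?thesis
        proof (cases "k \<in> \<phi> ` carrier H")
          case True
          have "restr (model_act N k (generator lam \<Theta> v)) = rep_act U (inv_into (carrier H) \<phi> k) (pure t w)"
            using restr_equivariant[OF inv(1)[OF True] gM] unfolding inv(2)[OF True] restr .
          then show ?thesis using True kK by (simp add: frob_def)
        next
          case False
          have "\<not> standard (fst k \<circ> \<Theta>)"
          proof
            assume s: "standard (fst k \<circ> \<Theta>)"
            have "fst (pos (fst k (e (x, l)))) = x" if b: "(x, l) \<in> blocks" for x l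
            proof -
              have "x \<in> R" "l \<in> {1..size_at x}" using b blocks_iff by blast+
              then obtain c where c: "c \<in> cells (lam x)" "l = t x c" using bij_betw_imp_surj_on[OF t(1)] by blast
              then have "(x, c) \<in> all_cells lam" using \<open>x \<in> R\<close> all_cells_iff by blast
              then have "fst (pos ((fst k \<circ> \<Theta>) (x, c))) = fst (x, c)" using s unfolding standard_def by blast
              then show ?thesis by (simp add: \<Theta>_def c(2))
            qed
            then show False using \<phi>_surj[OF kK] False by blast
          qed
          then have "restr (model_act N k (generator lam \<Theta> v)) = 0"
            unfolding model_act_generator[OF kK p] by (rule restr_nonstandard)
          then show ?thesis using False by (simp add: frob_def zero_fun_apply)
        qed
      next
        case False
        then have "k \<notin> \<phi> ` carrier H" using \<phi>_closed by blast
        then show ?thesis using False by (simp add: frob_def)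
      qed
      then show "?bump (pure t w) z = frob (generator lam \<Theta> v) z" unfolding z case_prod_conv .
    qed
    then show "?bump F \<in> frob ` rep_space M" unfolding F using gM by blast
  qed
qed

text \<open>Let \<open>b k\<close> be supported on the block subgroup, with the value of \<open>F\<close> at \<open>k\<close> as its value at the identity. The
  translate of \<open>b k\<close> by \<open>k\<inverse>\<close> agrees with \<open>F\<close> on the coset of \<open>k\<close> and vanishes elsewhere. The sum of these
  translates over all \<open>k\<close> counts every coset as often as it has elements, whence the factor \<open>c\<close>.\<close>

lemma frob_surjective:
  assumes fin: "finite (carrier G)" and F: "F \<in> rep_space Ind"
  shows "F \<in> frob ` rep_space M"
proof -
  interpret W: group K by (rule group_wreath_group[OF G])
  have FU: "\<And>k. k \<in> carrier K \<Longrightarrow> (\<lambda>\<xi>. F (k, \<xi>)) \<in> rep_space U"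
    and F0: "\<And>k \<xi>. k \<notin> carrier K \<Longrightarrow> F (k, \<xi>) = 0"
    and FH: "\<And>h k. h \<in> carrier H \<Longrightarrow> k \<in> carrier K \<Longrightarrow>
      (\<lambda>\<xi>. F (\<phi> h \<otimes>\<^bsub>K\<^esub> k, \<xi>)) = rep_act U h (\<lambda>\<xi>. F (k, \<xi>))"
    using F unfolding Ind_def induced_rep_def by auto
  let ?P = "\<phi> ` carrier H"
  have finK: "finite (carrier K)" by (rule finite_wreath_group[OF fin])
  have PK: "?P \<subseteq> carrier K" using \<phi>_closed by blast
  have "group H" unfolding H_def by (rule product_group) (rule group_wreath_group[OF G])
  then have "?P \<noteq> {}" using group.is_monoid monoid.one_closed by blast
  then have card: "card ?P > 0" using finite_subset[OF PK finK] by (simp add: card_gt_0_iff)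
  define b where "b k = (\<lambda>(l, \<xi>). if l \<in> ?P then rep_act U (inv_into (carrier H) \<phi> l) (\<lambda>\<xi>. F (k, \<xi>)) \<xi> else 0)" for k
  have b: "b k \<in> frob ` rep_space M" if "k \<in> carrier K" for k
    unfolding b_def by (rule bump_in_image[OF FU[OF that]])
  have bF: "b k (l, \<xi>) = (if l \<in> ?P then F (l \<otimes>\<^bsub>K\<^esub> k, \<xi>) else 0)" if k: "k \<in> carrier K" for k l \<xi>
  proof (cases "l \<in> ?P")
    case True
    have i: "inv_into (carrier H) \<phi> l \<in> carrier H" "\<phi> (inv_into (carrier H) \<phi> l) = l"
      by (rule inv_into_into[OF True], rule f_inv_into_f[OF True])
    show ?thesis using fun_cong[OF FH[OF i(1) k], of \<xi>] True unfolding i(2) by (simp add: b_def)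
  qed (simp add: b_def)
  define c :: complex where "c = 1 / of_nat (card ?P)"
  have "F = (\<Sum>k\<in>carrier K. cscale c (rep_act Ind (inv\<^bsub>K\<^esub> k) (b k)))"
  proof (rule ext, clarify)
    fix s :: "nat \<Rightarrow> nat" and g :: "nat \<Rightarrow> 'a" and \<xi>
    let ?l = "(s, g)"
    show "F (?l, \<xi>) = (\<Sum>k\<in>carrier K. cscale c (rep_act Ind (inv\<^bsub>K\<^esub> k) (b k))) (?l, \<xi>)"
    proof (cases "?l \<in> carrier K")
      case False
      then show ?thesis using F0[OF False] by (simp add: sum_fun_apply cscale_def Ind_act)
    next
      case l: True
      have bij: "bij_betw (\<lambda>k. ?l \<otimes>\<^bsub>K\<^esub> inv\<^bsub>K\<^esub> k) (carrier K) (carrier K)"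
        by (rule bij_betwI[where g = "\<lambda>k. inv\<^bsub>K\<^esub> k \<otimes>\<^bsub>K\<^esub> ?l"])
          (use l in \<open>auto simp: W.inv_mult_group W.m_assoc[symmetric] W.r_inv\<close>,
            simp_all add: W.m_assoc W.l_inv)
      have "(\<Sum>k\<in>carrier K. cscale c (rep_act Ind (inv\<^bsub>K\<^esub> k) (b k))) (?l, \<xi>) =
          (\<Sum>k\<in>carrier K. c * b k (?l \<otimes>\<^bsub>K\<^esub> inv\<^bsub>K\<^esub> k, \<xi>))"
        using l by (simp add: sum_fun_apply cscale_def Ind_act)
      also have "\<dots> = (\<Sum>k\<in>carrier K. if ?l \<otimes>\<^bsub>K\<^esub> inv\<^bsub>K\<^esub> k \<in> ?P then c * F (?l, \<xi>) else 0)"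
      proof (rule sum.cong[OF refl])
        fix k assume k: "k \<in> carrier K"
        have "?l \<otimes>\<^bsub>K\<^esub> inv\<^bsub>K\<^esub> k \<otimes>\<^bsub>K\<^esub> k = ?l"
          using W.m_assoc[OF l W.inv_closed[OF k] k] W.l_inv[OF k] W.r_one[OF l] by (simp only:)
        then show "c * b k (?l \<otimes>\<^bsub>K\<^esub> inv\<^bsub>K\<^esub> k, \<xi>) = (if ?l \<otimes>\<^bsub>K\<^esub> inv\<^bsub>K\<^esub> k \<in> ?P then c * F (?l, \<xi>) else 0)"
          unfolding bF[OF k] by (simp only: if_distrib[of "(*) c"] mult_zero_right)
      qed
      also have "\<dots> = (\<Sum>k\<in>carrier K. if k \<in> ?P then c * F (?l, \<xi>) else 0)"
        by (rule sum.reindex_bij_betw[OF bij, of "\<lambda>k. if k \<in> ?P then c * F (?l, \<xi>) else 0"])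
      also have "\<dots> = (\<Sum>k\<in>?P. c * F (?l, \<xi>))"
        unfolding sum.inter_restrict[OF finK, symmetric] using PK by (simp add: Int_absorb1)
      also have "\<dots> = F (?l, \<xi>)" using card by (simp add: c_def)
      finally show ?thesis by simp
    qed
  qed
  moreover have "(\<Sum>k\<in>carrier K. cscale c (rep_act Ind (inv\<^bsub>K\<^esub> k) (b k))) \<in> frob ` rep_space M"
  proof -
    have sub: "subspace_fun (frob ` rep_space M)"
      by (rule subspace_image_linear_on[OF linear_frob representationD(1)[OF representation_model]])
    show ?thesis
    proof (intro fun_space.subspace_sum[OF sub] fun_space.subspace_scale[OF sub])
      fix k assume k: "k \<in> carrier K"
      obtain f where f: "f \<in> rep_space M" "b k = frob f" using b[OF k] by blast
      show "rep_act Ind (inv\<^bsub>K\<^esub> k) (b k) \<in> frob ` rep_space M"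
        unfolding f(2) frob_equivariant[OF W.inv_closed[OF k] f(1), symmetric]
        by (rule imageI[OF model_act_closed[OF W.inv_closed[OF k] f(1)]])
    qed
  qed
  ultimately show ?thesis by metis
qed

theorem model_iso_Ind:
  assumes fin: "finite (carrier G)"
  shows "rep_iso K M Ind" "representation K Ind" "finite_dim (rep_space Ind)"
proof -
  have act: "rep_act M = model_act N" by (simp add: model_def)
  have T: "intertwiner K M Ind frob"
    unfolding intertwiner_def act
    using linear_frob frob_in_Ind frob_equivariant by (intro conjI ballI) blast+
  have inj: "inj_on frob (rep_space M)"
    using linear_on_inj_iff[OF linear_frob representationD(1)[OF representation_model]] frob_injective by blast
  have img: "frob ` rep_space M = rep_space Ind"
    using frob_in_Ind frob_surjective[OF fin] by blast
  have bij: "bij_betw frob (rep_space M) (rep_space Ind)" using inj img by (simp add: bij_betw_def)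
  show "rep_iso K M Ind" unfolding rep_iso_iff using T bij by blast
  show "representation K Ind"
    by (rule representation_iso_transport[OF representation_model T bij group_wreath_group[OF G]])
  show "finite_dim (rep_space Ind)"
    unfolding img[symmetric]
    by (rule finite_dim_image[OF finite_dim_model representationD(1)[OF representation_model] linear_frob])
qed

end

section \<open>Stability\<close>

lemma wreath_irrep_stable:
  fixes G :: "('g, 'b) monoid_scheme"
  assumes grp: "group G" "finite (carrier G)"
  obtains d N where "\<And>n. n \<ge> N \<Longrightarrow> representation (wreath_group n G) (wreath_irrep G (pad G lam n))"
    and "\<And>n. n \<ge> N \<Longrightarrow> finite_dim (rep_space (wreath_irrep G (pad G lam n)))"
    and "\<And>n. n \<ge> N \<Longrightarrow> grows_stably G d n (wreath_irrep G (pad G lam n)) (wreath_irrep G (pad G lam (Suc n)))"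
proof -
  let ?R = "irreps G" and ?x = "trivial_class G"
  define V where "V x = (SOME V. V \<in> x)" for x :: "('g, nat) rep set"
  have irr: "irreducible_rep G (V x)" if "x \<in> ?R" for x unfolding V_def by (rule irrep_representative(1)[OF that])
  interpret wreath_model G ?R V
  proof (rule wreath_model.intro)
    fix x assume x: "x \<in> ?R"
    show "representation G (V x)" using irr[OF x] unfolding irreducible_rep_def by (rule conjunct1)
    show "finite_dim (rep_space (V x))" by (rule finite_dim_irreducible[OF grp irr[OF x]])
  qed (rule grp(1), rule finite_irreps[OF grp])
  have x: "?x \<in> ?R" by (rule trivial_class_irrep[OF grp(1)])
  have "\<exists>e. rep_space (V ?x) = range (\<lambda>c. cscale c e)"
    unfolding V_def by (rule trivial_class_line[OF irrep_representative(2)[OF x]]) (rule exI)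
  then obtain e where e: "rep_space (V ?x) = range (\<lambda>c. cscale c e)" ..
  define t where "t = total_size G lam"
  define ks where "ks = lam ?x"
  interpret first_row G ?R V ?x lam ks e
    by unfold_locales (rule x, rule e)
  have pad: "pad G lam n = lam_row (n - t)" for n
    unfolding pad_def lam_row_def unfolding ks_def t_def ..
  have total: "(\<Sum>x\<in>?R. sum_list (pad G lam n x)) = n" if "n \<ge> t" for n
  proof -
    have "(\<Sum>x\<in>?R. sum_list (pad G lam n x)) = (n - t) + sum_list (lam ?x) + (\<Sum>x\<in>?R - {?x}. sum_list (pad G lam n x))"
      unfolding sum.remove[OF finite_R x] by (simp add: pad_def t_def)
    also have "(\<Sum>x\<in>?R - {?x}. sum_list (pad G lam n x)) = (\<Sum>x\<in>?R - {?x}. sum_list (lam x))"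
      by (intro sum.cong refl) (simp add: pad_def)
    also have "(n - t) + sum_list (lam ?x) + (\<Sum>x\<in>?R - {?x}. sum_list (lam x)) = (n - t) + t"
      unfolding t_def total_size_def sum.remove[OF finite_R x] by simp
    finally show ?thesis using that by simp
  qed
  have iso: "rep_iso (wreath_group n G) (model (lam_row (n - t)) n) (wreath_irrep G (pad G lam n))"
    "representation (wreath_group n G) (wreath_irrep G (pad G lam n))"
    "finite_dim (rep_space (wreath_irrep G (pad G lam n)))" if n: "n \<ge> t" for n
  proof -
    interpret I: induction_model G ?R V "pad G lam n" by unfold_locales
    have N: "I.N = n" unfolding I.N_def I.size_at_def by (rule total[OF n])
    have Ind: "I.Ind = wreath_irrep G (pad G lam n)"
      unfolding I.Ind_def I.H_def I.\<phi>_def I.U_def wreath_irrep_def Let_def V_def N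
      using total[OF n] by (simp add: total_size_def I.size_at_def[abs_def])
    show "rep_iso (wreath_group n G) (model (lam_row (n - t)) n) (wreath_irrep G (pad G lam n))"
      "representation (wreath_group n G) (wreath_irrep G (pad G lam n))"
      "finite_dim (rep_space (wreath_irrep G (pad G lam n)))"
      using I.model_iso_Ind[OF grp(2)] unfolding N Ind unfolding pad by this
  qed
  have "grows_stably G (card core) n (wreath_irrep G (pad G lam n)) (wreath_irrep G (pad G lam (Suc n)))"
    if n: "n \<ge> t + sum_list ks" for n
  proof (rule grows_stably_iso[OF grp(1) representation_model representation_model iso(1) iso(1)])
    have "sum_list ks \<le> n - t" "Suc n - t = Suc (n - t)" using n by simp_all
    then show "grows_stably G (card core) n (model (lam_row (n - t)) n) (model (lam_row (Suc n - t)) (Suc n))"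
      using model_grows_stably by simp
  qed (use n in simp_all)
  then show thesis using that[of "t + sum_list ks" "card core"] iso by simp
qed

theorem theorem3p2p2:
  fixes G :: "('g, 'b) monoid_scheme"
    and lam mu nu :: "('g, nat) rep set \<Rightarrow> nat list"
  assumes "group G" and "finite (carrier G)"
    and "partition_valued G lam" and "partition_valued G mu" and "partition_valued G nu"
  shows "\<exists>m N. \<forall>n\<ge>N.
    has_multiplicity (wreath_group n G)
      (wreath_irrep G (pad G nu n))
      (tensor_rep (wreath_irrep G (pad G lam n)) (wreath_irrep G (pad G mu n)))
      m"
proof -
  note G = assms(1,2)
  obtain a A where a: "\<And>n. n \<ge> A \<Longrightarrow> representation (wreath_group n G) (wreath_irrep G (pad G lam n))"
    "\<And>n. n \<ge> A \<Longrightarrow> finite_dim (rep_space (wreath_irrep G (pad G lam n)))"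
    "\<And>n. n \<ge> A \<Longrightarrow> grows_stably G a n (wreath_irrep G (pad G lam n)) (wreath_irrep G (pad G lam (Suc n)))"
    using wreath_irrep_stable[OF G, of lam] by metis
  obtain b B where b: "\<And>n. n \<ge> B \<Longrightarrow> representation (wreath_group n G) (wreath_irrep G (pad G mu n))"
    "\<And>n. n \<ge> B \<Longrightarrow> finite_dim (rep_space (wreath_irrep G (pad G mu n)))"
    "\<And>n. n \<ge> B \<Longrightarrow> grows_stably G b n (wreath_irrep G (pad G mu n)) (wreath_irrep G (pad G mu (Suc n)))"
    using wreath_irrep_stable[OF G, of mu] by metis
  obtain c C where c: "\<And>n. n \<ge> C \<Longrightarrow> representation (wreath_group n G) (wreath_irrep G (pad G nu n))"
    "\<And>n. n \<ge> C \<Longrightarrow> finite_dim (rep_space (wreath_irrep G (pad G nu n)))"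
    "\<And>n. n \<ge> C \<Longrightarrow> grows_stably G c n (wreath_irrep G (pad G nu n)) (wreath_irrep G (pad G nu (Suc n)))"
    using wreath_irrep_stable[OF G, of nu] by metis
  show ?thesis
    by (rule stable_multiplicity[where N = "max A (max B C)", OF G a(1) b(1) c(1) a(2) b(2) c(2) a(3) b(3) c(3)])
      simp_all
qed

end
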